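(* Let $n\ge2$. Suppose that for every $p\in\mathbb{N}$, every $K\in\mathcal{K}(\mathbb{R}^n)$ with $\dim(K)=n$, and every $t\in[0,1]$, there exists $x\in K$ such that $$\frac{\left|-t\Delta_p(K-x)\vee(1-t)(K-x)^p\right|}{|K|^p}\leq\frac{\left|-t\Delta_pS_n\vee(1-t)(S_n)^p\right|}{|S_n|^p},$$ where $S_n\in\mathcal{K}(\mathbb{R}^n)$ is a centered $n$-simplex. Then for every $p\in\mathbb{N}$, every $0\le j\le n$ and every $K\in\mathcal{K}(\mathbb{R}^n)$ one has $$V\big(-\Delta_pK[j],K^p[np-j]\big)\leq\binom nj|K|^p.$$
   Context: $\mathcal{K}(\mathbb{R}^n)$ denotes the set of convex bodies, i.e. nonempty compact convex subsets of $\mathbb{R}^n$; $|\cdot|$ is Lebesgue measure (in the dimension of the ambient space); $\dim K$ is the dimension of the affine span of $K$; $K-x$ is the translate $K+\{-x\}$. An $n$-simplex is the convex hull of $n+1$ affinely independent points $v_0,\dots,v_n\in\mathbb{R}^n$; it is centered if $v_0+\dots+v_n=0$. $K_1\vee K_2=\mathrm{conv}(K_1\cup K_2)$. The mixed volume of $K_1,\dots,K_N\in\mathcal{K}(\mathbb{R}^N)$ is $V(K_1,\dots,K_N)=\frac1{N!}\frac{\partial^N}{\partial t_1\cdots\partial t_N}\big|_{t_1=\dots=t_N=0}|t_1K_1+\dots+t_NK_N|$ (Minkowski sums; the volume is a homogeneous polynomial of degree $N$ in $t_1,\dots,t_N\ge0$). $L[k]$ means that $L$ is repeated $k$ times. Identify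 $\mathbb{R}^{np}=(\mathbb{R}^n)^p$; $\Delta_p:\mathbb{R}^n\to\mathbb{R}^{np}$, $\Delta_p(x)=(x,\dots,x)$; $-t\Delta_pK=\{-t\Delta_p(x):x\in K\}$; $K^p=K\times\cdots\times K\subset\mathbb{R}^{np}$. (The right-hand side of the hypothesis does not depend on the choice of the centered $n$-simplex, by linear invariance.) *)

theory Defs
  imports
    "HOL-Analysis.Analysis"
    "HOL-Library.Function_Algebras"
    "HOL-Library.Set_Algebras"
begin

text \<open>
  Since \<open>p\<close> is quantified inside the formulas, \<open>E\<^sup>p\<close> cannot be a type depending on \<open>p\<close>.  It is
  represented by the subspace of all \<open>x :: nat \<Rightarrow> E\<close> with \<open>x i = 0\<close> for \<open>i \<ge> p\<close>, which inherits
  its convex hulls, dilates and Minkowski sums from the pointwise vector space structure below.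
\<close>

instantiation "fun" :: (type, real_vector) real_vector
begin

definition scaleR_fun :: "real \<Rightarrow> ('a \<Rightarrow> 'b) \<Rightarrow> 'a \<Rightarrow> 'b"
  where "scaleR_fun c f = (\<lambda>x. c *\<^sub>R f x)"

instance
  by standard (auto simp: scaleR_fun_def plus_fun_def scaleR_add_right scaleR_add_left)

end

definition convex_body :: "'a::euclidean_space set \<Rightarrow> bool"
  where "convex_body K \<longleftrightarrow> K \<noteq> {} \<and> compact K \<and> convex K"

text \<open>Full-dimensional simplices with vertex sum \<open>0\<close>; \<open>C\<close> is the vertex set.\<close>

definition centered_simplex :: "'a::euclidean_space set \<Rightarrow> bool"
  where "centered_simplex S \<longleftrightarrow>
    (\<exists>C. \<not> affine_dependent C \<and> card C = DIM('a) + 1 \<and> \<Sum>C = 0 \<and> S = convex hull C)"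

definition join :: "'a::real_vector set \<Rightarrow> 'a set \<Rightarrow> 'a set"  (infixl \<open>\<or>\<^sub>c\<close> 65)
  where "A \<or>\<^sub>c B = convex hull (A \<union> B)"

definition translate_by :: "'a::real_vector set \<Rightarrow> 'a \<Rightarrow> 'a set"
  where "translate_by K x = (\<lambda>y. y - x) ` K"

definition dilate :: "real \<Rightarrow> 'a::real_vector set \<Rightarrow> 'a set"
  where "dilate c A = (\<lambda>x. c *\<^sub>R x) ` A"

definition diag :: "nat \<Rightarrow> 'a::zero \<Rightarrow> nat \<Rightarrow> 'a"
  where "diag p x = (\<lambda>i. if i < p then x else 0)"

definition cart_power :: "nat \<Rightarrow> 'a::zero set \<Rightarrow> (nat \<Rightarrow> 'a) set"
  where "cart_power p K = {x. (\<forall>i<p. x i \<in> K) \<and> (\<forall>i\<ge>p. x i = 0)}"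

text \<open>
  Lebesgue measure of a subset of \<open>E\<^sup>p\<close>.  Restriction to \<open>{..<p}\<close> translates the representation by
  functions vanishing outside \<open>{..<p}\<close> into the representation by extensional functions on which
  the product measure lives.
\<close>

definition vol :: "nat \<Rightarrow> (nat \<Rightarrow> 'a::euclidean_space) set \<Rightarrow> real"
  where "vol p A = measure (\<Pi>\<^sub>M i\<in>{..<p}. lborel) ((\<lambda>x. restrict x {..<p}) ` A)"

text \<open>
  The volume polynomial lives on the orthant \<open>t\<^sub>i \<ge> 0\<close> only, so at \<open>t\<^sub>i = 0\<close> its partial derivatives
  are one-sided.
\<close>

definition orthant_partial :: "nat \<Rightarrow> ((nat \<Rightarrow> real) \<Rightarrow> real) \<Rightarrow> (nat \<Rightarrow> real) \<Rightarrow> real"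
  where "orthant_partial i f t =
    vector_derivative (\<lambda>s. f (t(i := s))) (at (t i) within {0..})"

text \<open>
  Mixed volume of a list of convex bodies in \<open>E\<^sup>p\<close>; it is meaningful when the length of the list is
  the dimension \<open>DIM(E) * p\<close>.  The sum is the Minkowski sum.
\<close>

definition mixed_volume :: "nat \<Rightarrow> (nat \<Rightarrow> 'a::euclidean_space) set list \<Rightarrow> real"
  where "mixed_volume p Ks =
    (let N = length Ks
     in foldr orthant_partial [0..<N] (\<lambda>t. vol p (\<Sum>i<N. dilate (t i) (Ks ! i))) (\<lambda>_. 0) / fact N)"

end

theory Submission
  imports Defs "HOL-Computational_Algebra.Polynomial"
begin

text \<open>
  Put \<open>A = -\<Delta>\<^sub>p(K - x)\<close>, \<open>B = (K - x)\<^sup>p\<close>, \<open>N = np\<close> and \<open>t = (j + 1) / (n + 2)\<close>.  Mixed volumes are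
  monotone and \<open>tA\<close>, \<open>(1 - t)B\<close> lie in their join, so
  \<open>t\<^sup>j (1 - t)\<^sup>N\<^sup>-\<^sup>j V(A[j], B[N - j]) \<le> |tA \<or> (1 - t)B|\<close>, and by the hypothesis it remains to bound the join
  volume for the simplex by \<open>(n choose j) t\<^sup>j (1 - t)\<^sup>N\<^sup>-\<^sup>j |S|\<^sup>p\<close>.

  Monotonicity: for polytopes, a regular triangulation of the cone over the Cayley configuration
  \<open>U \<times> {0} \<union> W \<times> {1}\<close> cuts \<open>a conv U + b conv W\<close> into cells of volume \<open>d a\<^sup>k b\<^sup>N\<^sup>-\<^sup>k\<close>.  Heights growing fast
  enough along an enumeration make it extend to a triangulation for \<open>U \<union> W\<close> in both places, whose
  coefficients are those of \<open>(a + b)\<^sup>N |conv (U \<union> W)|\<close>; hence coefficientwise comparison.  General bodies are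
  limits of inscribed polytopes.

  The simplex: the smallest homothet of \<open>S\<close> containing all \<open>y\<^sub>k\<close> reduces the join in the \<open>p\<close>-th power to \<open>p = 1\<close>
  by Fubini.  For \<open>p = 1\<close> and \<open>j \<le> (n + 1)t \<le> j + 1\<close> the join is covered by the simplices
  spanned by \<open>0\<close>, \<open>j\<close> of the vertices of \<open>-tS\<close> and \<open>n - j\<close> of the complementary vertices of \<open>(1 - t)S\<close>.
\<close>

section \<open>Lebesgue measure on products and linear coordinates\<close>

text \<open>The power of the space is a subspace of an infinite-dimensional function type. Linear
  images in it are measured by uniqueness of Haar measure, up to a constant that is never evaluated:
  only two images under the same map are compared, or an image is null. Mixed volumes are needed for
  two bodies only. Then \<open>V(A[j], B[N - j])\<close> is the coefficient of
  \<open>a^j b^(N - j)\<close> in the volume of aA + bB, divided by \<open>N choose j\<close>, and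
  monotonicity shrinks to a coefficientwise bound by \<open>(a + b)^N |conv (A \<union> B)|\<close>.
  That is why one triangulation has to sit inside another. Nothing is lost in the end, because the
  window \<open>j \<le> (n + 1) t \<le> j + 1\<close> is the one in which a single j serves all
  cells of the simplex join, so that its bound carries exactly the factor
  \<open>t^j (1 - t)^(N - j)\<close> that cancels. For the simplex an upper bound is enough: the
  cells only have to cover, and the Fubini constant is bounded through the power of the simplex
  itself instead of being computed. The hypothesis speaks of bodies of full dimension; for flat ones
  the volume polynomial vanishes identically.\<close>

lemma PiM_lborel_scale:
  fixes r :: "'i \<Rightarrow> real"
  assumes I: "finite I" and r: "\<And>i. i \<in> I \<Longrightarrow> r i \<noteq> 0"
    and X: "X \<in> sets (Pi\<^sub>M I (\<lambda>_. lborel :: 'a::euclidean_space measure))"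
  shows "emeasure (Pi\<^sub>M I (\<lambda>_. lborel :: 'a measure)) ((\<lambda>x. \<lambda>i\<in>I. r i *\<^sub>R x i) ` X)
     = (\<Prod>i\<in>I. ennreal (\<bar>r i\<bar> ^ DIM('a))) * emeasure (Pi\<^sub>M I (\<lambda>_. lborel)) X"
    and "(\<lambda>x. \<lambda>i\<in>I. r i *\<^sub>R x i) ` X \<in> sets (Pi\<^sub>M I (\<lambda>_. lborel :: 'a measure))"
proof -
  let ?M = "Pi\<^sub>M I (\<lambda>_. lborel :: 'a measure)"
  let ?f = "\<lambda>x. \<lambda>i\<in>I. inverse (r i) *\<^sub>R x i :: 'a"
  let ?c = "\<Prod>i\<in>I. ennreal (\<bar>r i\<bar> ^ DIM('a))"
  interpret product_sigma_finite "\<lambda>_::'i. lborel :: 'a measure" by standard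
  have f [measurable]: "?f \<in> measurable ?M ?M" by measurable
  \<comment> \<open>The pushforward under the inverse scaling, divided by the expected factor,
    agrees with the product measure on boxes. The factors may vary with the coordinate, because
    cells are later stretched differently along two groups of vertices.\<close>
  have *: "scale_measure (inverse ?c) (distr ?M ?M ?f) = ?M"
  proof (rule PiM_eqI)
    fix A :: "'i \<Rightarrow> 'a set" assume A: "\<And>i. i \<in> I \<Longrightarrow> A i \<in> sets lborel"
    have 1: "emeasure lborel ((\<lambda>x. inverse (r i) *\<^sub>R x) -` A i)
         = ennreal (\<bar>r i\<bar> ^ DIM('a)) * emeasure lborel (A i)" if i: "i \<in> I" for i
    proof -
      have "emeasure lborel (A i) = emeasure (density (distr lborel borel (\<lambda>x. 0 + inverse (r i) *\<^sub>R x)) (\<lambda>_. \<bar>inverse (r i)\<bar>^DIM('a))) (A i)"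
        using lborel_affine[of "inverse (r i)" "0::'a"] r[OF i] by simp
      also have "\<dots> = ennreal (\<bar>inverse (r i)\<bar> ^ DIM('a)) * emeasure lborel ((\<lambda>x. inverse (r i) *\<^sub>R x) -` A i)"
        using A[OF i] by (subst emeasure_density) (auto simp: nn_integral_cmult_indicator emeasure_distr)
      finally have "emeasure lborel (A i) = ennreal (\<bar>inverse (r i)\<bar> ^ DIM('a)) * emeasure lborel ((\<lambda>x. inverse (r i) *\<^sub>R x) -` A i)" .
      then have "ennreal (\<bar>r i\<bar> ^ DIM('a)) * emeasure lborel (A i)
         = (ennreal (\<bar>r i\<bar> ^ DIM('a)) * ennreal (\<bar>inverse (r i)\<bar> ^ DIM('a))) * emeasure lborel ((\<lambda>x. inverse (r i) *\<^sub>R x) -` A i)"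
        by (simp add: mult.assoc)
      also have "ennreal (\<bar>r i\<bar> ^ DIM('a)) * ennreal (\<bar>inverse (r i)\<bar> ^ DIM('a)) = 1"
        using r[OF i] by (simp flip: ennreal_mult power_mult_distrib abs_mult)
      finally show ?thesis by simp
    qed
    have pre: "?f -` Pi\<^sub>E I A \<inter> space ?M = Pi\<^sub>E I (\<lambda>i. (\<lambda>x. inverse (r i) *\<^sub>R x) -` A i)"
      by (auto simp: space_PiM PiE_iff)
    have ms: "(\<lambda>x. inverse (r i) *\<^sub>R x) -` A i \<in> sets lborel" if "i \<in> I" for i
      using measurable_sets[of "\<lambda>x. inverse (r i) *\<^sub>R x" lborel lborel "A i"] A[OF that] by simp
    have "emeasure (distr ?M ?M ?f) (Pi\<^sub>E I A) = (\<Prod>i\<in>I. emeasure lborel ((\<lambda>x. inverse (r i) *\<^sub>R x) -` A i))"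
      using A I ms by (subst emeasure_distr) (auto simp: pre emeasure_PiM sets_PiM_I_finite)
    also have "\<dots> = ?c * (\<Prod>i\<in>I. emeasure lborel (A i))"
      by (simp add: 1 prod.distrib)
    finally have "emeasure (scale_measure (inverse ?c) (distr ?M ?M ?f)) (Pi\<^sub>E I A) = inverse ?c * (?c * (\<Prod>i\<in>I. emeasure lborel (A i)))"
      by simp
    also have "\<dots> = (\<Prod>i\<in>I. emeasure lborel (A i))"
    proof -
      have "?c = ennreal (\<Prod>i\<in>I. \<bar>r i\<bar> ^ DIM('a))" by (simp add: prod_ennreal)
      moreover have "(\<Prod>i\<in>I. \<bar>r i\<bar> ^ DIM('a)) > 0" using r by (intro prod_pos) auto
      ultimately have "inverse ?c * ?c = 1"
        by (simp add: inverse_ennreal ennreal_mult[symmetric])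
      then show ?thesis by (simp flip: mult.assoc)
    qed
    finally show "emeasure (scale_measure (inverse ?c) (distr ?M ?M ?f)) (Pi\<^sub>E I A) = (\<Prod>i\<in>I. emeasure lborel (A i))" .
  qed (use I in auto)
  have img: "(\<lambda>x. \<lambda>i\<in>I. r i *\<^sub>R x i) ` X = ?f -` X \<inter> space ?M"
  proof -
    have X': "x \<in> extensional I" if "x \<in> X" for x
      using sets.sets_into_space[OF X] that by (auto simp: space_PiM PiE_def)
    show ?thesis
    proof (intro equalityI subsetI)
      fix y assume "y \<in> (\<lambda>x. \<lambda>i\<in>I. r i *\<^sub>R x i) ` X"
      then obtain x where x: "x \<in> X" "y = (\<lambda>i\<in>I. r i *\<^sub>R x i)" by auto
      have "?f y = x" using X'[OF x(1)] r unfolding x(2) by (auto simp: fun_eq_iff extensional_def)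
      then show "y \<in> ?f -` X \<inter> space ?M" using x by (auto simp: space_PiM)
    next
      fix y assume y: "y \<in> ?f -` X \<inter> space ?M"
      then have "y = (\<lambda>i\<in>I. r i *\<^sub>R (?f y) i)" using r by (auto simp: space_PiM fun_eq_iff extensional_def PiE_def)
      then show "y \<in> (\<lambda>x. \<lambda>i\<in>I. r i *\<^sub>R x i) ` X" using y by blast
    qed
  qed
  show "(\<lambda>x. \<lambda>i\<in>I. r i *\<^sub>R x i) ` X \<in> sets ?M"
    unfolding img by (rule measurable_sets[OF f X])
  have "emeasure ?M X = inverse ?c * emeasure ?M (?f -` X \<inter> space ?M)"
    using X by (subst *[symmetric]) (simp add: emeasure_distr)
  then have "?c * emeasure ?M X = (?c * inverse ?c) * emeasure ?M (?f -` X \<inter> space ?M)"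
    by (simp add: mult.assoc)
  moreover have "?c * inverse ?c = 1"
  proof -
    have "?c = ennreal (\<Prod>i\<in>I. \<bar>r i\<bar> ^ DIM('a))" by (simp add: prod_ennreal)
    moreover have "(\<Prod>i\<in>I. \<bar>r i\<bar> ^ DIM('a)) > 0" using r by (intro prod_pos) auto
    ultimately show ?thesis
      by (simp add: inverse_ennreal ennreal_mult[symmetric])
  qed
  ultimately show "emeasure ?M ((\<lambda>x. \<lambda>i\<in>I. r i *\<^sub>R x i) ` X) = ?c * emeasure ?M X"
    unfolding img by simp
qed

lemma PiM_lborel_translate:
  fixes c :: "'i \<Rightarrow> 'a::euclidean_space"
  assumes I: "finite I"
  shows "distr (Pi\<^sub>M I (\<lambda>_. lborel :: 'a measure)) (Pi\<^sub>M I (\<lambda>_. lborel)) (\<lambda>x. \<lambda>i\<in>I. x i + c i) = Pi\<^sub>M I (\<lambda>_. lborel)"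
proof -
  let ?M = "Pi\<^sub>M I (\<lambda>_. lborel :: 'a measure)"
  let ?f = "\<lambda>x. \<lambda>i\<in>I. x i + c i :: 'a"
  interpret product_sigma_finite "\<lambda>_::'i. lborel :: 'a measure" by standard
  have f [measurable]: "?f \<in> measurable ?M ?M" by measurable
  show ?thesis
  proof (rule PiM_eqI)
    fix A :: "'i \<Rightarrow> 'a set" assume A: "\<And>i. i \<in> I \<Longrightarrow> A i \<in> sets lborel"
    have pre: "?f -` Pi\<^sub>E I A \<inter> space ?M = Pi\<^sub>E I (\<lambda>i. (\<lambda>x. x + c i) -` A i)"
      by (auto simp: space_PiM PiE_iff)
    have ms: "(\<lambda>x. x + c i) -` A i \<in> sets lborel" if "i \<in> I" for i
      using measurable_sets[of "\<lambda>x. x + c i" lborel lborel "A i"] A[OF that] by simp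
    have 1: "emeasure lborel ((\<lambda>x. x + c i) -` A i) = emeasure lborel (A i)" if "i \<in> I" for i
    proof -
      have "emeasure lborel (A i) = emeasure (distr lborel borel ((+) (c i))) (A i)"
        by (simp add: lborel_distr_plus)
      also have "\<dots> = emeasure lborel ((+) (c i) -` A i)"
        using A[OF that] by (subst emeasure_distr) auto
      also have "(+) (c i) -` A i = (\<lambda>x. x + c i) -` A i" by (auto simp: add.commute)
      finally show ?thesis by simp
    qed
    show "emeasure (distr ?M ?M ?f) (Pi\<^sub>E I A) = (\<Prod>i\<in>I. emeasure lborel (A i))"
      using A I ms 1 by (subst emeasure_distr) (auto simp: pre emeasure_PiM sets_PiM_I_finite)
  qed (use I in auto)
qed

text \<open>Uniqueness of Haar measure: evaluating the double integral of \<open>1\<^sub>A(x) 1\<^sub>B(x + \<Phi> y)\<close> in both orders gives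
  \<open>L A * \<nu> B = L B * \<nu> A\<close> for symmetric \<open>A\<close>, where \<open>\<nu>\<close> is the image of \<open>M\<close> under \<open>\<Phi>\<close>.\<close>

lemma haar_coordinates:
  fixes L :: "'v::real_vector measure" and I :: "'i set" and b :: "'i \<Rightarrow> 'v" and \<kappa> :: "'i \<Rightarrow> 'v \<Rightarrow> real"
  defines "M \<equiv> Pi\<^sub>M I (\<lambda>_. lborel :: real measure)"
  defines "\<Phi> \<equiv> \<lambda>y. \<Sum>i\<in>I. y i *\<^sub>R b i"
  assumes sf: "sigma_finite_measure L" and space: "space L = UNIV" and I: "finite I"
    and V: "V \<in> sets L" "subspace V" "emeasure L (- V) = 0"
    and add: "(\<lambda>(x, y). x + \<Phi> y) \<in> measurable (L \<Otimes>\<^sub>M M) L"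
    and trans: "\<And>f v. f \<in> borel_measurable L \<Longrightarrow> v \<in> V \<Longrightarrow> (\<integral>\<^sup>+x. f (x + v) \<partial>L) = (\<integral>\<^sup>+x. f x \<partial>L)"
    and b: "\<And>i. i \<in> I \<Longrightarrow> b i \<in> V"
    and \<kappa>: "\<And>i. i \<in> I \<Longrightarrow> \<kappa> i \<in> borel_measurable L"
    and \<kappa>\<Phi>: "\<And>y i. i \<in> I \<Longrightarrow> \<kappa> i (\<Phi> y) = y i"
    and \<Phi>\<kappa>: "\<And>v. v \<in> V \<Longrightarrow> \<Phi> (\<lambda>i. \<kappa> i v) = v"
  obtains c where "\<And>X. X \<in> sets M \<Longrightarrow> \<Phi> ` X \<in> sets L"
    "\<And>X. X \<in> sets M \<Longrightarrow> emeasure L (\<Phi> ` X) = c * emeasure M X"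
proof -
  interpret L: sigma_finite_measure L by fact
  interpret pi: product_sigma_finite "\<lambda>_::'i. lborel :: real measure" by standard
  interpret pf: finite_product_sigma_finite "\<lambda>_::'i. lborel :: real measure" I by standard fact
  interpret M: sigma_finite_measure M unfolding M_def by (rule pf.sigma_finite_measure_axioms)
  interpret LM: pair_sigma_finite L M by unfold_locales
  have \<Phi>_V: "\<Phi> y \<in> V" for y
    unfolding \<Phi>_def by (intro subspace_sum subspace_scale V b)
  have \<Phi>_add: "\<Phi> y + \<Phi> z = \<Phi> (\<lambda>i. y i + z i)" for y z
    by (simp add: \<Phi>_def scaleR_add_left sum.distrib)
  have \<Phi>_uminus: "- \<Phi> y = \<Phi> (\<lambda>i. - y i)" for y
    by (simp add: \<Phi>_def sum_negf)
  have \<Phi>_cong: "\<Phi> y = \<Phi> z" if "\<And>i. i \<in> I \<Longrightarrow> y i = z i" for y z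
    using that by (simp add: \<Phi>_def cong: sum.cong)
  define k where "k v = (\<lambda>i\<in>I. \<kappa> i v)" for v
  have k [measurable]: "k \<in> measurable L M"
    unfolding k_def M_def using \<kappa> by (intro measurable_restrict) auto
  have \<Phi>k: "\<Phi> (k v) = v" if "v \<in> V" for v
  proof -
    have "\<Phi> (k v) = \<Phi> (\<lambda>i. \<kappa> i v)" by (rule \<Phi>_cong) (simp add: k_def)
    with \<Phi>\<kappa>[OF that] show ?thesis by simp
  qed
  have k\<Phi>: "k (\<Phi> y) = y" if "y \<in> space M" for y
    using that by (auto simp: k_def \<kappa>\<Phi> M_def space_PiM fun_eq_iff PiE_def extensional_def)
  have img: "\<Phi> ` X = V \<inter> (k -` X \<inter> space L)" if X: "X \<in> sets M" for X
    using sets.sets_into_space[OF X] k\<Phi> \<Phi>k \<Phi>_V by (force simp: space)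
  have img_sets: "\<Phi> ` X \<in> sets L" if X: "X \<in> sets M" for X
    unfolding img[OF X] using V measurable_sets[OF k X] by auto
  define \<nu> where "\<nu> B = (\<integral>\<^sup>+y. indicator B (\<Phi> y) \<partial>M)" for B
  have \<Phi>m: "\<Phi> \<in> measurable M L"
  proof -
    have "(\<lambda>y. (case (0, y) of (x, y) \<Rightarrow> x + \<Phi> y)) \<in> measurable M L"
      by (rule measurable_compose[OF _ add]) (simp add: space)
    then show ?thesis by simp
  qed
  have \<nu>: "\<nu> (\<Phi> ` X) = emeasure M X" if X: "X \<in> sets M" for X
  proof -
    have "\<nu> (\<Phi> ` X) = (\<integral>\<^sup>+y. indicator X y \<partial>M)"
      unfolding \<nu>_def
    proof (rule nn_integral_cong)
      fix y assume y: "y \<in> space M"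
      have "y \<in> X" if "\<Phi> y \<in> \<Phi> ` X"
      proof -
        from that obtain x where x: "x \<in> X" "\<Phi> y = \<Phi> x" by auto
        then have "k (\<Phi> y) = k (\<Phi> x)" by simp
        with k\<Phi>[OF y] k\<Phi>[of x] x(1) sets.sets_into_space[OF X] show ?thesis by auto
      qed
      then have "\<Phi> y \<in> \<Phi> ` X \<longleftrightarrow> y \<in> X" by auto
      then show "indicator (\<Phi> ` X) (\<Phi> y) = (indicator X y :: ennreal)" by (simp add: indicator_def)
    qed
    then show ?thesis using X by simp
  qed
  have M_trans: "(\<integral>\<^sup>+y. g (\<lambda>i\<in>I. y i + c i) \<partial>M) = (\<integral>\<^sup>+y. g y \<partial>M)" if g: "g \<in> borel_measurable M" for g and c :: "'i \<Rightarrow> real"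
  proof -
    have "(\<integral>\<^sup>+y. g y \<partial>M) = (\<integral>\<^sup>+y. g y \<partial>distr M M (\<lambda>x. \<lambda>i\<in>I. x i + c i))"
      unfolding M_def by (subst PiM_lborel_translate[OF I]) simp
    also have "\<dots> = (\<integral>\<^sup>+y. g (\<lambda>i\<in>I. y i + c i) \<partial>M)"
      using g PiM_lborel_translate[OF I] unfolding M_def
      by (intro nn_integral_distr) auto
    finally show ?thesis by simp
  qed
  \<comment> \<open>A symmetric box whose \<nu>-measure \<open>2 ^ card I\<close> is finite and
    nonzero, so that the identity \<open>key\<close> can be solved for the measure of an arbitrary
    image.\<close>
  define Q where "Q = Pi\<^sub>E I (\<lambda>_. {-1..1::real})"
  have Q: "Q \<in> sets M" unfolding Q_def M_def using I by (intro sets_PiM_I_finite) auto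
  define A where "A = \<Phi> ` Q"
  have A: "A \<in> sets L" "A \<subseteq> V" using img_sets[OF Q] \<Phi>_V by (auto simp: A_def)
  have A_iff: "v \<in> A \<longleftrightarrow> v \<in> V \<and> (\<forall>i\<in>I. \<bar>\<kappa> i v\<bar> \<le> 1)" for v
    unfolding A_def img[OF Q] by (force simp: Q_def k_def space PiE_iff abs_le_iff)
  have A_sym: "- v \<in> A \<longleftrightarrow> v \<in> A" for v
  proof -
    have "- v \<in> A" if v: "v \<in> A" for v
    proof -
      have vV: "v \<in> V" using A v by auto
      have "- v = \<Phi> (\<lambda>i. - \<kappa> i v)" using \<Phi>\<kappa>[OF vV] \<Phi>_uminus by metis
      then have "\<kappa> i (- v) = - \<kappa> i v" if "i \<in> I" for i using \<kappa>\<Phi>[OF that] by metis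
      then show ?thesis using v V(2) unfolding A_iff by (auto intro: subspace_neg)
    qed
    from this[of v] this[of "- v"] show ?thesis by auto
  qed
  have nuA: "\<nu> A = 2 ^ card I"
    unfolding A_def \<nu>[OF Q] unfolding M_def Q_def using I by (subst pi.emeasure_PiM) auto
  have key: "emeasure L A * \<nu> B = emeasure L B * \<nu> A" if B: "B \<in> sets L" "B \<subseteq> V" for B
  proof -
    note [measurable] = add B(1) A(1) \<Phi>m
    have m1: "(\<lambda>(x, y). indicator A x * indicator B (x + \<Phi> y) :: ennreal) \<in> borel_measurable (L \<Otimes>\<^sub>M M)"
    proof -
      have "(\<lambda>z. indicator B ((\<lambda>(x, y). x + \<Phi> y) z) :: ennreal) \<in> borel_measurable (L \<Otimes>\<^sub>M M)"
        by measurable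
      then have "(\<lambda>z. indicator A (fst z) * indicator B ((\<lambda>(x, y). x + \<Phi> y) z) :: ennreal) \<in> borel_measurable (L \<Otimes>\<^sub>M M)"
        by measurable
      then show ?thesis by (simp add: case_prod_beta)
    qed
    have neg: "(\<lambda>y. \<lambda>i\<in>I. - y i) \<in> measurable M M"
      unfolding M_def by measurable
    have addn: "(\<lambda>(x, y). x - \<Phi> y) \<in> measurable (L \<Otimes>\<^sub>M M) L"
    proof -
      have "(\<lambda>z. case (fst z, \<lambda>i\<in>I. - snd z i) of (x, y) \<Rightarrow> x + \<Phi> y) \<in> measurable (L \<Otimes>\<^sub>M M) L"
        by (rule measurable_compose[OF _ add], rule measurable_Pair, simp,
            rule measurable_compose[OF measurable_snd neg])
      moreover have "\<Phi> (\<lambda>i\<in>I. - y i) = - \<Phi> y" for y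
        unfolding \<Phi>_uminus by (rule \<Phi>_cong) simp
      ultimately show ?thesis by (simp add: case_prod_beta)
    qed
    have m2: "(\<lambda>(x, y). indicator A (x - \<Phi> y) * indicator B x :: ennreal) \<in> borel_measurable (L \<Otimes>\<^sub>M M)"
    proof -
      have "(\<lambda>z. indicator A ((\<lambda>(x, y). x - \<Phi> y) z) :: ennreal) \<in> borel_measurable (L \<Otimes>\<^sub>M M)"
        using addn by measurable
      then have "(\<lambda>z. indicator A ((\<lambda>(x, y). x - \<Phi> y) z) * indicator B (fst z) :: ennreal) \<in> borel_measurable (L \<Otimes>\<^sub>M M)"
        by measurable
      then show ?thesis by (simp add: case_prod_beta)
    qed
    have mB: "(\<lambda>y. indicator B (\<Phi> y) :: ennreal) \<in> borel_measurable M"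
      and mA: "(\<lambda>y. indicator A (\<Phi> y) :: ennreal) \<in> borel_measurable M" by measurable
    have inner1: "(\<integral>\<^sup>+y. indicator B (x + \<Phi> y) \<partial>M) = \<nu> B" if x: "x \<in> V" for x
    proof -
      have "x + \<Phi> y = \<Phi> (\<lambda>i\<in>I. y i + \<kappa> i x)" for y
      proof -
        have "x + \<Phi> y = \<Phi> (\<lambda>i. \<kappa> i x + y i)" using \<Phi>\<kappa>[OF x] \<Phi>_add by metis
        also have "\<dots> = \<Phi> (\<lambda>i\<in>I. y i + \<kappa> i x)" by (rule \<Phi>_cong) simp
        finally show ?thesis .
      qed
      then show ?thesis using M_trans[OF mB, of "\<lambda>i. \<kappa> i x"] by (simp add: \<nu>_def)
    qed
    \<comment> \<open>Symmetry of A enters here: it replaces \<open>x - \<Phi> y\<close> by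
      \<open>\<Phi> y - x\<close>, which is \<Phi> of a translate of y.\<close>
    have inner2: "(\<integral>\<^sup>+y. indicator A (x - \<Phi> y) \<partial>M) = \<nu> A" if x: "x \<in> V" for x
    proof -
      have "\<Phi> y - x = \<Phi> (\<lambda>i\<in>I. y i + - \<kappa> i x)" for y
      proof -
        have "\<Phi> y - x = \<Phi> (\<lambda>i. y i + - \<kappa> i x)" using \<Phi>\<kappa>[OF x] \<Phi>_add \<Phi>_uminus by (metis diff_conv_add_uminus)
        also have "\<dots> = \<Phi> (\<lambda>i\<in>I. y i + - \<kappa> i x)" by (rule \<Phi>_cong) simp
        finally show ?thesis .
      qed
      moreover have "indicator A (x - \<Phi> y) = (indicator A (\<Phi> y - x) :: ennreal)" for y
        using A_sym[of "x - \<Phi> y"] by (simp add: indicator_def)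
      ultimately show ?thesis using M_trans[OF mA, of "\<lambda>i. - \<kappa> i x"] by (simp add: \<nu>_def)
    qed
    have "emeasure L A * \<nu> B = (\<integral>\<^sup>+x. indicator A x * \<nu> B \<partial>L)"
      by (simp add: nn_integral_multc)
    also have "\<dots> = (\<integral>\<^sup>+x. (\<integral>\<^sup>+y. indicator A x * indicator B (x + \<Phi> y) \<partial>M) \<partial>L)"
    proof (rule nn_integral_cong)
      fix x
      have "(\<integral>\<^sup>+y. indicator A x * indicator B (x + \<Phi> y) \<partial>M) = indicator A x * (\<integral>\<^sup>+y. indicator B (x + \<Phi> y) \<partial>M)"
        by (auto simp: indicator_def split: if_splits)
      then show "indicator A x * \<nu> B = (\<integral>\<^sup>+y. indicator A x * indicator B (x + \<Phi> y) \<partial>M)"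
        using inner1 A(2) by (auto simp: indicator_def)
    qed
    also have "\<dots> = (\<integral>\<^sup>+y. (\<integral>\<^sup>+x. indicator A x * indicator B (x + \<Phi> y) \<partial>L) \<partial>M)"
      using LM.Fubini'[OF m1] by simp
    also have "\<dots> = (\<integral>\<^sup>+y. (\<integral>\<^sup>+x. indicator A (x - \<Phi> y) * indicator B x \<partial>L) \<partial>M)"
    proof (rule nn_integral_cong)
      fix y assume y: "y \<in> space M"
      have "(\<lambda>x. indicator A (x - \<Phi> y) * indicator B x :: ennreal) \<in> borel_measurable L"
        using measurable_compose[OF measurable_Pair2'[OF y] m2] by simp
      from trans[OF this \<Phi>_V[of y]]
      show "(\<integral>\<^sup>+x. indicator A x * indicator B (x + \<Phi> y) \<partial>L) = (\<integral>\<^sup>+x. indicator A (x - \<Phi> y) * indicator B x \<partial>L)"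
        by simp
    qed
    also have "\<dots> = (\<integral>\<^sup>+x. (\<integral>\<^sup>+y. indicator A (x - \<Phi> y) * indicator B x \<partial>M) \<partial>L)"
      using LM.Fubini'[OF m2] by simp
    also have "\<dots> = (\<integral>\<^sup>+x. indicator B x * \<nu> A \<partial>L)"
    proof (rule nn_integral_cong)
      fix x
      have "(\<integral>\<^sup>+y. indicator A (x - \<Phi> y) * indicator B x \<partial>M) = indicator B x * (\<integral>\<^sup>+y. indicator A (x - \<Phi> y) \<partial>M)"
        by (auto simp: indicator_def split: if_splits)
      then show "(\<integral>\<^sup>+y. indicator A (x - \<Phi> y) * indicator B x \<partial>M) = indicator B x * \<nu> A"
        using inner2 B(2) by (auto simp: indicator_def)
    qed
    also have "\<dots> = emeasure L B * \<nu> A"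
      by (simp add: nn_integral_multc)
    finally show ?thesis .
  qed
  show ?thesis
  proof (rule that)
    fix X assume X: "X \<in> sets M"
    show "\<Phi> ` X \<in> sets L" by (rule img_sets[OF X])
    have "emeasure L A * emeasure M X = emeasure L (\<Phi> ` X) * 2 ^ card I"
      using key[OF img_sets[OF X]] \<Phi>_V \<nu>[OF X] nuA by auto
    then have "inverse (2 ^ card I) * (emeasure L A * emeasure M X) = emeasure L (\<Phi> ` X) * (2 ^ card I * inverse (2 ^ card I))"
      by (simp add: mult_ac)
    also have "(2::ennreal) ^ card I * inverse (2 ^ card I) = 1"
    proof -
      have "(2::ennreal) ^ card I = ennreal (2 ^ card I)" by (simp flip: ennreal_power)
      then show ?thesis by (simp add: inverse_ennreal flip: ennreal_mult)
    qed
    finally show "emeasure L (\<Phi> ` X) = (inverse (2 ^ card I) * emeasure L A) * emeasure M X"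
      by (simp add: mult.assoc)
  qed
qed

section \<open>Lebesgue measure on powers of a Euclidean space\<close>

definition pow_space :: "nat \<Rightarrow> (nat \<Rightarrow> 'a::zero) set"
  where "pow_space p = {x. \<forall>i\<ge>p. x i = 0}"

text \<open>The measure behind \<open>vol\<close>, moved from extensional functions to functions
  that vanish from p on. On this side sums, dilates and compact sets use the ordinary vector space
  and product topology of functions, at the price that the measure is concentrated on
  \<open>pow_space p\<close>.\<close>

definition lborel_pow :: "nat \<Rightarrow> (nat \<Rightarrow> 'a::euclidean_space) measure"
  where "lborel_pow p = distr (Pi\<^sub>M {..<p} (\<lambda>_. lborel)) borel (\<lambda>x i. if i < p then x i else 0)"

lemma scaleR_fun_apply: "(c *\<^sub>R f) i = c *\<^sub>R f i"
  by (simp add: scaleR_fun_def)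

lemma sum_fun_apply: "(\<Sum>x\<in>A. f x) i = (\<Sum>x\<in>A. f x i)" for f :: "'b \<Rightarrow> 'i \<Rightarrow> 'a::comm_monoid_add"
  by (induction A rule: infinite_finite_induct) (auto simp: zero_fun_def plus_fun_def)

lemmas fun_vector_apply = plus_fun_apply scaleR_fun_apply sum_fun_apply zero_fun_def minus_apply uminus_apply

lemma subspace_pow_space: "subspace (pow_space p :: (nat \<Rightarrow> 'a::real_vector) set)"
  by (auto simp: subspace_def pow_space_def fun_vector_apply)

lemma measurable_component [measurable]: "(\<lambda>x. x i) \<in> borel_measurable (borel :: (nat \<Rightarrow> 'a::euclidean_space) measure)"
  by (rule measurable_product_then_coordinatewise) simp

lemma space_lborel_pow [simp]: "space (lborel_pow p) = UNIV"
  and sets_lborel_pow [simp, measurable_cong]: "sets (lborel_pow p) = sets borel"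
  by (auto simp: lborel_pow_def)

lemma measurable_embed [measurable]:
  "(\<lambda>x i. if i < p then x i else 0) \<in> measurable (Pi\<^sub>M {..<p} (\<lambda>_. lborel)) (borel :: (nat \<Rightarrow> 'a::euclidean_space) measure)"
proof (rule measurable_coordinatewise_then_product)
  fix i
  show "(\<lambda>x. if i < p then x i else (0::'a)) \<in> borel_measurable (Pi\<^sub>M {..<p} (\<lambda>_. lborel))"
  proof (cases "i < p")
    case True
    then have "(\<lambda>x. x i) \<in> measurable (Pi\<^sub>M {..<p} (\<lambda>_. lborel)) (lborel :: 'a measure)"
      by (intro measurable_component_singleton) simp
    with True show ?thesis by simp
  qed simp
qed

lemma pow_space_borel [measurable]: "pow_space p \<in> sets (borel :: (nat \<Rightarrow> 'a::euclidean_space) measure)"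
proof -
  have "pow_space p = (\<Inter>i\<in>{p..}. {x :: nat \<Rightarrow> 'a. x i = 0})" by (auto simp: pow_space_def)
  also have "\<dots> \<in> sets borel" by (intro sets.countable_INT') auto
  finally show ?thesis .
qed

lemma nn_integral_lborel_pow:
  assumes "f \<in> borel_measurable (borel :: (nat \<Rightarrow> 'a::euclidean_space) measure)"
  shows "(\<integral>\<^sup>+x. f x \<partial>lborel_pow p) = (\<integral>\<^sup>+x. f (\<lambda>i. if i < p then x i else 0) \<partial>(Pi\<^sub>M {..<p} (\<lambda>_. lborel :: 'a measure)))"
  unfolding lborel_pow_def using assms by (intro nn_integral_distr) auto

lemma emeasure_lborel_pow:
  assumes A: "A \<in> sets (borel :: (nat \<Rightarrow> 'a::euclidean_space) measure)" "A \<subseteq> pow_space p"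
  shows "emeasure (lborel_pow p) A = emeasure (Pi\<^sub>M {..<p} (\<lambda>_. lborel)) ((\<lambda>x. restrict x {..<p}) ` A)"
    and "(\<lambda>x. restrict x {..<p}) ` A \<in> sets (Pi\<^sub>M {..<p} (\<lambda>_. lborel))"
proof -
  let ?M = "Pi\<^sub>M {..<p} (\<lambda>_. lborel :: 'a measure)"
  let ?e = "\<lambda>x i. if i < p then x i else 0 :: 'a"
  have eq: "(\<lambda>x. restrict x {..<p}) ` A = ?e -` A \<inter> space ?M"
  proof (intro equalityI subsetI)
    fix y assume "y \<in> (\<lambda>x. restrict x {..<p}) ` A"
    then obtain x where x: "x \<in> A" "y = restrict x {..<p}" by auto
    have "?e y = x" using x A(2) by (auto simp: fun_eq_iff pow_space_def)
    then have "?e y \<in> A" using x(1) by simp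
    moreover have "y \<in> space ?M" unfolding x(2) by (auto simp: space_PiM)
    ultimately show "y \<in> ?e -` A \<inter> space ?M" by simp
  next
    fix y assume y: "y \<in> ?e -` A \<inter> space ?M"
    then have b: "y = restrict (?e y) {..<p}" by (auto simp: space_PiM fun_eq_iff PiE_def extensional_def)
    from y have a: "?e y \<in> A" by simp
    show "y \<in> (\<lambda>x. restrict x {..<p}) ` A"
      by (rule image_eqI[where f = "\<lambda>x. restrict x {..<p}" and x = "?e y", OF b a])
  qed
  show "(\<lambda>x. restrict x {..<p}) ` A \<in> sets ?M"
    unfolding eq using measurable_embed A(1) by (rule measurable_sets)
  show "emeasure (lborel_pow p) A = emeasure ?M ((\<lambda>x. restrict x {..<p}) ` A)"
    unfolding lborel_pow_def eq using A(1) by (subst emeasure_distr) auto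
qed

lemma vol_eq:
  assumes "A \<in> sets (borel :: (nat \<Rightarrow> 'a::euclidean_space) measure)" "A \<subseteq> pow_space p"
  shows "vol p A = measure (lborel_pow p) A"
  unfolding vol_def measure_def using emeasure_lborel_pow[OF assms] by simp

lemma lborel_pow_translate:
  fixes f :: "(nat \<Rightarrow> 'a::euclidean_space) \<Rightarrow> ennreal"
  assumes f: "f \<in> borel_measurable borel" and v: "v \<in> pow_space p"
  shows "(\<integral>\<^sup>+x. f (x + v) \<partial>lborel_pow p) = (\<integral>\<^sup>+x. f x \<partial>lborel_pow p)"
proof -
  let ?M = "Pi\<^sub>M {..<p} (\<lambda>_. lborel :: 'a measure)"
  let ?e = "\<lambda>x i. if i < p then x i else 0 :: 'a"
  let ?t = "\<lambda>x. \<lambda>i\<in>{..<p}. x i + v i"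
  have m: "(\<lambda>x. x + v) \<in> borel_measurable borel"
    by (rule measurable_coordinatewise_then_product) (simp add: fun_vector_apply)
  have t: "?t \<in> measurable ?M ?M" by measurable
  have "(\<integral>\<^sup>+x. f (x + v) \<partial>lborel_pow p) = (\<integral>\<^sup>+x. f (?e x + v) \<partial>?M)"
    using measurable_compose[OF m f] by (rule nn_integral_lborel_pow)
  also have "\<dots> = (\<integral>\<^sup>+x. f (?e (?t x)) \<partial>?M)"
    using v by (intro nn_integral_cong arg_cong[where f=f]) (auto simp: fun_eq_iff fun_vector_apply pow_space_def)
  also have "\<dots> = (\<integral>\<^sup>+x. f (?e x) \<partial>distr ?M ?M ?t)"
    using measurable_compose[OF measurable_embed f]
    by (intro nn_integral_distr[symmetric, OF t]) (simp add: PiM_lborel_translate)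
  also have "\<dots> = (\<integral>\<^sup>+x. f x \<partial>lborel_pow p)"
    by (simp add: PiM_lborel_translate nn_integral_lborel_pow[OF f])
  finally show ?thesis .
qed

lemma plus_const_borel:
  assumes "A \<in> sets (borel :: (nat \<Rightarrow> 'a::euclidean_space) measure)"
  shows "(\<lambda>x. x + v) ` A \<in> sets borel"
proof -
  have m: "(\<lambda>x. x - v) \<in> borel_measurable borel"
    by (rule measurable_coordinatewise_then_product) (simp add: fun_vector_apply)
  have "(\<lambda>x. x + v) ` A = (\<lambda>x. x - v) -` A \<inter> space borel"
    by (auto simp: image_iff) (metis diff_add_cancel)
  then show ?thesis using measurable_sets[OF m assms] by simp
qed

lemma emeasure_lborel_pow_translate:
  assumes A: "A \<in> sets (borel :: (nat \<Rightarrow> 'a::euclidean_space) measure)" and v: "v \<in> pow_space p"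
  shows "emeasure (lborel_pow p) ((\<lambda>x. x + v) ` A) = emeasure (lborel_pow p) A"
proof -
  have "(\<integral>\<^sup>+x. indicator ((\<lambda>x. x + v) ` A) (x + v) \<partial>lborel_pow p) = (\<integral>\<^sup>+x. indicator ((\<lambda>x. x + v) ` A) x \<partial>lborel_pow p)"
    using plus_const_borel[OF A] v by (intro lborel_pow_translate) auto
  moreover have "indicator ((\<lambda>x. x + v) ` A) (x + v) = (indicator A x :: ennreal)" for x
    by (auto simp: indicator_def)
  ultimately show ?thesis using A plus_const_borel[OF A] by simp
qed

lemma vol_translate:
  assumes A: "A \<in> sets (borel :: (nat \<Rightarrow> 'a::euclidean_space) measure)" "A \<subseteq> pow_space p" and v: "v \<in> pow_space p"
  shows "vol p ((\<lambda>x. x + v) ` A) = vol p A"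
proof -
  have "(\<lambda>x. x + v) ` A \<subseteq> pow_space p" using A v by (auto intro: subspace_add[OF subspace_pow_space])
  then show ?thesis
    using A v plus_const_borel[OF A(1)] by (simp add: vol_eq measure_def emeasure_lborel_pow_translate)
qed

lemma vol_dilate:
  fixes A :: "(nat \<Rightarrow> 'a::euclidean_space) set"
  assumes A: "A \<in> sets borel" "A \<subseteq> pow_space p" and r: "r \<noteq> 0"
  shows "vol p (dilate r A) = \<bar>r\<bar> ^ (DIM('a) * p) * vol p A"
proof -
  let ?M = "Pi\<^sub>M {..<p} (\<lambda>_. lborel :: 'a measure)"
  have "(\<lambda>x. restrict x {..<p}) ` dilate r A = (\<lambda>x. \<lambda>i\<in>{..<p}. r *\<^sub>R x i) ` (\<lambda>x. restrict x {..<p}) ` A"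
    unfolding dilate_def image_image by (intro image_cong refl) (auto simp: fun_vector_apply fun_eq_iff)
  then have "emeasure ?M ((\<lambda>x. restrict x {..<p}) ` dilate r A) = (\<Prod>i<p. ennreal (\<bar>r\<bar> ^ DIM('a))) * emeasure ?M ((\<lambda>x. restrict x {..<p}) ` A)"
    using PiM_lborel_scale(1)[OF _ _ emeasure_lborel_pow(2)[OF A], of "\<lambda>_. r"] r by simp
  also have "(\<Prod>i<p. ennreal (\<bar>r\<bar> ^ DIM('a))) = ennreal (\<bar>r\<bar> ^ (DIM('a) * p))"
    by (simp add: ennreal_power power_mult)
  finally have E: "emeasure ?M ((\<lambda>x. restrict x {..<p}) ` dilate r A) = ennreal (\<bar>r\<bar> ^ (DIM('a) * p)) * emeasure ?M ((\<lambda>x. restrict x {..<p}) ` A)" .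
  show ?thesis unfolding vol_def measure_def E by (simp add: enn2real_mult)
qed

lemma enn2real_power: "enn2real (x ^ n) = enn2real x ^ n"
  by (induction n) (auto simp: enn2real_mult)

lemma vol_cart_power:
  assumes K: "K \<in> sets (lborel :: 'a::euclidean_space measure)"
  shows "vol p (cart_power p K) = measure lborel K ^ p"
proof -
  interpret product_sigma_finite "\<lambda>_::nat. lborel :: 'a measure" by standard
  have eq: "(\<lambda>x. restrict x {..<p}) ` cart_power p K = Pi\<^sub>E {..<p} (\<lambda>_. K)"
  proof (intro equalityI subsetI)
    fix y assume y: "y \<in> Pi\<^sub>E {..<p} (\<lambda>_. K)"
    then have "y = restrict (\<lambda>i. if i < p then y i else 0) {..<p}"
      by (auto simp: fun_eq_iff PiE_def extensional_def)
    moreover have "(\<lambda>i. if i < p then y i else 0) \<in> cart_power p K"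
      using y by (auto simp: cart_power_def)
    ultimately show "y \<in> (\<lambda>x. restrict x {..<p}) ` cart_power p K" by blast
  qed (auto simp: cart_power_def PiE_iff extensional_def)
  show ?thesis
    unfolding vol_def eq measure_def using K by (subst emeasure_PiM) (auto simp: enn2real_power)
qed

lemma cart_power_subset: "cart_power p K \<subseteq> pow_space p"
  by (auto simp: cart_power_def pow_space_def)

lemma cart_power_borel:
  assumes K: "K \<in> sets (borel :: 'a::euclidean_space measure)"
  shows "cart_power p K \<in> sets borel"
proof -
  have "cart_power p K = (\<Inter>i\<in>{..<p}. (\<lambda>x. x i) -` K \<inter> space borel) \<inter> pow_space p"
    by (auto simp: cart_power_def pow_space_def)
  also have "\<dots> \<in> sets borel"
  proof (cases "p = 0")
    case False
    then show ?thesis using K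
      by (intro sets.Int sets.countable_INT' pow_space_borel) (auto intro!: measurable_sets[OF measurable_component, simplified])
  qed simp
  finally show ?thesis .
qed

lemma emeasure_compl_pow_space:
  "emeasure (lborel_pow p) (- pow_space p :: (nat \<Rightarrow> 'a::euclidean_space) set) = 0"
proof -
  have e: "(\<lambda>x i. if i < p then x i else 0) -` (- pow_space p) \<inter> space (Pi\<^sub>M {..<p} (\<lambda>_. lborel)) = ({} :: (nat \<Rightarrow> 'a) set)"
    by (auto simp: pow_space_def)
  show ?thesis unfolding lborel_pow_def
    by (subst emeasure_distr[OF measurable_embed]) (simp_all only: e, auto)
qed

lemma sigma_finite_lborel_pow: "sigma_finite_measure (lborel_pow p :: (nat \<Rightarrow> 'a::euclidean_space) measure)"
proof
  let ?A = "\<lambda>n. cart_power p (ball 0 (real n)) :: (nat \<Rightarrow> 'a) set"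
  \<comment> \<open>The measure lives on all functions, so the cubes that exhaust
    \<open>pow_space p\<close> are supplemented by its null complement.\<close>
  let ?F = "insert (- pow_space p) (range ?A) :: (nat \<Rightarrow> 'a) set set"
  interpret product_sigma_finite "\<lambda>_::nat. lborel :: 'a measure" by standard
  have "x \<in> \<Union>?F" for x :: "nat \<Rightarrow> 'a"
  proof (cases "x \<in> pow_space p")
    case True
    obtain n where n: "real n > (\<Sum>i<p. norm (x i))" using reals_Archimedean2 by blast
    have "norm (x i) < real n" if "i < p" for i
      using member_le_sum[of i "{..<p}" "\<lambda>i. norm (x i)"] that n by simp
    then have "x \<in> ?A n" using True by (auto simp: cart_power_def pow_space_def)
    then show ?thesis by blast
  qed auto
  moreover have "emeasure (lborel_pow p) (- pow_space p :: (nat \<Rightarrow> 'a) set) = 0"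
    by (rule emeasure_compl_pow_space)
  moreover have "emeasure (lborel_pow p) (?A n) \<noteq> \<infinity>" for n
  proof -
    have eq: "(\<lambda>x. restrict x {..<p}) ` ?A n \<subseteq> Pi\<^sub>E {..<p} (\<lambda>_. ball 0 (real n))"
      by (auto simp: cart_power_def PiE_iff extensional_def split: if_split_asm)
    have "emeasure (lborel_pow p) (?A n) = emeasure (Pi\<^sub>M {..<p} (\<lambda>_. lborel)) ((\<lambda>x. restrict x {..<p}) ` ?A n)"
      by (rule emeasure_lborel_pow) (auto intro: cart_power_borel cart_power_subset[THEN subsetD])
    also have "\<dots> \<le> emeasure (Pi\<^sub>M {..<p} (\<lambda>_. lborel :: 'a measure)) (Pi\<^sub>E {..<p} (\<lambda>_. ball 0 (real n)))"
      by (intro emeasure_mono eq sets_PiM_I_finite) auto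
    also have "\<dots> < \<infinity>"
      using emeasure_lborel_ball_finite[of "0::'a" "real n"]
      by (subst emeasure_PiM) (auto simp: power_less_top_ennreal)
    finally show ?thesis by simp
  qed
  ultimately have "countable ?F \<and> ?F \<subseteq> sets (lborel_pow p) \<and> \<Union>?F = space (lborel_pow p) \<and> (\<forall>a\<in>?F. emeasure (lborel_pow p) a \<noteq> \<infinity>)"
    by (auto intro: cart_power_borel)
  then show "\<exists>A. countable A \<and> A \<subseteq> sets (lborel_pow p :: (nat \<Rightarrow> 'a) measure) \<and> \<Union> A = space (lborel_pow p) \<and> (\<forall>a\<in>A. emeasure (lborel_pow p) a \<noteq> (\<infinity>::ennreal))"
    by (rule exI)
qed

lemma pow_space_expansion:
  fixes v :: "nat \<Rightarrow> 'a::euclidean_space"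
  assumes "v \<in> pow_space p"
  shows "(\<Sum>k<p. \<Sum>e\<in>Basis. (v k \<bullet> e) *\<^sub>R (\<lambda>i. if i = k then e else 0)) = v"
proof
  fix i
  have "(\<Sum>e\<in>Basis. (v k \<bullet> e) *\<^sub>R (if i = k then e else 0)) = (if k = i then v i else 0)" for k
    by (auto simp: euclidean_representation)
  then have "(\<Sum>k<p. \<Sum>e\<in>Basis. (v k \<bullet> e) *\<^sub>R (\<lambda>i. if i = k then e else 0)) i = (\<Sum>k<p. if k = i then v i else 0)"
    by (simp add: fun_vector_apply)
  also have "\<dots> = v i"
    using assms by (auto simp: pow_space_def)
  finally show "(\<Sum>k<p. \<Sum>e\<in>Basis. (v k \<bullet> e) *\<^sub>R (\<lambda>i. if i = k then e else 0)) i = v i" .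
qed

text \<open>Replaces the change of variables formula. The constant c, which stands for a
  determinant, may stay unknown: it cancels when two images under the same basis are compared, and
  it is harmless for null sets.\<close>

lemma lborel_pow_coordinates:
  fixes I :: "'i set" and b :: "'i \<Rightarrow> nat \<Rightarrow> 'a::euclidean_space"
  defines "M \<equiv> Pi\<^sub>M I (\<lambda>_. lborel :: real measure)"
  defines "\<Phi> \<equiv> \<lambda>y. \<Sum>i\<in>I. y i *\<^sub>R b i"
  assumes I: "finite I" and b: "\<And>i. i \<in> I \<Longrightarrow> b i \<in> pow_space p"
    and spanning: "\<And>v. v \<in> pow_space p \<Longrightarrow> \<exists>y. \<Phi> y = v"
    and indep: "\<And>y i. \<Phi> y = 0 \<Longrightarrow> i \<in> I \<Longrightarrow> y i = 0"
  obtains c where "\<And>X. X \<in> sets M \<Longrightarrow> \<Phi> ` X \<in> sets borel"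
    "\<And>X. X \<in> sets M \<Longrightarrow> emeasure (lborel_pow p) (\<Phi> ` X) = c * emeasure M X"
proof -
  let ?s = "\<lambda>k e. (\<lambda>i. if i = k then e else 0) :: nat \<Rightarrow> 'a"
  have s: "?s k e \<in> pow_space p" if "k < p" for k e using that by (auto simp: pow_space_def)
  \<comment> \<open>Chosen coefficients of the unit vectors. Extending them linearly in the first p
    components yields coordinate functionals \<kappa> that are defined on all functions and visibly
    measurable.\<close>
  define co where "co k e = (SOME y. \<Phi> y = ?s k e)" for k e
  have co: "\<Phi> (co k e) = ?s k e" if "k < p" for k e
    unfolding co_def using someI_ex[OF spanning[OF s[OF that]]] .
  define \<kappa> where "\<kappa> i v = (\<Sum>k<p. \<Sum>e\<in>Basis. (v k \<bullet> e) * co k e i)" for i v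
  have \<Phi>\<kappa>: "\<Phi> (\<lambda>i. \<kappa> i v) = v" if v: "v \<in> pow_space p" for v
  proof -
    have "\<Phi> (\<lambda>i. \<kappa> i v) = (\<Sum>i\<in>I. \<Sum>k<p. \<Sum>e\<in>Basis. ((v k \<bullet> e) * co k e i) *\<^sub>R b i)"
      by (simp add: \<Phi>_def \<kappa>_def scaleR_sum_left)
    also have "\<dots> = (\<Sum>k<p. \<Sum>i\<in>I. \<Sum>e\<in>Basis. ((v k \<bullet> e) * co k e i) *\<^sub>R b i)"
      by (rule sum.swap)
    also have "\<dots> = (\<Sum>k<p. \<Sum>e\<in>Basis. \<Sum>i\<in>I. ((v k \<bullet> e) * co k e i) *\<^sub>R b i)"
      by (intro sum.cong refl sum.swap)
    also have "\<dots> = (\<Sum>k<p. \<Sum>e\<in>Basis. (v k \<bullet> e) *\<^sub>R \<Phi> (co k e))"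
      by (simp add: \<Phi>_def scaleR_sum_right)
    also have "\<dots> = (\<Sum>k<p. \<Sum>e\<in>Basis. (v k \<bullet> e) *\<^sub>R ?s k e)"
      by (simp add: co)
    finally show ?thesis using pow_space_expansion[OF v] by simp
  qed
  have \<Phi>V: "\<Phi> y \<in> pow_space p" for y
    unfolding \<Phi>_def by (intro subspace_sum subspace_scale subspace_pow_space b)
  have \<kappa>\<Phi>: "\<kappa> i (\<Phi> y) = y i" if i: "i \<in> I" for i y
  proof -
    have "\<Phi> (\<lambda>i. \<kappa> i (\<Phi> y) - y i) = \<Phi> (\<lambda>i. \<kappa> i (\<Phi> y)) - \<Phi> y"
      by (simp add: \<Phi>_def scaleR_diff_left sum_subtractf)
    then have "\<Phi> (\<lambda>i. \<kappa> i (\<Phi> y) - y i) = 0" using \<Phi>\<kappa>[OF \<Phi>V] by simp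
    from indep[OF this i] show ?thesis by simp
  qed
  have add: "(\<lambda>(x, y). x + \<Phi> y) \<in> measurable (lborel_pow p \<Otimes>\<^sub>M M) (lborel_pow p)"
  proof -
    have "(\<lambda>(x, y). x + \<Phi> y) \<in> borel_measurable (lborel_pow p \<Otimes>\<^sub>M M)"
    proof (rule measurable_coordinatewise_then_product)
      fix k
      have "(\<lambda>z. snd z i) \<in> borel_measurable (lborel_pow p \<Otimes>\<^sub>M M)" if "i \<in> I" for i
      proof -
        have "(\<lambda>z. z i) \<in> measurable M lborel" unfolding M_def using that by measurable
        from measurable_compose[OF measurable_snd this] show ?thesis by simp
      qed
      then have "(\<lambda>z. fst z k + (\<Sum>i\<in>I. snd z i *\<^sub>R b i k)) \<in> borel_measurable (lborel_pow p \<Otimes>\<^sub>M M)"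
        by (intro borel_measurable_add borel_measurable_sum borel_measurable_scaleR) auto
      then show "(\<lambda>x. (case x of (x, y) \<Rightarrow> x + \<Phi> y) k) \<in> borel_measurable (lborel_pow p \<Otimes>\<^sub>M M)"
        by (simp add: case_prod_beta \<Phi>_def fun_vector_apply)
    qed
    then show ?thesis by (simp cong: measurable_cong_sets)
  qed
  have \<kappa>m: "\<kappa> i \<in> borel_measurable (lborel_pow p)" if "i \<in> I" for i
  proof -
    have "\<kappa> i \<in> borel_measurable borel" unfolding \<kappa>_def by measurable
    then show ?thesis by (simp cong: measurable_cong_sets)
  qed
  show ?thesis
  proof (rule haar_coordinates[of "lborel_pow p" I "pow_space p" b \<kappa>])
    fix f :: "(nat \<Rightarrow> 'a) \<Rightarrow> ennreal" and v :: "nat \<Rightarrow> 'a"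
    assume "f \<in> borel_measurable (lborel_pow p)" "v \<in> pow_space p"
    then show "(\<integral>\<^sup>+x. f (x + v) \<partial>lborel_pow p) = (\<integral>\<^sup>+x. f x \<partial>lborel_pow p)"
      by (intro lborel_pow_translate) (simp_all cong: measurable_cong_sets)
  next
    fix c
    assume "\<And>X. X \<in> sets (Pi\<^sub>M I (\<lambda>_. lborel)) \<Longrightarrow> (\<lambda>y. \<Sum>i\<in>I. y i *\<^sub>R b i) ` X \<in> sets (lborel_pow p)"
      "\<And>X. X \<in> sets (Pi\<^sub>M I (\<lambda>_. lborel)) \<Longrightarrow> emeasure (lborel_pow p) ((\<lambda>y. \<Sum>i\<in>I. y i *\<^sub>R b i) ` X) = c * emeasure (Pi\<^sub>M I (\<lambda>_. lborel)) X"
    then show thesis by (intro that[of c]) (simp_all add: M_def \<Phi>_def)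
  qed (use I b add \<kappa>m \<kappa>\<Phi> \<Phi>\<kappa> in \<open>simp_all add: M_def \<Phi>_def sigma_finite_lborel_pow subspace_pow_space emeasure_compl_pow_space\<close>)
qed

text \<open>The case of the space itself, with V the whole space; it serves the cells of the
  simplex.\<close>

lemma lborel_coordinates:
  fixes I :: "'i set" and b :: "'i \<Rightarrow> 'a::euclidean_space"
  defines "M \<equiv> Pi\<^sub>M I (\<lambda>_. lborel :: real measure)"
  defines "\<Phi> \<equiv> \<lambda>y. \<Sum>i\<in>I. y i *\<^sub>R b i"
  assumes I: "finite I"
    and spanning: "\<And>v. \<exists>y. \<Phi> y = v"
    and indep: "\<And>y i. \<Phi> y = 0 \<Longrightarrow> i \<in> I \<Longrightarrow> y i = 0"
  obtains c where "\<And>X. X \<in> sets M \<Longrightarrow> \<Phi> ` X \<in> sets borel"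
    "\<And>X. X \<in> sets M \<Longrightarrow> emeasure lborel (\<Phi> ` X) = c * emeasure M X"
proof -
  define co where "co e = (SOME y. \<Phi> y = e)" for e
  have co: "\<Phi> (co e) = e" for e
    unfolding co_def using someI_ex[OF spanning] .
  define \<kappa> where "\<kappa> i v = (\<Sum>e\<in>Basis. (v \<bullet> e) * co e i)" for i v
  have \<Phi>\<kappa>: "\<Phi> (\<lambda>i. \<kappa> i v) = v" for v
  proof -
    have "\<Phi> (\<lambda>i. \<kappa> i v) = (\<Sum>i\<in>I. \<Sum>e\<in>Basis. ((v \<bullet> e) * co e i) *\<^sub>R b i)"
      by (simp add: \<Phi>_def \<kappa>_def scaleR_sum_left)
    also have "\<dots> = (\<Sum>e\<in>Basis. \<Sum>i\<in>I. ((v \<bullet> e) * co e i) *\<^sub>R b i)"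
      by (rule sum.swap)
    also have "\<dots> = (\<Sum>e\<in>Basis. (v \<bullet> e) *\<^sub>R \<Phi> (co e))"
      by (simp add: \<Phi>_def scaleR_sum_right)
    finally show ?thesis by (simp add: co euclidean_representation)
  qed
  have \<kappa>\<Phi>: "\<kappa> i (\<Phi> y) = y i" if i: "i \<in> I" for i y
  proof -
    have "\<Phi> (\<lambda>i. \<kappa> i (\<Phi> y) - y i) = \<Phi> (\<lambda>i. \<kappa> i (\<Phi> y)) - \<Phi> y"
      by (simp add: \<Phi>_def scaleR_diff_left sum_subtractf)
    then have "\<Phi> (\<lambda>i. \<kappa> i (\<Phi> y) - y i) = 0" using \<Phi>\<kappa> by simp
    from indep[OF this i] show ?thesis by simp
  qed
  have add: "(\<lambda>(x, y). x + \<Phi> y) \<in> borel_measurable (lborel \<Otimes>\<^sub>M M)"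
  proof -
    have "(\<lambda>z. snd z i) \<in> borel_measurable (lborel \<Otimes>\<^sub>M M)" if "i \<in> I" for i
    proof -
      have "(\<lambda>z. z i) \<in> measurable M lborel" unfolding M_def using that by measurable
      from measurable_compose[OF measurable_snd this] show ?thesis by simp
    qed
    then have "(\<lambda>z. fst z + (\<Sum>i\<in>I. snd z i *\<^sub>R b i)) \<in> borel_measurable (lborel \<Otimes>\<^sub>M M)"
      by (intro borel_measurable_add borel_measurable_sum borel_measurable_scaleR) auto
    then show ?thesis by (simp add: case_prod_beta \<Phi>_def)
  qed
  have tr: "(\<integral>\<^sup>+x. f (x + v) \<partial>lborel) = (\<integral>\<^sup>+x. f x \<partial>lborel)"
    if "f \<in> borel_measurable borel" for f :: "'a \<Rightarrow> ennreal" and v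
  proof -
    have "(\<integral>\<^sup>+x. f x \<partial>lborel) = (\<integral>\<^sup>+x. f x \<partial>distr lborel borel ((+) v))"
      by (simp add: lborel_distr_plus)
    also have "\<dots> = (\<integral>\<^sup>+x. f (v + x) \<partial>lborel)"
      using that by (subst nn_integral_distr) auto
    finally show ?thesis by (simp add: add.commute)
  qed
  have \<kappa>m: "\<kappa> i \<in> borel_measurable lborel" for i
    unfolding \<kappa>_def
    by (intro borel_measurable_sum borel_measurable_times borel_measurable_inner borel_measurable_const) auto
  show ?thesis
  proof (rule haar_coordinates[of "lborel :: 'a measure" I UNIV b \<kappa>])
    fix c
    assume "\<And>X. X \<in> sets (Pi\<^sub>M I (\<lambda>_. lborel)) \<Longrightarrow> (\<lambda>y. \<Sum>i\<in>I. y i *\<^sub>R b i) ` X \<in> sets lborel"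
      "\<And>X. X \<in> sets (Pi\<^sub>M I (\<lambda>_. lborel)) \<Longrightarrow> emeasure lborel ((\<lambda>y. \<Sum>i\<in>I. y i *\<^sub>R b i) ` X) = c * emeasure (Pi\<^sub>M I (\<lambda>_. lborel)) X"
    then show thesis by (intro that[of c]) (simp_all add: M_def \<Phi>_def)
  qed (use I add \<kappa>m \<kappa>\<Phi> \<Phi>\<kappa> tr in \<open>simp_all add: M_def \<Phi>_def lborel.sigma_finite_measure_axioms\<close>)
qed

lemma pow_space_span:
  obtains S :: "(nat \<Rightarrow> 'a::euclidean_space) set"
  where "finite S" "S \<subseteq> pow_space p" "pow_space p = span S" "independent S" "card S = DIM('a) * p"
proof -
  let ?s = "\<lambda>(k, e). (\<lambda>i. if i = k then e else 0) :: nat \<Rightarrow> 'a"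
  let ?S = "?s ` ({..<p} \<times> Basis)"
  have sub: "?S \<subseteq> pow_space p" by (auto simp: pow_space_def)
  have inj: "inj_on ?s ({..<p} \<times> Basis)"
  proof (rule inj_onI, clarsimp)
    fix k l e f assume *: "e \<in> Basis" "f \<in> Basis" "(\<lambda>i. if i = k then e else 0) = (\<lambda>i. if i = l then f else (0::'a))"
    from fun_cong[OF *(3), of k] * have "k = l \<and> e = f" by (auto split: if_splits)
    then show "k = l \<and> e = f" .
  qed
  have "v \<in> span ?S" if v: "v \<in> pow_space p" for v :: "nat \<Rightarrow> 'a"
  proof -
    have "(\<Sum>k<p. \<Sum>e\<in>Basis. (v k \<bullet> e) *\<^sub>R ?s (k, e)) \<in> span ?S"
      by (intro span_sum span_scale span_base imageI) auto
    then show ?thesis using pow_space_expansion[OF v] by simp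
  qed
  moreover have "span ?S \<subseteq> pow_space p" using sub subspace_pow_space by (rule span_minimal)
  ultimately have sp: "pow_space p = span ?S" by auto
  have ind: "independent ?S"
  proof (rule independent_if_scalars_zero)
    fix f and x :: "nat \<Rightarrow> 'a" assume 0: "(\<Sum>x\<in>?S. f x *\<^sub>R x) = 0" and "x \<in> ?S"
    then obtain k e where x: "x = ?s (k, e)" "k < p" "e \<in> Basis" by auto
    have "0 = (\<Sum>z\<in>{..<p} \<times> Basis. f (?s z) *\<^sub>R ?s z) k"
      using 0 inj by (simp add: sum.reindex fun_vector_apply)
    also have "\<dots> = (\<Sum>l<p. \<Sum>d\<in>Basis. f (?s (l, d)) *\<^sub>R ?s (l, d) k)"
      by (simp add: fun_vector_apply sum.cartesian_product case_prod_beta)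
    also have "\<dots> = (\<Sum>l<p. if l = k then \<Sum>d\<in>Basis. f (?s (k, d)) *\<^sub>R d else 0)"
      by (intro sum.cong) auto
    also have "\<dots> = (\<Sum>d\<in>Basis. f (?s (k, d)) *\<^sub>R d)" using x by simp
    finally have "(\<Sum>d\<in>Basis. f (?s (k, d)) *\<^sub>R d) = 0" by simp
    then have "(\<Sum>d\<in>Basis. f (?s (k, d)) *\<^sub>R d) \<bullet> e = 0" by simp
    then show "f x = 0" using x by (simp add: inner_sum_left inner_Basis if_distrib cong: if_cong)
  qed auto
  have "card ?S = DIM('a) * p" using inj by (simp add: card_image)
  show ?thesis by (rule that[of ?S]) (fact | simp)+
qed

lemma finite_independent_pow_space:
  assumes "independent B" "B \<subseteq> (pow_space p :: (nat \<Rightarrow> 'a::euclidean_space) set)"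
  shows "finite B"
  by (rule pow_space_span[where p=p and 'a='a]) (use independent_span_bound[of _ B] assms in auto)

text \<open>Steinitz exchange with the standard basis, in both directions. This count is what makes
  the two exponents of a cell add up to the dimension.\<close>

lemma card_basis_pow_space:
  assumes "independent B" "B \<subseteq> (pow_space p :: (nat \<Rightarrow> 'a::euclidean_space) set)" "pow_space p \<subseteq> span B"
  shows "card B = DIM('a) * p"
proof -
  obtain S :: "(nat \<Rightarrow> 'a) set" where S: "finite S" "S \<subseteq> pow_space p" "pow_space p = span S" "independent S" "card S = DIM('a) * p"
    by (rule pow_space_span)
  have "card B \<le> card S" using independent_span_bound[of S B] S assms by auto
  moreover have "card S \<le> card B" using independent_span_bound[of B S] S assms finite_independent_pow_space[OF assms(1,2)] by auto
  ultimately show ?thesis using S by simp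
qed

lemma basis_expansion_pow_space:
  assumes B: "independent B" "B \<subseteq> (pow_space p :: (nat \<Rightarrow> 'a::euclidean_space) set)" "pow_space p \<subseteq> span B"
  shows "\<And>v. v \<in> pow_space p \<Longrightarrow> \<exists>y. (\<Sum>x\<in>B. y x *\<^sub>R x) = v"
    and "\<And>y x. (\<Sum>x\<in>B. y x *\<^sub>R x) = 0 \<Longrightarrow> x \<in> B \<Longrightarrow> y x = 0"
proof -
  have fin: "finite B" using B by (intro finite_independent_pow_space)
  show "\<exists>y. (\<Sum>x\<in>B. y x *\<^sub>R x) = v" if "v \<in> pow_space p" for v
    using that B(3) unfolding span_finite[OF fin] by auto
  show "y x = 0" if "(\<Sum>x\<in>B. y x *\<^sub>R x) = 0" "x \<in> B" for y x
    using independentD[OF B(1) fin subset_refl that] .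
qed

text \<open>A basis of L extends to one of \<open>pow_space p\<close> with a new vector v0, and L
  has v0-coordinate 0. In coordinates it lies in a box with a one-point side, which is null. The
  image Z of that box is returned because it is measurable by construction.\<close>

lemma proper_subspace_null:
  fixes L :: "(nat \<Rightarrow> 'a::euclidean_space) set"
  assumes L: "subspace L" "L \<subseteq> pow_space p" "L \<noteq> pow_space p"
  obtains Z where "L \<subseteq> Z" "Z \<in> sets borel" "emeasure (lborel_pow p) Z = 0"
proof -
  obtain C where C: "C \<subseteq> L" "independent C" "L \<subseteq> span C"
    by (rule basis_exists)
  obtain B where B: "C \<subseteq> B" "B \<subseteq> pow_space p" "independent B" "pow_space p \<subseteq> span B"
    by (rule maximal_independent_subset_extend[OF order_trans[OF C(1) L(2)] C(2)])
  have fin: "finite B" using B by (intro finite_independent_pow_space)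
  have "\<not> B \<subseteq> C"
  proof
    assume "B \<subseteq> C"
    then have "pow_space p \<subseteq> span L" using B(4) C(1) span_mono by (meson order_trans)
    then show False using L by (simp add: span_eq_iff[THEN iffD2])
  qed
  then obtain v0 where v0: "v0 \<in> B" "v0 \<notin> C" by auto
  let ?\<Phi> = "\<lambda>y. \<Sum>x\<in>B. y x *\<^sub>R x"
  let ?X = "Pi\<^sub>E B (\<lambda>v. if v = v0 then {0::real} else UNIV)"
  interpret product_sigma_finite "\<lambda>_::nat \<Rightarrow> 'a. lborel :: real measure" by standard
  have X: "?X \<in> sets (Pi\<^sub>M B (\<lambda>_. lborel))" using fin by (intro sets_PiM_I_finite) auto
  obtain c where c: "\<And>X. X \<in> sets (Pi\<^sub>M B (\<lambda>_. lborel)) \<Longrightarrow> ?\<Phi> ` X \<in> sets borel"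
    "\<And>X. X \<in> sets (Pi\<^sub>M B (\<lambda>_. lborel)) \<Longrightarrow> emeasure (lborel_pow p) (?\<Phi> ` X) = c * emeasure (Pi\<^sub>M B (\<lambda>_. lborel)) X"
  proof (rule lborel_pow_coordinates[of B "\<lambda>x. x" p])
    show "\<exists>y. (\<Sum>x\<in>B. y x *\<^sub>R x) = v" if "v \<in> pow_space p" for v
      using that by (rule basis_expansion_pow_space(1)[OF B(3,2,4)])
    show "y i = 0" if "(\<Sum>x\<in>B. y x *\<^sub>R x) = 0" "i \<in> B" for y i
      using that by (rule basis_expansion_pow_space(2)[OF B(3,2,4)])
  qed (use fin B(2) in blast)+
  have "(\<Prod>v\<in>B. emeasure lborel (if v = v0 then {0::real} else UNIV)) = 0"
    using v0 fin by (intro prod_zero bexI[of _ v0]) auto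
  then have X0: "emeasure (Pi\<^sub>M B (\<lambda>_. lborel)) ?X = 0"
    using fin by (subst emeasure_PiM) auto
  have L_sub: "L \<subseteq> ?\<Phi> ` ?X"
  proof
    fix x assume "x \<in> L"
    then have "x \<in> span (B - {v0})" using C(3) span_mono[of C "B - {v0}"] B(1) v0 by auto
    then obtain u where u: "x = (\<Sum>v\<in>B - {v0}. u v *\<^sub>R v)"
      using span_finite[of "B - {v0}"] fin by auto
    let ?u = "\<lambda>v\<in>B. if v = v0 then 0 else u v"
    have "?\<Phi> ?u = x" using v0 fin unfolding u by (subst sum.remove[of _ v0]) (auto intro!: sum.cong)
    moreover have "?u \<in> ?X" by auto
    ultimately show "x \<in> ?\<Phi> ` ?X" by blast
  qed
  show ?thesis
    by (rule that[OF L_sub c(1)[OF X]]) (simp only: c(2)[OF X] X0 mult_zero_right)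
qed

section \<open>Regular triangulations of polyhedral cones\<close>

text \<open>The linear functional on \<open>span \<sigma>\<close> that agrees with \<omega> on the
  basis \<sigma>: the hyperplane through the lifted vertices. If \<sigma> is dependent or x lies
  outside its span, \<open>representation\<close> and hence the height is 0, which allows \<sigma>
  to range over all subsets.\<close>

definition height :: "('w::real_vector \<Rightarrow> real) \<Rightarrow> 'w set \<Rightarrow> 'w \<Rightarrow> real"
  where "height \<omega> \<sigma> x = (\<Sum>k\<in>\<sigma>. representation \<sigma> x k * \<omega> k)"

lemma representation_eq_coeff:
  assumes "independent \<sigma>" "finite \<sigma>" "k \<in> \<sigma>"
  shows "representation \<sigma> (\<Sum>x\<in>\<sigma>. c x *\<^sub>R x) k = c k"
proof -
  have "representation \<sigma> (\<Sum>x\<in>\<sigma>. c x *\<^sub>R x) = (\<lambda>b. \<Sum>x\<in>\<sigma>. representation \<sigma> (c x *\<^sub>R x) b)"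
    using assms by (intro representation_sum) (auto intro: span_scale span_base)
  also have "\<dots> = (\<lambda>b. \<Sum>x\<in>\<sigma>. c x * representation \<sigma> x b)"
    using assms by (intro ext sum.cong) (auto simp: representation_scale span_base)
  finally show ?thesis using assms
    by (simp add: representation_basis if_distrib cong: if_cong)
qed

lemma representation_expansion:
  assumes "independent \<sigma>" "finite \<sigma>" "x \<in> span \<sigma>"
  shows "(\<Sum>k\<in>\<sigma>. representation \<sigma> x k *\<^sub>R k) = x"
  by (rule sum_representation_eq) (use assms in auto)

lemma height_coeff:
  assumes "independent \<sigma>" "finite \<sigma>"
  shows "height \<omega> \<sigma> (\<Sum>x\<in>\<sigma>. c x *\<^sub>R x) = (\<Sum>x\<in>\<sigma>. c x * \<omega> x)"
  unfolding height_def using assms by (intro sum.cong) (auto simp: representation_eq_coeff)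

lemma height_sum:
  assumes "independent \<sigma>" "finite \<sigma>" "\<And>x. x \<in> s \<Longrightarrow> x \<in> span \<sigma>"
  shows "height \<omega> \<sigma> (\<Sum>x\<in>s. c x *\<^sub>R x) = (\<Sum>x\<in>s. c x * height \<omega> \<sigma> x)"
proof -
  have "representation \<sigma> (\<Sum>x\<in>s. c x *\<^sub>R x) k = (\<Sum>x\<in>s. c x * representation \<sigma> x k)" for k
    using assms by (subst representation_sum) (auto simp: representation_scale intro!: span_scale)
  then show ?thesis
    unfolding height_def
    by (simp add: sum_distrib_right sum_distrib_left mult.assoc) (rule sum.swap)
qed

text \<open>Caratheodory: subtract multiples of a dependency of nonpositive cost until a coefficient vanishes.\<close>

lemma conic_reduce:
  fixes J :: "'w::real_vector set"
  assumes J: "finite J" and hf: "linear hf" "\<And>x. x \<in> J \<Longrightarrow> hf x = (1::real)"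
    and c: "\<And>x. x \<in> J \<Longrightarrow> 0 \<le> c x"
  shows "\<exists>c'. (\<forall>x\<in>J. 0 \<le> c' x) \<and> (\<Sum>x\<in>J. c' x *\<^sub>R x) = (\<Sum>x\<in>J. c x *\<^sub>R x)
    \<and> (\<Sum>x\<in>J. c' x * \<omega> x) \<le> (\<Sum>x\<in>J. c x * \<omega> x) \<and> independent {x\<in>J. c' x > 0}"
  using c
proof (induction "card {x\<in>J. c x > 0}" arbitrary: c rule: less_induct)
  case less
  define s where "s = {x\<in>J. c x > 0}"
  have s: "finite s" "s \<subseteq> J" using J by (auto simp: s_def)
  show ?case
  proof (cases "independent s")
    case True
    then show ?thesis using less.prems by (intro exI[of _ c]) (auto simp: s_def)
  next
    case False
    then obtain u0 where u0: "\<exists>v\<in>s. u0 v \<noteq> 0" "(\<Sum>v\<in>s. u0 v *\<^sub>R v) = 0"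
      using dependent_finite[OF s(1)] by auto
    define u where "u = (if (\<Sum>v\<in>s. u0 v * \<omega> v) \<le> 0 then u0 else (\<lambda>v. - u0 v))"
    have u: "\<exists>v\<in>s. u v \<noteq> 0" "(\<Sum>v\<in>s. u v *\<^sub>R v) = 0" "(\<Sum>v\<in>s. u v * \<omega> v) \<le> 0"
      using u0 by (auto simp: u_def sum_negf)
    \<comment> \<open>All points lie on the hyperplane \<open>hf = 1\<close>, so the coefficients of
      a dependency sum to 0. A nontrivial one therefore has a negative coefficient, and moving along
      it must exhaust some positive weight.\<close>
    have "(\<Sum>v\<in>s. u v) = (\<Sum>v\<in>s. u v * hf v)" using hf(2) s by (intro sum.cong) auto
    also have "\<dots> = hf (\<Sum>v\<in>s. u v *\<^sub>R v)" using hf(1) by (simp add: linear_sum linear_scale)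
    finally have su: "(\<Sum>v\<in>s. u v) = 0" using u hf by (simp add: linear_0)
    have "\<exists>v\<in>s. u v < 0"
    proof (rule ccontr)
      assume "\<not> (\<exists>v\<in>s. u v < 0)"
      then have "\<forall>v\<in>s. u v = 0" using su s by (subst (asm) sum_nonneg_eq_0_iff) (auto simp: not_less)
      with u show False by auto
    qed
    \<comment> \<open>The ratio test of the simplex method: the minimum is the longest step that
      keeps all weights nonnegative, and the weight of its minimizer v1 drops to 0.\<close>
    define R where "R = (\<lambda>v. c v / (- u v)) ` {v\<in>s. u v < 0}"
    have R: "finite R" "R \<noteq> {}" using s \<open>\<exists>v\<in>s. u v < 0\<close> by (auto simp: R_def)
    have "\<exists>v\<in>{v\<in>s. u v < 0}. Min R = c v / (- u v)"
      using Min_in[OF R] by (simp only: R_def image_iff)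
    then obtain v1 where v1: "v1 \<in> s" "u v1 < 0" "Min R = c v1 / (- u v1)" by blast
    define \<theta> where "\<theta> = Min R"
    have \<theta>: "0 < \<theta>" using v1 by (auto simp: \<theta>_def s_def divide_pos_neg)
    define c' where "c' v = (if v \<in> s then c v + \<theta> * u v else c v)" for v
    have c'0: "0 \<le> c' v" if "v \<in> J" for v
    proof (cases "v \<in> s \<and> u v < 0")
      case True
      then have "\<theta> \<le> c v / (- u v)" using R unfolding \<theta>_def R_def by (intro Min_le) auto
      moreover have "0 < - u v" using True by simp
      ultimately have "\<theta> * (- u v) \<le> c v" using pos_le_divide_eq by blast
      then show ?thesis using True by (simp add: c'_def)
    next
      case False
      then show ?thesis using less.prems[OF that] \<theta> by (auto simp: c'_def)
    qed
    have split: "(\<Sum>x\<in>J. c' x *\<^sub>R x) = (\<Sum>x\<in>J. c x *\<^sub>R x) + \<theta> *\<^sub>R (\<Sum>x\<in>s. u x *\<^sub>R x)"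
    proof -
      have "(\<Sum>x\<in>J. c' x *\<^sub>R x) = (\<Sum>x\<in>J. c x *\<^sub>R x + (if x \<in> s then \<theta> *\<^sub>R u x *\<^sub>R x else 0))"
        by (intro sum.cong) (auto simp: c'_def scaleR_add_left)
      also have "\<dots> = (\<Sum>x\<in>J. c x *\<^sub>R x) + (\<Sum>x\<in>s. \<theta> *\<^sub>R u x *\<^sub>R x)"
        using s J by (simp add: sum.distrib sum.If_cases Int_absorb1)
      finally show ?thesis by (simp add: scaleR_sum_right)
    qed
    have splitw: "(\<Sum>x\<in>J. c' x * \<omega> x) = (\<Sum>x\<in>J. c x * \<omega> x) + \<theta> * (\<Sum>x\<in>s. u x * \<omega> x)"
    proof -
      have "(\<Sum>x\<in>J. c' x * \<omega> x) = (\<Sum>x\<in>J. c x * \<omega> x + (if x \<in> s then \<theta> * (u x * \<omega> x) else 0))"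
        by (intro sum.cong) (auto simp: c'_def algebra_simps)
      also have "\<dots> = (\<Sum>x\<in>J. c x * \<omega> x) + (\<Sum>x\<in>s. \<theta> * (u x * \<omega> x))"
        using s J by (simp add: sum.distrib sum.If_cases Int_absorb1)
      finally show ?thesis by (simp add: sum_distrib_left)
    qed
    have "{x\<in>J. c' x > 0} \<subseteq> s - {v1}"
    proof
      fix x assume x: "x \<in> {x\<in>J. c' x > 0}"
      have "x \<in> s" using x by (auto simp: c'_def s_def split: if_splits)
      moreover have "c' v1 = 0" using v1 by (simp add: c'_def \<theta>_def)
      ultimately show "x \<in> s - {v1}" using x by auto
    qed
    then have "card {x\<in>J. c' x > 0} < card s"
      using s v1 by (meson card_Diff1_less card_mono finite_Diff le_less_trans)
    from less.hyps[of c', OF this[unfolded s_def] c'0] obtain c'' where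
      c'': "\<forall>x\<in>J. 0 \<le> c'' x" "(\<Sum>x\<in>J. c'' x *\<^sub>R x) = (\<Sum>x\<in>J. c' x *\<^sub>R x)"
      "(\<Sum>x\<in>J. c'' x * \<omega> x) \<le> (\<Sum>x\<in>J. c' x * \<omega> x)" "independent {x\<in>J. c'' x > 0}" by blast
    have "\<theta> * (\<Sum>x\<in>s. u x * \<omega> x) \<le> 0" using \<theta> u(3) by (simp add: mult_nonneg_nonpos)
    then show ?thesis using c'' split splitw u(2) by (intro exI[of _ c'']) auto
  qed
qed

text \<open>Linear programming duality in primal form. Take the cheapest of the finitely many
  independent supports representing z. If some x lay strictly below its height, shifting a little
  weight from \<sigma> to x would lower the cost. The assumption \<open>nd\<close> excludes
  degenerate z, so that the optimal support spans everything.\<close>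

lemma exists_optimal_basis:
  fixes J W :: "'w::real_vector set"
  assumes J: "finite J" and hf: "linear hf" "\<And>x. x \<in> J \<Longrightarrow> hf x = (1::real)"
    and c: "\<And>x. x \<in> J \<Longrightarrow> 0 \<le> c x" and z: "z = (\<Sum>x\<in>J. c x *\<^sub>R x)"
    and nd: "\<And>s. s \<subseteq> J \<Longrightarrow> z \<in> span s \<Longrightarrow> W \<subseteq> span s" and JW: "J \<subseteq> W"
  obtains \<sigma> where "\<sigma> \<subseteq> J" "independent \<sigma>" "W \<subseteq> span \<sigma>"
    "\<And>k. k \<in> \<sigma> \<Longrightarrow> 0 < representation \<sigma> z k" "\<And>x. x \<in> J - \<sigma> \<Longrightarrow> height \<omega> \<sigma> x \<le> \<omega> x"
proof -
  define F where "F = {s. s \<subseteq> J \<and> independent s \<and> (\<exists>c. (\<forall>x\<in>s. c x > 0) \<and> (\<Sum>x\<in>s. c x *\<^sub>R x) = z)}"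
  have finF: "finite F" using J by (auto simp: F_def intro: finite_subset[of _ "Pow J"])
  have feas: "\<exists>s\<in>F. height \<omega> s z \<le> (\<Sum>x\<in>J. d x * \<omega> x)"
    if d: "\<And>x. x \<in> J \<Longrightarrow> 0 \<le> d x" "(\<Sum>x\<in>J. d x *\<^sub>R x) = z" for d
  proof -
    obtain c' where c': "\<forall>x\<in>J. 0 \<le> c' x" "(\<Sum>x\<in>J. c' x *\<^sub>R x) = z"
      "(\<Sum>x\<in>J. c' x * \<omega> x) \<le> (\<Sum>x\<in>J. d x * \<omega> x)" "independent {x\<in>J. c' x > 0}"
      using conic_reduce[where c = d and \<omega> = \<omega>, OF J hf d(1)] unfolding d(2) by blast
    let ?s = "{x\<in>J. c' x > 0}"
    have zs: "(\<Sum>x\<in>?s. c' x *\<^sub>R x) = z"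
      unfolding c'(2)[symmetric] using c'(1) J by (intro sum.mono_neutral_left) force+
    have "height \<omega> ?s z = (\<Sum>x\<in>?s. c' x * \<omega> x)"
      using height_coeff[OF c'(4), of \<omega> c'] J zs by simp
    also have "\<dots> = (\<Sum>x\<in>J. c' x * \<omega> x)" using c'(1) J by (intro sum.mono_neutral_left) force+
    finally have "height \<omega> ?s z \<le> (\<Sum>x\<in>J. d x * \<omega> x)" using c'(3) by simp
    moreover have "?s \<in> F" using c' zs by (auto simp: F_def)
    ultimately show ?thesis by blast
  qed
  then have "F \<noteq> {}" using c z by auto
  then obtain \<sigma> where \<sigma>: "\<sigma> \<in> F" "\<And>s. s \<in> F \<Longrightarrow> height \<omega> \<sigma> z \<le> height \<omega> s z"
    using ex_is_arg_min_if_finite[OF finF, of "\<lambda>s. height \<omega> s z"]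
    by (auto simp: is_arg_min_linorder)
  then obtain d where d: "\<And>x. x \<in> \<sigma> \<Longrightarrow> d x > 0" "(\<Sum>x\<in>\<sigma>. d x *\<^sub>R x) = z"
    by (auto simp: F_def)
  have \<sigma>J: "\<sigma> \<subseteq> J" and ind: "independent \<sigma>" using \<sigma> by (auto simp: F_def)
  have fin: "finite \<sigma>" using \<sigma>J J by (rule finite_subset)
  have sp: "W \<subseteq> span \<sigma>"
    using d(2) by (intro nd \<sigma>J) (auto intro: span_sum span_scale span_base)
  have rep: "representation \<sigma> z k = d k" if "k \<in> \<sigma>" for k
    unfolding d(2)[symmetric] by (rule representation_eq_coeff[OF ind fin that])
  have hz: "height \<omega> \<sigma> z = (\<Sum>x\<in>\<sigma>. d x * \<omega> x)"
    unfolding d(2)[symmetric] by (rule height_coeff[OF ind fin])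
  have "height \<omega> \<sigma> x \<le> \<omega> x" if x: "x \<in> J - \<sigma>" for x
  proof (rule ccontr)
    assume contra: "\<not> height \<omega> \<sigma> x \<le> \<omega> x"
    define \<alpha> where "\<alpha> = representation \<sigma> x"
    have x\<alpha>: "(\<Sum>k\<in>\<sigma>. \<alpha> k *\<^sub>R k) = x"
      unfolding \<alpha>_def using x JW sp by (intro representation_expansion ind fin) auto
    \<comment> \<open>These bounds keep every \<open>d k - \<epsilon> * \<alpha> k\<close>
      nonnegative; the summand 1 in the denominator avoids division by 0, and the element 1 keeps E
      nonempty for empty \<sigma>.\<close>
    define E where "E = insert 1 ((\<lambda>k. d k / (\<bar>\<alpha> k\<bar> + 1)) ` \<sigma>)"
    define \<epsilon> where "\<epsilon> = Min E"
    have E: "finite E" "E \<noteq> {}" using fin by (auto simp: E_def)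
    have \<epsilon>: "0 < \<epsilon>" unfolding \<epsilon>_def using E d by (subst Min_gr_iff) (auto simp: E_def intro!: divide_pos_pos)
    have \<epsilon>d: "\<epsilon> * \<alpha> k \<le> d k" if k: "k \<in> \<sigma>" for k
    proof -
      have "\<epsilon> \<le> d k / (\<bar>\<alpha> k\<bar> + 1)" unfolding \<epsilon>_def using E k by (intro Min_le) (auto simp: E_def)
      then have "\<epsilon> * (\<bar>\<alpha> k\<bar> + 1) \<le> d k" by (subst (asm) pos_le_divide_eq) auto
      moreover have "\<epsilon> * \<alpha> k \<le> \<epsilon> * (\<bar>\<alpha> k\<bar> + 1)" using \<epsilon> by (intro mult_left_mono) auto
      ultimately show ?thesis by linarith
    qed
    define e where "e k = (if k \<in> \<sigma> then d k - \<epsilon> * \<alpha> k else if k = x then \<epsilon> else 0)" for k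
    have sumJ: "(\<Sum>k\<in>J. g k) = (\<Sum>k\<in>\<sigma>. g k) + g x"
      if "\<And>k. k \<in> J - \<sigma> - {x} \<Longrightarrow> g k = 0" for g :: "'w \<Rightarrow> 'z::comm_monoid_add"
    proof -
      have "(\<Sum>k\<in>J. g k) = (\<Sum>k\<in>insert x \<sigma>. g k)"
        using J \<sigma>J x that by (intro sum.mono_neutral_right) auto
      then show ?thesis using fin x by (simp add: add.commute)
    qed
    have "(\<Sum>k\<in>J. e k *\<^sub>R k) = (\<Sum>k\<in>\<sigma>. (d k - \<epsilon> * \<alpha> k) *\<^sub>R k) + \<epsilon> *\<^sub>R x"
      using x by (subst sumJ) (auto simp: e_def)
    also have "\<dots> = z"
      using x\<alpha> d(2) by (simp add: scaleR_diff_left sum_subtractf flip: scaleR_scaleR scaleR_sum_right)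
    finally have ez: "(\<Sum>k\<in>J. e k *\<^sub>R k) = z" .
    have e0: "0 \<le> e k" if "k \<in> J" for k using \<epsilon> \<epsilon>d by (auto simp: e_def)
    have "(\<Sum>k\<in>J. e k * \<omega> k) = (\<Sum>k\<in>\<sigma>. (d k - \<epsilon> * \<alpha> k) * \<omega> k) + \<epsilon> * \<omega> x"
      using x by (subst sumJ) (auto simp: e_def)
    also have "\<dots> = height \<omega> \<sigma> z - \<epsilon> * height \<omega> \<sigma> x + \<epsilon> * \<omega> x"
      unfolding hz unfolding height_def \<alpha>_def[symmetric]
      by (simp add: left_diff_distrib sum_subtractf sum_distrib_left mult.assoc)
    also have "\<dots> < height \<omega> \<sigma> z" using contra \<epsilon> by simp
    finally show False using feas[OF e0 ez] \<sigma>(2) by force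
  qed
  then show ?thesis using that[OF \<sigma>J ind sp] rep d(1) by auto
qed

text \<open>The maximal cells of the lower hull of the configuration \<open>J\<close> lifted by \<open>\<omega>\<close>.\<close>

definition regular_triangulation :: "('w::real_vector \<Rightarrow> real) \<Rightarrow> 'w set \<Rightarrow> 'w set \<Rightarrow> 'w set set"
  where "regular_triangulation \<omega> W J =
    {\<sigma>. \<sigma> \<subseteq> J \<and> independent \<sigma> \<and> W \<subseteq> span \<sigma> \<and> (\<forall>x\<in>J - \<sigma>. height \<omega> \<sigma> x < \<omega> x)}"

text \<open>Lower hull argument: the functional of one cell is at most \<omega> at the vertices of
  the other, strictly below it at those not shared. Evaluated at a positive combination z this
  orders the two heights of z, with equality only if one cell contains the other. Exchanging the
  roles gives equality of the cells.\<close>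

lemma regular_triangulation_disjoint:
  assumes J: "finite J" "J \<subseteq> W" and \<sigma>: "\<sigma> \<in> regular_triangulation \<omega> W J" and \<tau>: "\<tau> \<in> regular_triangulation \<omega> W J"
    and z: "z \<in> W" and c: "\<And>k. k \<in> \<sigma> \<Longrightarrow> 0 < representation \<sigma> z k"
    and d: "\<And>k. k \<in> \<tau> \<Longrightarrow> 0 < representation \<tau> z k"
  shows "\<sigma> = \<tau>"
proof -
  have le: "height \<omega> \<tau>' z \<le> height \<omega> \<sigma>' z \<and> (height \<omega> \<tau>' z = height \<omega> \<sigma>' z \<longrightarrow> \<sigma>' \<subseteq> \<tau>')"
    if \<sigma>': "\<sigma>' \<in> regular_triangulation \<omega> W J" and \<tau>': "\<tau>' \<in> regular_triangulation \<omega> W J"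
      and c: "\<And>k. k \<in> \<sigma>' \<Longrightarrow> 0 < representation \<sigma>' z k" for \<sigma>' \<tau>'
  proof -
    have i: "independent \<sigma>'" "finite \<sigma>'" "\<sigma>' \<subseteq> J" "W \<subseteq> span \<sigma>'" "independent \<tau>'" "finite \<tau>'" "\<tau>' \<subseteq> J" "W \<subseteq> span \<tau>'"
      using \<sigma>' \<tau>' J by (auto simp: regular_triangulation_def intro: finite_subset)
    have hz: "height \<omega> \<tau>' z = (\<Sum>k\<in>\<sigma>'. representation \<sigma>' z k * height \<omega> \<tau>' k)"
      using height_sum[OF i(5,6), of \<sigma>' \<omega> "representation \<sigma>' z"] representation_expansion[OF i(1,2), of z] i z J
      by (metis subset_iff)
    have hk: "height \<omega> \<tau>' k \<le> \<omega> k" if "k \<in> \<sigma>'" for k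
    proof (cases "k \<in> \<tau>'")
      case True
      then have "height \<omega> \<tau>' k = \<omega> k"
        using i by (simp add: height_def representation_basis if_distrib[of "\<lambda>x. x * _"] cong: if_cong)
      then show ?thesis by simp
    next
      case False
      then show ?thesis using \<tau>' that i by (force simp: regular_triangulation_def)
    qed
    have le: "height \<omega> \<tau>' z \<le> height \<omega> \<sigma>' z"
      unfolding hz unfolding height_def[of \<omega> \<sigma>'] using c hk by (intro sum_mono mult_left_mono) (auto intro: less_imp_le)
    moreover have "\<sigma>' \<subseteq> \<tau>'" if eq: "height \<omega> \<tau>' z = height \<omega> \<sigma>' z"
    proof (rule ccontr)
      assume "\<not> \<sigma>' \<subseteq> \<tau>'"
      then obtain k where k: "k \<in> \<sigma>'" "k \<notin> \<tau>'" by auto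
      then have "height \<omega> \<tau>' k < \<omega> k" using \<tau>' i by (auto simp: regular_triangulation_def)
      then have "height \<omega> \<tau>' z < height \<omega> \<sigma>' z"
        unfolding hz unfolding height_def[of \<omega> \<sigma>'] using c hk k i
        by (intro sum_strict_mono_ex1) (auto intro!: mult_left_mono less_imp_le[OF c])
      with eq show False by simp
    qed
    ultimately show ?thesis by blast
  qed
  from le[OF \<sigma> \<tau> c] le[OF \<tau> \<sigma> d] show ?thesis by auto
qed

text \<open>The heights are powers \<open>r ^ e x\<close> with distinct exponents, those of J coming
  first. There are finitely many conditions, and each holds for all large r: an equality would make
  r a root of a nonzero polynomial, and a fixed combination of lower powers is dominated by a higher
  power. The second property is the one that lets every cell for J survive in J'.\<close>

lemma exists_generic_heights:
  fixes J J' W :: "'w::real_vector set"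
  assumes J': "finite J'" "J \<subseteq> J'"
  obtains \<omega> where
    "\<And>\<sigma> x. \<sigma> \<subseteq> J' \<Longrightarrow> x \<in> J' - \<sigma> \<Longrightarrow> height \<omega> \<sigma> x \<noteq> \<omega> x"
    "\<And>\<sigma> x. \<sigma> \<subseteq> J \<Longrightarrow> x \<in> J' - J \<Longrightarrow> height \<omega> \<sigma> x < \<omega> x"
proof -
  have fJ: "finite J" using J' by (rule finite_subset[rotated])
  obtain f n where f: "f ` J = {i. i < (n::nat)}" "inj_on f J"
    using finite_imp_inj_to_nat_seg[OF fJ] by auto
  obtain g m where g: "g ` (J' - J) = {i. i < (m::nat)}" "inj_on g (J' - J)"
    using finite_imp_inj_to_nat_seg[of "J' - J"] J' by auto
  define e where "e x = (if x \<in> J then f x else n + g x)" for x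
  have fn: "f x < n" if "x \<in> J" for x
    using imageI[OF that, of f] unfolding f(1) by simp
  have e_inj: "e x \<noteq> e y" if "x \<in> J'" "y \<in> J'" "x \<noteq> y" for x y
    using that inj_onD[OF f(2), of x y] inj_onD[OF g(2), of x y] fn[of x] fn[of y]
    by (cases "x \<in> J"; cases "y \<in> J"; simp add: e_def; blast?)
  have e_less: "e x < e y" if "x \<in> J" "y \<in> J' - J" for x y
    using that fn[of x] by (auto simp: e_def)
  let ?\<omega> = "\<lambda>r x. r ^ e x :: real"
  have 1: "eventually (\<lambda>r. height (?\<omega> r) \<sigma> x \<noteq> ?\<omega> r x) at_top" if \<sigma>: "\<sigma> \<subseteq> J'" and x: "x \<in> J' - \<sigma>" for \<sigma> x
  proof -
    \<comment> \<open>Distinct exponents prevent any cancellation of \<open>monom 1 (e x)\<close>,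
      since x is not in \<sigma>; so the coefficient of P at \<open>e x\<close> is -1.\<close>
    define P where "P = (\<Sum>k\<in>\<sigma>. monom (representation \<sigma> x k) (e k)) - monom 1 (e x)"
    have "coeff P (e x) = (\<Sum>k\<in>\<sigma>. if e k = e x then representation \<sigma> x k else 0) - 1"
      by (simp add: P_def coeff_sum)
    also have "(\<Sum>k\<in>\<sigma>. if e k = e x then representation \<sigma> x k else 0) = 0"
      using \<sigma> x e_inj by (intro sum.neutral) auto
    finally have "P \<noteq> 0" by auto
    then have "finite {r. poly P r = 0}" by (rule poly_roots_finite)
    then obtain M where M: "\<And>r. poly P r = 0 \<Longrightarrow> r \<le> M"
      using bdd_above_finite unfolding bdd_above_def by blast
    define B where "B = M + 1"
    have B: "r < B" if "poly P r = 0" for r using M[OF that] by (simp add: B_def)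
    have "eventually (\<lambda>r. r \<ge> B) at_top" by (rule eventually_ge_at_top)
    then show ?thesis
    proof eventually_elim
      case (elim r)
      then have "poly P r \<noteq> 0" using B by force
      then show ?case by (simp add: P_def poly_sum poly_monom height_def)
    qed
  qed
  have 2: "eventually (\<lambda>r. height (?\<omega> r) \<sigma> x < ?\<omega> r x) at_top" if \<sigma>: "\<sigma> \<subseteq> J" and x: "x \<in> J' - J" for \<sigma> x
  proof -
    define B where "B = (\<Sum>k\<in>\<sigma>. \<bar>representation \<sigma> x k\<bar>)"
    have "eventually (\<lambda>r. r > max 1 B) at_top" by (rule eventually_gt_at_top)
    then show ?thesis
    proof eventually_elim
      case (elim r)
      show ?case
      proof (cases "\<sigma> = {}")
        case True
        then show ?thesis using elim by (simp add: height_def)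
      next
        case False
        then obtain k where "k \<in> \<sigma>" by auto
        then have ex: "e x > 0" using e_less[of k x] \<sigma> x by auto
        have "height (?\<omega> r) \<sigma> x \<le> (\<Sum>k\<in>\<sigma>. \<bar>representation \<sigma> x k\<bar> * r ^ (e x - 1))"
          unfolding height_def
        proof (rule sum_mono)
          fix k assume k: "k \<in> \<sigma>"
          have "r ^ e k \<le> r ^ (e x - 1)" using e_less[of k x] k \<sigma> x elim by (intro power_increasing) auto
          then show "representation \<sigma> x k * r ^ e k \<le> \<bar>representation \<sigma> x k\<bar> * r ^ (e x - 1)"
            using elim by (intro mult_mono) auto
        qed
        also have "\<dots> = B * r ^ (e x - 1)" by (simp add: B_def sum_distrib_right)
        also have "\<dots> < r * r ^ (e x - 1)" using elim by (intro mult_strict_right_mono) auto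
        also have "\<dots> = r ^ e x" using ex by (simp flip: power_Suc)
        finally show ?thesis .
      qed
    qed
  qed
  have e1: "eventually (\<lambda>r. \<forall>\<sigma>\<in>Pow J'. \<forall>x\<in>J' - \<sigma>. height (?\<omega> r) \<sigma> x \<noteq> ?\<omega> r x) at_top"
    using J' 1 by (intro eventually_ball_finite ballI) auto
  have e2: "eventually (\<lambda>r. \<forall>\<sigma>\<in>Pow J. \<forall>x\<in>J' - J. height (?\<omega> r) \<sigma> x < ?\<omega> r x) at_top"
    using J' fJ 2 by (intro eventually_ball_finite ballI) auto
  obtain r where "\<forall>\<sigma>\<in>Pow J'. \<forall>x\<in>J' - \<sigma>. height (?\<omega> r) \<sigma> x \<noteq> ?\<omega> r x"
     "\<forall>\<sigma>\<in>Pow J. \<forall>x\<in>J' - J. height (?\<omega> r) \<sigma> x < ?\<omega> r x"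
    using eventually_happens'[OF trivial_limit_at_top_linorder eventually_conj[OF e1 e2]] by blast
  then show ?thesis by (intro that[of "?\<omega> r"]) auto
qed

section \<open>Joins and Minkowski sums\<close>

lemma dilate_iff: "x \<in> dilate c A \<longleftrightarrow> (\<exists>a\<in>A. x = c *\<^sub>R a)"
  by (auto simp: dilate_def)

lemma dilate_plus_same:
  assumes A: "convex A" "A \<noteq> {}" and ab: "0 \<le> a" "0 \<le> b"
  shows "dilate a A + dilate b A = dilate (a + b) A"
proof (intro equalityI subsetI)
  fix z assume "z \<in> dilate a A + dilate b A"
  then obtain x y where xy: "x \<in> A" "y \<in> A" "z = a *\<^sub>R x + b *\<^sub>R y"
    by (auto simp: set_plus_def dilate_def)
  show "z \<in> dilate (a + b) A"
  proof (cases "a + b = 0")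
    case True
    then have "a = 0" "b = 0" using ab by auto
    then show ?thesis using xy by (auto simp: dilate_def)
  next
    case False
    then have "(a / (a + b)) *\<^sub>R x + (b / (a + b)) *\<^sub>R y \<in> A"
      using ab xy by (intro convexD[OF A(1)]) (auto simp flip: add_divide_distrib)
    moreover have "z = (a + b) *\<^sub>R ((a / (a + b)) *\<^sub>R x + (b / (a + b)) *\<^sub>R y)"
      using False xy by (simp add: scaleR_add_right)
    ultimately show ?thesis unfolding dilate_def by blast
  qed
next
  fix z assume "z \<in> dilate (a + b) A"
  then show "z \<in> dilate a A + dilate b A"
    by (auto simp: set_plus_def dilate_def scaleR_add_left)
qed

text \<open>Over a fixed s the right-hand side is the Minkowski sum of
  \<open>dilate (1 - s) A\<close> and \<open>dilate s B\<close>; convex combinations of such fibres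
  stay within a fibre because dilates of a convex set add up. The formula gives compactness of joins
  and a parametrization of their points.\<close>

lemma join_eq:
  assumes A: "convex A" "A \<noteq> {}" and B: "convex B" "B \<noteq> {}"
  shows "A \<or>\<^sub>c B = (\<lambda>(s, x, y). (1 - s) *\<^sub>R x + s *\<^sub>R y) ` ({0..1} \<times> A \<times> B)" (is "_ = ?R")
proof
  have R: "?R = {z. \<exists>s\<in>{0..1}. z \<in> dilate (1 - s) A + dilate s B}"
    by (force simp: set_plus_def dilate_def)
  have "convex ?R"
    unfolding convex_def
  proof (intro ballI allI impI)
    fix z z' and u v :: real
    assume z: "z \<in> ?R" and z': "z' \<in> ?R" and uv: "0 \<le> u" "0 \<le> v" "u + v = 1"
    from z obtain s x y where s: "0 \<le> s" "s \<le> 1" "x \<in> A" "y \<in> B" "z = (1 - s) *\<^sub>R x + s *\<^sub>R y" by auto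
    from z' obtain s' x' y' where s': "0 \<le> s'" "s' \<le> 1" "x' \<in> A" "y' \<in> B" "z' = (1 - s') *\<^sub>R x' + s' *\<^sub>R y'" by auto
    let ?s = "u * s + v * s'"
    have "(u * (1 - s)) *\<^sub>R x + (v * (1 - s')) *\<^sub>R x' \<in> dilate (u * (1 - s)) A + dilate (v * (1 - s')) A"
      using s s' by (auto simp: dilate_def)
    also have "\<dots> = dilate (u * (1 - s) + v * (1 - s')) A"
      using s s' uv by (intro dilate_plus_same A) auto
    also have "u * (1 - s) + v * (1 - s') = 1 - ?s" using uv by (simp add: algebra_simps)
    finally have 1: "(u * (1 - s)) *\<^sub>R x + (v * (1 - s')) *\<^sub>R x' \<in> dilate (1 - ?s) A" .
    have "(u * s) *\<^sub>R y + (v * s') *\<^sub>R y' \<in> dilate (u * s) B + dilate (v * s') B"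
      using s s' by (auto simp: dilate_def)
    also have "\<dots> = dilate ?s B"
      using s s' uv by (intro dilate_plus_same B) auto
    finally have 2: "(u * s) *\<^sub>R y + (v * s') *\<^sub>R y' \<in> dilate ?s B" .
    have "u *\<^sub>R z + v *\<^sub>R z' = ((u * (1 - s)) *\<^sub>R x + (v * (1 - s')) *\<^sub>R x') + ((u * s) *\<^sub>R y + (v * s') *\<^sub>R y')"
      using s s' by (simp add: scaleR_add_right)
    also have "\<dots> \<in> dilate (1 - ?s) A + dilate ?s B" by (intro set_plus_intro 1 2)
    finally have "u *\<^sub>R z + v *\<^sub>R z' \<in> dilate (1 - ?s) A + dilate ?s B" .
    moreover have "?s \<in> {0..1}"
    proof -
      have "?s \<le> u * 1 + v * 1" using s s' uv by (intro add_mono mult_left_mono) auto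
      then show ?thesis using s s' uv by auto
    qed
    ultimately show "u *\<^sub>R z + v *\<^sub>R z' \<in> ?R" unfolding R by blast
  qed
  moreover have "A \<subseteq> ?R"
  proof
    fix x assume "x \<in> A"
    moreover obtain y where "y \<in> B" using B by auto
    ultimately show "x \<in> ?R" by (intro image_eqI[where x = "(0, x, y)"]) auto
  qed
  moreover have "B \<subseteq> ?R"
  proof
    fix y assume "y \<in> B"
    moreover obtain x where "x \<in> A" using A by auto
    ultimately show "y \<in> ?R" by (intro image_eqI[where x = "(1, x, y)"]) auto
  qed
  ultimately show "A \<or>\<^sub>c B \<subseteq> ?R" unfolding join_def by (intro hull_minimal) auto
next
  show "?R \<subseteq> A \<or>\<^sub>c B"
  proof clarify
    fix s :: real and x y assume s: "s \<in> {0..1}" and "x \<in> A" "y \<in> B"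
    then have "x \<in> convex hull (A \<union> B)" "y \<in> convex hull (A \<union> B)" by (auto intro: hull_inc)
    with s show "(1 - s) *\<^sub>R x + s *\<^sub>R y \<in> A \<or>\<^sub>c B"
      unfolding join_def by (intro convexD[OF convex_convex_hull]) auto
  qed
qed

section \<open>Topology of the function representation: compactness and finite volume of joins, sums
  and powers\<close>

lemma continuous_on_funI:
  fixes f :: "'b::topological_space \<Rightarrow> nat \<Rightarrow> 'a::euclidean_space"
  assumes "\<And>i. continuous_on S (\<lambda>x. f x i)"
  shows "continuous_on S f"
  using assms by (rule continuous_on_coordinatewise_then_product)

lemma continuous_on_component: "continuous_on S (\<lambda>x :: nat \<Rightarrow> 'a::euclidean_space. x i)"
  by (rule continuous_on_product_then_coordinatewise) (rule continuous_on_id)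

lemma continuous_on_component_compose:
  fixes f :: "'b::topological_space \<Rightarrow> nat \<Rightarrow> 'a::euclidean_space"
  assumes "continuous_on S f"
  shows "continuous_on S (\<lambda>x. f x i)"
  using assms by (rule continuous_on_product_then_coordinatewise)

lemma continuous_on_lin_fun:
  fixes f g :: "'b::topological_space \<Rightarrow> nat \<Rightarrow> 'a::euclidean_space"
  assumes "continuous_on S a" "continuous_on S b" "continuous_on S f" "continuous_on S g"
  shows "continuous_on S (\<lambda>x. a x *\<^sub>R f x + b x *\<^sub>R g x)"
proof (rule continuous_on_funI)
  fix i
  have "continuous_on S (\<lambda>x. a x *\<^sub>R f x i + b x *\<^sub>R g x i)"
    by (intro continuous_on_add continuous_on_scaleR continuous_on_component_compose assms)
  then show "continuous_on S (\<lambda>x. (a x *\<^sub>R f x + b x *\<^sub>R g x) i)"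
    by (simp add: fun_vector_apply)
qed

lemma compact_join_fun:
  fixes A B :: "(nat \<Rightarrow> 'a::euclidean_space) set"
  assumes "convex A" "convex B" "compact A" "compact B"
  shows "compact (A \<or>\<^sub>c B)"
proof (cases "A = {} \<or> B = {}")
  case True
  then show ?thesis using assms by (auto simp: join_def hull_same)
next
  case False
  then have "A \<or>\<^sub>c B = (\<lambda>(s, x, y). (1 - s) *\<^sub>R x + s *\<^sub>R y) ` ({0..1} \<times> A \<times> B)"
    using assms by (intro join_eq) auto
  moreover have "compact ((\<lambda>(s, x, y). (1 - s) *\<^sub>R x + s *\<^sub>R y) ` ({0..1::real} \<times> A \<times> B))"
    unfolding case_prod_beta using assms
    by (intro compact_continuous_image continuous_on_lin_fun compact_Times continuous_on_diff
        continuous_on_const continuous_on_fst continuous_on_snd continuous_on_id) auto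
  ultimately show ?thesis by simp
qed

lemma compact_sum_fun:
  fixes A B :: "(nat \<Rightarrow> 'a::euclidean_space) set"
  assumes "compact A" "compact B"
  shows "compact (dilate a A + dilate b B)"
proof -
  have "dilate a A + dilate b B = (\<lambda>(x, y). a *\<^sub>R x + b *\<^sub>R y) ` (A \<times> B)"
    by (force simp: set_plus_def dilate_def)
  moreover have "compact ((\<lambda>(x, y). a *\<^sub>R x + b *\<^sub>R y) ` (A \<times> B))"
    unfolding case_prod_beta using assms
    by (intro compact_continuous_image continuous_on_lin_fun compact_Times continuous_on_diff
        continuous_on_const continuous_on_fst continuous_on_snd continuous_on_id) auto
  ultimately show ?thesis by simp
qed

lemma compact_convex_hull_fun:
  fixes U :: "(nat \<Rightarrow> 'a::euclidean_space) set"
  assumes "finite U"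
  shows "compact (convex hull U)"
  using assms
proof (induction U rule: finite_induct)
  case (insert x U)
  have "convex hull (insert x U) = {x} \<or>\<^sub>c (convex hull U)"
    unfolding join_def using hull_Un_right[of convex "{x}" U] by simp
  then show ?case using insert by (simp add: compact_join_fun)
qed simp

lemma borel_compact_fun:
  "compact (A :: (nat \<Rightarrow> 'a::euclidean_space) set) \<Longrightarrow> A \<in> sets borel"
  by (intro borel_closed compact_imp_closed)

lemma compact_cart_power:
  fixes K :: "'a::euclidean_space set"
  assumes "compact K"
  shows "compact (cart_power p K)"
proof -
  have "cart_power p K = Pi\<^sub>E UNIV (\<lambda>i. if i < p then K else {0})"
    by (force simp: cart_power_def PiE_iff split: if_splits)
  moreover have "compactin (product_topology (\<lambda>_::nat. euclidean) UNIV) (Pi\<^sub>E UNIV (\<lambda>i. if i < p then K else {0::'a}))"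
    using assms by (auto simp: compactin_PiE)
  ultimately show ?thesis by (simp add: euclidean_product_topology)
qed

lemma bounded_coordinates_compact:
  fixes A :: "(nat \<Rightarrow> 'a::euclidean_space) set"
  assumes "compact A" "A \<subseteq> pow_space p"
  obtains R where "A \<subseteq> cart_power p (cball 0 R)"
proof -
  have "\<exists>r. \<forall>x\<in>A. norm (x i) \<le> r" for i
  proof -
    have "compact ((\<lambda>x. x i) ` A)"
      by (intro compact_continuous_image assms continuous_on_component)
    then have "bounded ((\<lambda>x. x i) ` A)" by (rule compact_imp_bounded)
    then show ?thesis by (auto simp: bounded_iff)
  qed
  then obtain r where r: "\<And>i x. x \<in> A \<Longrightarrow> norm (x i) \<le> r i" by metis
  have "x \<in> cart_power p (cball 0 (Max (r ` {..<p})))" if "x \<in> A" for x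
  proof -
    have "norm (x i) \<le> Max (r ` {..<p})" if "i < p" for i
      using r[OF \<open>x \<in> A\<close>, of i] that by (intro order_trans[OF _ Max_ge]) auto
    then show ?thesis using assms(2) that by (auto simp: cart_power_def pow_space_def)
  qed
  then show ?thesis using that by blast
qed

lemma emeasure_compact_pow_finite:
  fixes A :: "(nat \<Rightarrow> 'a::euclidean_space) set"
  assumes "compact A" "A \<subseteq> pow_space p"
  shows "emeasure (lborel_pow p) A < \<infinity>"
proof -
  obtain R where R: "A \<subseteq> cart_power p (cball 0 R)"
    using bounded_coordinates_compact[OF assms] .
  interpret product_sigma_finite "\<lambda>_::nat. lborel :: 'a measure" by standard
  have eq: "(\<lambda>x. restrict x {..<p}) ` cart_power p (cball 0 R) \<subseteq> Pi\<^sub>E {..<p} (\<lambda>_. cball (0::'a) R)"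
    by (auto simp: cart_power_def PiE_iff extensional_def split: if_split_asm)
  have c: "cart_power p (cball (0::'a) R) \<in> sets borel" by (intro cart_power_borel) auto
  have "emeasure (lborel_pow p) A \<le> emeasure (lborel_pow p) (cart_power p (cball (0::'a) R))"
    using c by (intro emeasure_mono R) auto
  also have "\<dots> = emeasure (Pi\<^sub>M {..<p} (\<lambda>_. lborel)) ((\<lambda>x. restrict x {..<p}) ` cart_power p (cball (0::'a) R))"
    by (rule emeasure_lborel_pow(1)[OF c cart_power_subset])
  also have "\<dots> \<le> emeasure (Pi\<^sub>M {..<p} (\<lambda>_. lborel :: 'a measure)) (Pi\<^sub>E {..<p} (\<lambda>_. cball 0 R))"
    by (intro emeasure_mono eq sets_PiM_I_finite) auto
  also have "\<dots> < \<infinity>"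
    using emeasure_lborel_cball_finite[of "0::'a" R]
    by (subst emeasure_PiM) (auto simp: power_less_top_ennreal)
  finally show ?thesis .
qed

lemma vol_mono:
  fixes A B :: "(nat \<Rightarrow> 'a::euclidean_space) set"
  assumes "compact A" "compact B" "A \<subseteq> B" "B \<subseteq> pow_space p"
  shows "vol p A \<le> vol p B"
proof -
  have "measure (lborel_pow p) A \<le> measure (lborel_pow p) B"
    using assms emeasure_compact_pow_finite[of B p]
    by (intro measure_mono_fmeasurable) (auto simp: fmeasurable_def borel_compact_fun)
  moreover have "vol p A = measure (lborel_pow p) A" "vol p B = measure (lborel_pow p) B"
    using assms by (auto intro!: vol_eq borel_compact_fun)
  ultimately show ?thesis by simp
qed

lemma fmeasurable_compact_pow:
  fixes A :: "(nat \<Rightarrow> 'a::euclidean_space) set"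
  assumes "compact A" "A \<subseteq> pow_space p"
  shows "A \<in> fmeasurable (lborel_pow p)"
  using assms emeasure_compact_pow_finite[of A p] by (auto simp: fmeasurable_def borel_compact_fun)

section \<open>The volume of a Minkowski sum of two polytopes\<close>

text \<open>The section of the cone over \<sigma> at the level (a, b) of the two extra coordinates.
  These record the total weight on the two kinds of vertices, so that all sums aA + bB become
  sections of one cone.\<close>

definition cone_slice :: "('v::real_vector \<times> real \<times> real) set \<Rightarrow> real \<Rightarrow> real \<Rightarrow> 'v set"
  where "cone_slice \<sigma> a b = {z. \<exists>c. (\<forall>x\<in>\<sigma>. 0 \<le> c x) \<and> (\<Sum>x\<in>\<sigma>. c x *\<^sub>R x) = (z, a, b)}"

definition lifted :: "nat \<Rightarrow> ((nat \<Rightarrow> 'a::euclidean_space) \<times> real \<times> real) set \<Rightarrow> bool"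
  where "lifted p \<sigma> \<longleftrightarrow> (\<forall>x\<in>\<sigma>. fst x \<in> pow_space p \<and> snd x \<in> {(1, 0), (0, 1)})"

lemma lifted_sum:
  assumes "finite \<sigma>" "lifted p \<sigma>"
  shows "(\<Sum>x\<in>\<sigma>. c x *\<^sub>R x) =
    ((\<Sum>x\<in>\<sigma>. c x *\<^sub>R fst x), (\<Sum>x\<in>{x\<in>\<sigma>. snd x = (1, 0)}. c x), (\<Sum>x\<in>{x\<in>\<sigma>. snd x = (0, 1)}. c x))"
proof (intro prod_eqI)
  have "(\<Sum>x\<in>\<sigma>. c x * fst (snd x)) = (\<Sum>x\<in>\<sigma>. if snd x = (1, 0) then c x else 0)"
    using assms by (intro sum.cong) (auto simp: lifted_def)
  then show "fst (snd (\<Sum>x\<in>\<sigma>. c x *\<^sub>R x)) = fst (snd ((\<Sum>x\<in>\<sigma>. c x *\<^sub>R fst x), (\<Sum>x\<in>{x\<in>\<sigma>. snd x = (1, 0)}. c x), (\<Sum>x\<in>{x\<in>\<sigma>. snd x = (0, 1)}. c x)))"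
    using assms by (simp add: fst_sum snd_sum sum.inter_filter)
  have "(\<Sum>x\<in>\<sigma>. c x * snd (snd x)) = (\<Sum>x\<in>\<sigma>. if snd x = (0, 1) then c x else 0)"
    using assms by (intro sum.cong) (auto simp: lifted_def)
  then show "snd (snd (\<Sum>x\<in>\<sigma>. c x *\<^sub>R x)) = snd (snd ((\<Sum>x\<in>\<sigma>. c x *\<^sub>R fst x), (\<Sum>x\<in>{x\<in>\<sigma>. snd x = (1, 0)}. c x), (\<Sum>x\<in>{x\<in>\<sigma>. snd x = (0, 1)}. c x)))"
    using assms by (simp add: snd_sum sum.inter_filter)
qed (simp add: fst_sum)

text \<open>Fix one vertex of each kind and eliminate its coefficient by the two weight equations.
  The remaining coefficients range over a product of standard simplices of sizes a and b and
  dimensions k and l, and the map to the slice is affine with a linear part that does not depend on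
  a and b. Scaling the two groups of coordinates gives \<open>a ^ k * b ^ l\<close>.\<close>

lemma cone_slice_basis:
  fixes \<sigma> :: "((nat \<Rightarrow> 'a::euclidean_space) \<times> real \<times> real) set"
  assumes fin: "finite \<sigma>" and lifted: "lifted p \<sigma>" and ind: "independent \<sigma>"
    and sp: "pow_space p \<times> UNIV \<subseteq> span \<sigma>"
  defines "k \<equiv> card {x\<in>\<sigma>. snd x = (1, 0)} - 1" and "l \<equiv> card {x\<in>\<sigma>. snd x = (0, 1)} - 1"
  shows "k + l = DIM('a) * p"
    and "0 < a \<Longrightarrow> 0 < b \<Longrightarrow> cone_slice \<sigma> a b \<in> sets borel"
    and "0 < a \<Longrightarrow> 0 < b \<Longrightarrow> emeasure (lborel_pow p) (cone_slice \<sigma> a b)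
      = ennreal (a ^ k * b ^ l) * emeasure (lborel_pow p) (cone_slice \<sigma> 1 1)"
proof -
  define \<sigma>0 where "\<sigma>0 = {x\<in>\<sigma>. snd x = (1, 0)}"
  define \<sigma>1 where "\<sigma>1 = {x\<in>\<sigma>. snd x = (0, 1)}"
  have \<sigma>: "\<sigma> = \<sigma>0 \<union> \<sigma>1" "\<sigma>0 \<inter> \<sigma>1 = {}" and fin01: "finite \<sigma>0" "finite \<sigma>1"
    using lifted fin by (auto simp: lifted_def \<sigma>0_def \<sigma>1_def)
  have ex: "\<exists>c. (\<Sum>x\<in>\<sigma>. c x *\<^sub>R x) = z" if "fst z \<in> pow_space p" for z
  proof -
    have "z \<in> span \<sigma>" using sp that by (cases z) auto
    then show ?thesis unfolding span_finite[OF fin] by auto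
  qed
  note ls = lifted_sum[OF fin lifted, folded \<sigma>0_def \<sigma>1_def]
  \<comment> \<open>Spanning (0, 1, 1) requires vertices of both kinds; hence the truncated
    \<open>- 1\<close> in k and l is a genuine subtraction.\<close>
  have ne: "\<sigma>0 \<noteq> {}" "\<sigma>1 \<noteq> {}"
    using ex[of "(0, 1, 1)"] by (auto simp: ls subspace_0[OF subspace_pow_space])
  then obtain x0 x1 where x0: "x0 \<in> \<sigma>0" and x1: "x1 \<in> \<sigma>1" by auto
  define I0 where "I0 = \<sigma>0 - {x0}"
  define I1 where "I1 = \<sigma>1 - {x1}"
  define I where "I = I0 \<union> I1"
  have I: "finite I" "finite I0" "finite I1" "I0 \<inter> I1 = {}" "x0 \<notin> I" "x1 \<notin> I" "x0 \<noteq> x1" "x0 \<notin> I0" "x1 \<notin> I1" "x0 \<notin> I1" "x1 \<notin> I0"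
    using fin01 \<sigma> x0 x1 by (auto simp: I_def I0_def I1_def)
  have ins: "\<sigma>0 = insert x0 I0" "\<sigma>1 = insert x1 I1" using x0 x1 by (auto simp: I0_def I1_def)
  define b' where "b' x = fst x - fst (if x \<in> \<sigma>0 then x0 else x1)" for x
  define \<Phi> where "\<Phi> y = (\<Sum>x\<in>I. y x *\<^sub>R b' x)" for y
  have \<Phi>_cong: "\<Phi> y = \<Phi> y'" if "\<And>x. x \<in> I \<Longrightarrow> y x = y' x" for y y'
    using that by (simp add: \<Phi>_def cong: sum.cong)
  have K: "(\<Sum>x\<in>\<sigma>. c x *\<^sub>R fst x) = (\<Sum>x\<in>\<sigma>0. c x) *\<^sub>R fst x0 + (\<Sum>x\<in>\<sigma>1. c x) *\<^sub>R fst x1 + \<Phi> c" for c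
  proof -
    have "\<Phi> c = (\<Sum>x\<in>I0. c x *\<^sub>R b' x) + (\<Sum>x\<in>I1. c x *\<^sub>R b' x)"
      unfolding \<Phi>_def I_def using I by (intro sum.union_disjoint) auto
    also have "(\<Sum>x\<in>I0. c x *\<^sub>R b' x) = (\<Sum>x\<in>\<sigma>0. c x *\<^sub>R (fst x - fst x0))"
      using I unfolding ins by (simp add: b'_def ins)
    also have "(\<Sum>x\<in>I1. c x *\<^sub>R b' x) = (\<Sum>x\<in>\<sigma>1. c x *\<^sub>R (fst x - fst x1))"
    proof -
      have "(\<Sum>x\<in>I1. c x *\<^sub>R b' x) = (\<Sum>x\<in>I1. c x *\<^sub>R (fst x - fst x1))"
        using \<sigma>(2) by (intro sum.cong) (auto simp: b'_def ins)
      then show ?thesis using I unfolding ins by simp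
    qed
    finally have "\<Phi> c = (\<Sum>x\<in>\<sigma>0. c x *\<^sub>R (fst x - fst x0)) + (\<Sum>x\<in>\<sigma>1. c x *\<^sub>R (fst x - fst x1))" .
    moreover have "(\<Sum>x\<in>\<sigma>. c x *\<^sub>R fst x) = (\<Sum>x\<in>\<sigma>0. c x *\<^sub>R fst x) + (\<Sum>x\<in>\<sigma>1. c x *\<^sub>R fst x)"
      unfolding \<sigma>(1) using fin01 \<sigma>(2) by (rule sum.union_disjoint)
    ultimately show ?thesis
      by (simp add: scaleR_diff_right sum_subtractf scaleR_sum_left)
  qed
  have ext: "\<exists>c. (\<forall>x\<in>I. c x = y x) \<and> c x0 = a - (\<Sum>x\<in>I0. y x) \<and> c x1 = b - (\<Sum>x\<in>I1. y x)
      \<and> (\<Sum>x\<in>\<sigma>. c x *\<^sub>R x) = (a *\<^sub>R fst x0 + b *\<^sub>R fst x1 + \<Phi> y, a, b)" for y a b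
  proof -
    define c where "c x = (if x = x0 then a - (\<Sum>x\<in>I0. y x) else if x = x1 then b - (\<Sum>x\<in>I1. y x) else y x)" for x
    have c: "c x = y x" if "x \<in> I" for x using that I by (auto simp: c_def)
    have "(\<Sum>x\<in>I0. c x) = (\<Sum>x\<in>I0. y x)" "(\<Sum>x\<in>I1. c x) = (\<Sum>x\<in>I1. y x)"
      using c by (auto simp: I_def intro!: sum.cong)
    then have "(\<Sum>x\<in>\<sigma>0. c x) = a" "(\<Sum>x\<in>\<sigma>1. c x) = b"
      using I unfolding ins by (auto simp: c_def)
    then have "(\<Sum>x\<in>\<sigma>. c x *\<^sub>R x) = (a *\<^sub>R fst x0 + b *\<^sub>R fst x1 + \<Phi> y, a, b)"
      unfolding ls K using \<Phi>_cong[of c y] c by simp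
    then show ?thesis using c I by (intro exI[of _ c]) (auto simp: c_def)
  qed
  have V01: "fst x \<in> pow_space p" if "x \<in> \<sigma>" for x using lifted that by (auto simp: lifted_def)
  have b'V: "b' x \<in> pow_space p" if "x \<in> I" for x
    unfolding b'_def using that x0 x1 \<sigma>(1) by (intro subspace_diff[OF subspace_pow_space] V01) (auto simp: I_def I0_def I1_def)
  have spanning: "\<exists>y. \<Phi> y = v" if v: "v \<in> pow_space p" for v
  proof -
    obtain c where "(\<Sum>x\<in>\<sigma>. c x *\<^sub>R x) = (v, 0, 0)" using ex[of "(v, 0, 0)"] v by auto
    then show ?thesis unfolding ls K by auto
  qed
  have indep: "y x = 0" if "\<Phi> y = 0" "x \<in> I" for y x
  proof -
    obtain c where c: "\<forall>x\<in>I. c x = y x" "(\<Sum>x\<in>\<sigma>. c x *\<^sub>R x) = (0 *\<^sub>R fst x0 + 0 *\<^sub>R fst x1 + \<Phi> y, 0, 0)"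
      using ext[of y 0 0] by blast
    have "(\<Sum>x\<in>\<sigma>. c x *\<^sub>R x) = 0" unfolding c(2) that(1) by (simp add: zero_prod_def)
    moreover have "x \<in> \<sigma>" using that(2) \<sigma>(1) by (auto simp: I_def I0_def I1_def)
    ultimately have "c x = 0" by (rule independentD[OF ind fin subset_refl])
    then show ?thesis using c that by simp
  qed
  obtain C where C: "\<And>X. X \<in> sets (Pi\<^sub>M I (\<lambda>_. lborel)) \<Longrightarrow> \<Phi> ` X \<in> sets borel"
    "\<And>X. X \<in> sets (Pi\<^sub>M I (\<lambda>_. lborel)) \<Longrightarrow> emeasure (lborel_pow p) (\<Phi> ` X) = C * emeasure (Pi\<^sub>M I (\<lambda>_. lborel)) X"
  proof (rule lborel_pow_coordinates[of I b' p, folded \<Phi>_def])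
  qed (use I b'V spanning indep in blast)+
  have inj: "inj_on b' I"
  proof (rule inj_onI, rule ccontr)
    fix x x' assume x: "x \<in> I" "x' \<in> I" "b' x = b' x'" "x \<noteq> x'"
    define y where "y i = (if i = x then 1 else if i = x' then -1 else 0 :: real)" for i
    have "\<Phi> y = (\<Sum>i\<in>{x, x'}. y i *\<^sub>R b' i)"
      unfolding \<Phi>_def using x I by (intro sum.mono_neutral_right) (auto simp: y_def)
    also have "\<dots> = 0" using x by (simp add: y_def)
    finally have "y x = 0" using indep x by blast
    then show False by (simp add: y_def)
  qed
  have "card (b' ` I) = DIM('a) * p"
  proof (rule card_basis_pow_space)
    show "independent (b' ` I)"
    proof (rule independent_if_scalars_zero)
      fix f v assume f: "(\<Sum>v\<in>b' ` I. f v *\<^sub>R v) = 0" and "v \<in> b' ` I"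
      then obtain i where i: "i \<in> I" "v = b' i" by auto
      have "\<Phi> (\<lambda>i. f (b' i)) = 0" using f inj by (simp add: \<Phi>_def sum.reindex)
      from indep[OF this i(1)] show "f v = 0" using i by simp
    qed (use I in auto)
    show "b' ` I \<subseteq> pow_space p" using b'V by auto
    show "pow_space p \<subseteq> span (b' ` I)"
    proof
      fix v :: "nat \<Rightarrow> 'a" assume "v \<in> pow_space p"
      then obtain y where y: "\<Phi> y = v" using spanning by auto
      show "v \<in> span (b' ` I)" unfolding y[symmetric] \<Phi>_def by (intro span_sum span_scale span_base imageI)
    qed
  qed
  then have "card I = DIM('a) * p" using inj by (simp add: card_image)
  moreover have "card I = card I0 + card I1" unfolding I_def using I by (intro card_Un_disjoint) auto
  moreover have kl: "k = card I0" "l = card I1"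
    unfolding k_def l_def using I unfolding \<sigma>0_def[symmetric] \<sigma>1_def[symmetric] ins by auto
  ultimately show "k + l = DIM('a) * p" by simp
  \<comment> \<open>The product of two standard simplices of sizes a and b; the missing weight in
    each group is the coefficient of x0 or x1.\<close>
  define X where "X a b = {y \<in> space (Pi\<^sub>M I (\<lambda>_. lborel)). (\<forall>x\<in>I. 0 \<le> y x) \<and> (\<Sum>x\<in>I0. y x) \<le> a \<and> (\<Sum>x\<in>I1. y x) \<le> b}" for a b :: real
  have comp: "(\<lambda>y. y x) \<in> borel_measurable (Pi\<^sub>M I (\<lambda>_. lborel :: real measure))" if "x \<in> I" for x
  proof -
    have "(\<lambda>y. y x) \<in> measurable (Pi\<^sub>M I (\<lambda>_. lborel :: real measure)) lborel"
      using that by (rule measurable_component_singleton)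
    then show ?thesis by simp
  qed
  have X: "X a b \<in> sets (Pi\<^sub>M I (\<lambda>_. lborel))" for a b
    unfolding X_def
    by (intro sets.sets_Collect_conj sets.sets_Collect_finite_All borel_measurable_le borel_measurable_const
          borel_measurable_sum comp I(1)) (auto simp: I_def)
  have slice: "cone_slice \<sigma> a b = (\<lambda>x. x + (a *\<^sub>R fst x0 + b *\<^sub>R fst x1)) ` \<Phi> ` X a b" for a b
  proof (intro equalityI subsetI)
    fix z assume "z \<in> cone_slice \<sigma> a b"
    then obtain c where c: "\<forall>x\<in>\<sigma>. 0 \<le> c x" "(\<Sum>x\<in>\<sigma>. c x *\<^sub>R x) = (z, a, b)" by (auto simp: cone_slice_def)
    then have s: "(\<Sum>x\<in>\<sigma>0. c x) = a" "(\<Sum>x\<in>\<sigma>1. c x) = b" "z = a *\<^sub>R fst x0 + b *\<^sub>R fst x1 + \<Phi> c"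
      unfolding ls K by auto
    have le: "(\<Sum>x\<in>I0. c x) \<le> a" "(\<Sum>x\<in>I1. c x) \<le> b"
      using s(1,2) c(1) x0 x1 \<sigma>(1) I unfolding ins by auto
    have "(\<Sum>x\<in>I0. restrict c I x) = (\<Sum>x\<in>I0. c x)" "(\<Sum>x\<in>I1. restrict c I x) = (\<Sum>x\<in>I1. c x)"
      by (auto simp: I_def intro!: sum.cong)
    then have cX: "restrict c I \<in> X a b" using c(1) le \<sigma>(1) by (auto simp: X_def space_PiM I_def I0_def I1_def)
    have "\<Phi> (restrict c I) = \<Phi> c" by (rule \<Phi>_cong) simp
    then have "z = \<Phi> (restrict c I) + (a *\<^sub>R fst x0 + b *\<^sub>R fst x1)"
      using s(3) by (simp only: add.commute)
    then show "z \<in> (\<lambda>x. x + (a *\<^sub>R fst x0 + b *\<^sub>R fst x1)) ` \<Phi> ` X a b" by (rule image_eqI[where x = "\<Phi> (restrict c I)"]) (rule imageI[OF cX])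
  next
    fix z assume "z \<in> (\<lambda>x. x + (a *\<^sub>R fst x0 + b *\<^sub>R fst x1)) ` \<Phi> ` X a b"
    then obtain y where y: "y \<in> X a b" "z = a *\<^sub>R fst x0 + b *\<^sub>R fst x1 + \<Phi> y" by (auto simp: add.commute)
    obtain c where c: "\<forall>x\<in>I. c x = y x" "c x0 = a - (\<Sum>x\<in>I0. y x)" "c x1 = b - (\<Sum>x\<in>I1. y x)"
       "(\<Sum>x\<in>\<sigma>. c x *\<^sub>R x) = (a *\<^sub>R fst x0 + b *\<^sub>R fst x1 + \<Phi> y, a, b)"
      using ext[of y a b] by auto
    have "\<forall>x\<in>\<sigma>. 0 \<le> c x" using c y(1) unfolding \<sigma>(1) ins by (auto simp: X_def I_def)
    then show "z \<in> cone_slice \<sigma> a b" using c(4) y(2) by (auto simp: cone_slice_def)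
  qed
  have shift: "a *\<^sub>R fst x0 + b *\<^sub>R fst x1 \<in> pow_space p" for a b
    using x0 x1 \<sigma>(1) by (intro subspace_add subspace_scale subspace_pow_space V01) auto
  show borel: "cone_slice \<sigma> a b \<in> sets borel" if "0 < a" "0 < b" for a b
    unfolding slice by (rule plus_const_borel[OF C(1)[OF X]])
  have em: "emeasure (lborel_pow p) (cone_slice \<sigma> a b) = C * emeasure (Pi\<^sub>M I (\<lambda>_. lborel)) (X a b)" for a b
    unfolding slice by (simp only: emeasure_lborel_pow_translate[OF C(1)[OF X] shift] C(2)[OF X])
  show "emeasure (lborel_pow p) (cone_slice \<sigma> a b) = ennreal (a ^ k * b ^ l) * emeasure (lborel_pow p) (cone_slice \<sigma> 1 1)"
    if ab: "0 < a" "0 < b" for a b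
  proof -
    define r where "r x = (if x \<in> I0 then a else b)" for x
    have "X a b = (\<lambda>y. \<lambda>x\<in>I. r x *\<^sub>R y x) ` X 1 1"
    proof (intro equalityI subsetI)
      fix y assume y: "y \<in> X a b"
      let ?y = "\<lambda>x\<in>I. y x / r x"
      have r0: "(\<Sum>x\<in>I0. ?y x) = (\<Sum>x\<in>I0. y x) / a" "(\<Sum>x\<in>I1. ?y x) = (\<Sum>x\<in>I1. y x) / b"
        unfolding sum_divide_distrib using I(4) by (auto simp: I_def r_def intro!: sum.cong)
      have "?y \<in> X 1 1" using y ab unfolding X_def mem_Collect_eq r0
        by (auto simp: space_PiM r_def)
      moreover have "y = (\<lambda>x\<in>I. r x *\<^sub>R ?y x)"
        using y ab by (auto simp: X_def space_PiM r_def fun_eq_iff PiE_def extensional_def)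
      ultimately show "y \<in> (\<lambda>y. \<lambda>x\<in>I. r x *\<^sub>R y x) ` X 1 1" by blast
    next
      fix y assume "y \<in> (\<lambda>y. \<lambda>x\<in>I. r x *\<^sub>R y x) ` X 1 1"
      then obtain y' where y': "y' \<in> X 1 1" "y = (\<lambda>x\<in>I. r x *\<^sub>R y' x)" by auto
      have r0: "(\<Sum>x\<in>I0. y x) = a * (\<Sum>x\<in>I0. y' x)" "(\<Sum>x\<in>I1. y x) = b * (\<Sum>x\<in>I1. y' x)"
        unfolding sum_distrib_left y' using I(4) by (auto simp: I_def r_def intro!: sum.cong)
      show "y \<in> X a b" using y' ab unfolding X_def mem_Collect_eq r0
        by (auto simp: space_PiM r_def)
    qed
    then have "emeasure (Pi\<^sub>M I (\<lambda>_. lborel)) (X a b) = (\<Prod>x\<in>I. ennreal (\<bar>r x\<bar> ^ DIM(real))) * emeasure (Pi\<^sub>M I (\<lambda>_. lborel)) (X 1 1)"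
      using PiM_lborel_scale(1)[OF I(1) _ X, of r 1 1] ab by (auto simp: r_def)
    also have "(\<Prod>x\<in>I. ennreal (\<bar>r x\<bar> ^ DIM(real))) = ennreal (\<Prod>x\<in>I. r x)"
      using ab by (subst prod_ennreal[symmetric]) (auto simp: r_def intro!: prod.cong)
    also have "(\<Prod>x\<in>I. r x) = (\<Prod>x\<in>I0. r x) * (\<Prod>x\<in>I1. r x)"
      unfolding I_def using I by (intro prod.union_disjoint) auto
    also have "(\<Prod>x\<in>I0. r x) = a ^ k" by (simp add: r_def kl)
    also have "(\<Prod>x\<in>I1. r x) = (\<Prod>x\<in>I1. b)" using I(4) by (intro prod.cong) (auto simp: r_def)
    also have "\<dots> = b ^ l" by (simp add: kl)
    finally show ?thesis unfolding em by (simp add: mult_ac)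
  qed
qed

text \<open>If the level (a, b) meets the span at all, both kinds of vertices occur, since a and b
  are positive. The section is then a translate of the subspace
  \<open>{v. (v, 0, 0) \<in> span s}\<close>, which is proper because otherwise s would span
  everything.\<close>

lemma cone_slice_null:
  fixes s :: "((nat \<Rightarrow> 'a::euclidean_space) \<times> real \<times> real) set"
  assumes s: "finite s" "lifted p s" and nsp: "\<not> pow_space p \<times> UNIV \<subseteq> span s" and ab: "0 < a" "0 < b"
  obtains Z where "{z. (z, a, b) \<in> span s} \<subseteq> Z" "Z \<in> sets borel" "emeasure (lborel_pow p) Z = 0"
proof (cases "\<exists>z. (z, a, b) \<in> span s")
  case False
  then show ?thesis by (intro that[of "{}"]) auto
next
  case True
  then obtain z where z: "(z, a, b) \<in> span s" by blast
  then obtain c where "(\<Sum>x\<in>s. c x *\<^sub>R x) = (z, a, b)" unfolding span_finite[OF s(1)] by auto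
  then have c: "(\<Sum>x\<in>{x\<in>s. snd x = (1, 0)}. c x) = a" "(\<Sum>x\<in>{x\<in>s. snd x = (0, 1)}. c x) = b"
    unfolding lifted_sum[OF s] by auto
  have "{x\<in>s. snd x = (1, 0)} \<noteq> {}" "{x\<in>s. snd x = (0, 1)} \<noteq> {}"
    using c ab by (metis sum.empty less_irrefl)+
  then obtain x0 x1 where x: "x0 \<in> s" "snd x0 = (1, 0)" "x1 \<in> s" "snd x1 = (0, 1)" by blast
  define L where "L = {v. (v, 0, 0) \<in> span s}"
  have "fst ` span s \<subseteq> pow_space p"
  proof -
    have "span s \<subseteq> pow_space p \<times> UNIV"
      using s(2) subspace_pow_space[of p]
      by (intro span_minimal) (auto simp: lifted_def subspace_def zero_prod_def)
    then show ?thesis by auto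
  qed
  then have L1: "L \<subseteq> pow_space p" by (force simp: L_def)
  have L2: "subspace L"
    unfolding L_def subspace_def
    using span_zero[of s] span_add[of _ s] span_scale[of _ s] by (fastforce simp: zero_prod_def)
  have shift: "(v - a' *\<^sub>R fst x0 - b' *\<^sub>R fst x1, 0, 0) \<in> span s \<longleftrightarrow> (v, a', b') \<in> span s" for v a' b'
  proof -
    have e: "(v, a', b') = (v - a' *\<^sub>R fst x0 - b' *\<^sub>R fst x1, 0, 0) + (a' *\<^sub>R x0 + b' *\<^sub>R x1)"
      using x by (simp add: prod_eq_iff)
    have "a' *\<^sub>R x0 + b' *\<^sub>R x1 \<in> span s" using x by (intro span_add span_scale span_base)
    then show ?thesis unfolding e by (rule span_add_eq2[symmetric])
  qed
  have "L \<noteq> pow_space p"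
  proof
    assume L: "L = pow_space p"
    have "(v, a', b') \<in> span s" if "v \<in> pow_space p" for v a' b'
    proof -
      have "v - a' *\<^sub>R fst x0 - b' *\<^sub>R fst x1 \<in> pow_space p"
        using s(2) x that by (intro subspace_diff subspace_scale subspace_pow_space) (auto simp: lifted_def)
      then show ?thesis unfolding L[symmetric] L_def mem_Collect_eq shift .
    qed
    then show False using nsp by auto
  qed
  then obtain Z where Z: "L \<subseteq> Z" "Z \<in> sets borel" "emeasure (lborel_pow p) Z = 0"
    using proper_subspace_null[OF L2 L1] by blast
  let ?v = "a *\<^sub>R fst x0 + b *\<^sub>R fst x1"
  show ?thesis
  proof (rule that)
    show "(\<lambda>x. x + ?v) ` Z \<in> sets borel" using Z(2) by (rule plus_const_borel)
    have v: "?v \<in> pow_space p"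
      using s(2) x by (intro subspace_add subspace_scale subspace_pow_space) (auto simp: lifted_def)
    show "emeasure (lborel_pow p) ((\<lambda>x. x + ?v) ` Z) = 0"
      unfolding emeasure_lborel_pow_translate[OF Z(2) v] by (rule Z(3))
    show "{z. (z, a, b) \<in> span s} \<subseteq> (\<lambda>x. x + ?v) ` Z"
    proof
      fix z assume "z \<in> {z. (z, a, b) \<in> span s}"
      then have "z - a *\<^sub>R fst x0 - b *\<^sub>R fst x1 \<in> L" using shift[of z a b] by (simp add: L_def)
      then have "z - ?v \<in> Z" using Z(1) by (auto simp: diff_diff_eq)
      then show "z \<in> (\<lambda>x. x + ?v) ` Z" by (intro image_eqI[where x = "z - ?v"]) auto
    qed
  qed
qed

lemma cone_slice_mono:
  assumes "finite J" "\<sigma> \<subseteq> J"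
  shows "cone_slice \<sigma> a b \<subseteq> cone_slice J a b"
proof
  fix z assume "z \<in> cone_slice \<sigma> a b"
  then obtain c where c: "\<forall>x\<in>\<sigma>. 0 \<le> c x" "(\<Sum>x\<in>\<sigma>. c x *\<^sub>R x) = (z, a, b)" by (auto simp: cone_slice_def)
  let ?c = "\<lambda>x. if x \<in> \<sigma> then c x else 0"
  have "(\<Sum>x\<in>J. ?c x *\<^sub>R x) = (\<Sum>x\<in>\<sigma>. ?c x *\<^sub>R x)"
    using assms by (intro sum.mono_neutral_right) auto
  also have "\<dots> = (z, a, b)" unfolding c(2)[symmetric] by (intro sum.cong) auto
  finally show "z \<in> cone_slice J a b" using c(1) by (auto simp: cone_slice_def intro!: exI[of _ ?c])
qed

text \<open>Remove the null set N of points at this level that lie in the span of some nonspanning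
  subset. Each remaining point is in exactly one cell: an optimal basis exists, genericity of
  \<omega> makes its inequalities strict, and two cells with positive coefficients at the same point
  coincide.\<close>

lemma measure_cone_slice:
  fixes J :: "((nat \<Rightarrow> 'a::euclidean_space) \<times> real \<times> real) set"
  assumes J: "finite J" "lifted p J" and ab: "0 < a" "0 < b"
    and comp: "compact (cone_slice J a b)" and sub: "cone_slice J a b \<subseteq> pow_space p"
    and gen: "\<And>\<sigma> x. \<sigma> \<subseteq> J \<Longrightarrow> x \<in> J - \<sigma> \<Longrightarrow> height \<omega> \<sigma> x \<noteq> \<omega> x"
  shows "measure (lborel_pow p) (cone_slice J a b)
    = (\<Sum>\<sigma>\<in>regular_triangulation \<omega> (pow_space p \<times> UNIV) J. measure (lborel_pow p) (cone_slice \<sigma> a b))"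
proof -
  let ?W = "pow_space p \<times> UNIV :: ((nat \<Rightarrow> 'a) \<times> real \<times> real) set"
  define T where "T = regular_triangulation \<omega> ?W J"
  have JW: "J \<subseteq> ?W" using J(2) by (auto simp: lifted_def)
  have finT: "finite T" using J(1) by (auto simp: T_def regular_triangulation_def intro: finite_subset[of _ "Pow J"])
  have fin: "finite \<sigma>" "\<sigma> \<subseteq> J" "lifted p \<sigma>" "independent \<sigma>" "?W \<subseteq> span \<sigma>" if "\<sigma> \<in> T" for \<sigma>
    using that J by (auto simp: T_def regular_triangulation_def lifted_def intro: finite_subset)
  define D where "D = {s. s \<subseteq> J \<and> \<not> ?W \<subseteq> span s}"
  have finD: "finite D" using J(1) by (auto simp: D_def intro: finite_subset[of _ "Pow J"])
  have "\<exists>Z. {z. (z, a, b) \<in> span s} \<subseteq> Z \<and> Z \<in> sets borel \<and> emeasure (lborel_pow p) Z = 0" if s: "s \<in> D" for s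
  proof -
    have "finite s" "lifted p s" "\<not> ?W \<subseteq> span s"
      using s J by (auto simp: D_def lifted_def intro: finite_subset)
    from cone_slice_null[OF this ab] show ?thesis by blast
  qed
  then obtain Z where Z: "\<And>s. s \<in> D \<Longrightarrow> {z. (z, a, b) \<in> span s} \<subseteq> Z s"
     "\<And>s. s \<in> D \<Longrightarrow> Z s \<in> sets borel" "\<And>s. s \<in> D \<Longrightarrow> emeasure (lborel_pow p) (Z s) = 0" by metis
  define N where "N = (\<Union>s\<in>D. Z s)"
  have N: "N \<in> null_sets (lborel_pow p)"
    unfolding N_def using finD Z(2,3) by (intro null_sets.finite_UN) (auto simp: null_sets_def)
  \<comment> \<open>A vanishing coefficient would put the point into the span of a facet of the
    cell, that is into N.\<close>
  have repr: "representation \<sigma> (z, a, b) x > 0" if \<sigma>: "\<sigma> \<in> T" and z: "z \<in> cone_slice \<sigma> a b" "z \<notin> N" and x: "x \<in> \<sigma>" for \<sigma> z x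
  proof -
    obtain c where c: "\<forall>x\<in>\<sigma>. 0 \<le> c x" "(\<Sum>x\<in>\<sigma>. c x *\<^sub>R x) = (z, a, b)"
      using z by (auto simp: cone_slice_def)
    have r: "representation \<sigma> (z, a, b) x = c x"
      unfolding c(2)[symmetric] using fin[OF \<sigma>] x by (intro representation_eq_coeff) auto
    have "c x \<noteq> 0"
    proof
      assume c0: "c x = 0"
      have "x \<notin> span (\<sigma> - {x})" using fin(4)[OF \<sigma>] x by (auto simp: dependent_def)
      then have "\<not> ?W \<subseteq> span (\<sigma> - {x})" using JW fin(2)[OF \<sigma>] x by auto
      then have D: "\<sigma> - {x} \<in> D" using fin(2)[OF \<sigma>] by (auto simp: D_def)
      have e: "(z, a, b) = (\<Sum>y\<in>\<sigma> - {x}. c y *\<^sub>R y)"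
        unfolding c(2)[symmetric] using c0 fin(1)[OF \<sigma>] x by (subst sum.remove[of _ x]) auto
      have "(z, a, b) \<in> span (\<sigma> - {x})" unfolding e by (intro span_sum span_scale span_base)
      then have "z \<in> N" using Z(1)[OF D] D by (auto simp: N_def)
      then show False using z by simp
    qed
    then show ?thesis using r c(1) x by force
  qed
  have slice_meas: "cone_slice \<sigma> a b \<in> fmeasurable (lborel_pow p)" if "\<sigma> \<in> T" for \<sigma>
  proof (rule fmeasurableI2)
    show "cone_slice J a b \<in> fmeasurable (lborel_pow p)" using comp sub by (rule fmeasurable_compact_pow)
    show "cone_slice \<sigma> a b \<subseteq> cone_slice J a b" using J(1) fin(2)[OF that] by (rule cone_slice_mono)
    show "cone_slice \<sigma> a b \<in> sets (lborel_pow p)" using cone_slice_basis(2)[OF fin(1,3,4,5)[OF that] ab] by simp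
  qed
  \<comment> \<open>The sum of the two weights equals 1 at every lifted point; this supplies the
    common hyperplane that the Caratheodory reduction requires.\<close>
  define hf :: "(nat \<Rightarrow> 'a) \<times> real \<times> real \<Rightarrow> real" where "hf = (\<lambda>x. fst (snd x) + snd (snd x))"
  have hf: "linear hf" "\<And>x. x \<in> J \<Longrightarrow> hf x = 1"
    using J(2) by (auto simp: hf_def lifted_def algebra_simps intro!: linearI)
  have cover: "\<exists>\<sigma>\<in>T. z \<in> cone_slice \<sigma> a b" if z: "z \<in> cone_slice J a b" "z \<notin> N" for z
  proof -
    obtain c where c: "\<forall>x\<in>J. 0 \<le> c x" "(\<Sum>x\<in>J. c x *\<^sub>R x) = (z, a, b)"
      using z by (auto simp: cone_slice_def)
    obtain \<sigma> where \<sigma>: "\<sigma> \<subseteq> J" "independent \<sigma>" "?W \<subseteq> span \<sigma>"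
      "\<And>k. k \<in> \<sigma> \<Longrightarrow> 0 < representation \<sigma> (z, a, b) k" "\<And>x. x \<in> J - \<sigma> \<Longrightarrow> height \<omega> \<sigma> x \<le> \<omega> x"
    proof (rule exists_optimal_basis[where \<omega> = \<omega>, OF J(1) hf _ c(2)[symmetric] _ JW])
      fix s assume s: "s \<subseteq> J" "(z, a, b) \<in> span s"
      show "?W \<subseteq> span s"
      proof (rule ccontr)
        assume "\<not> ?thesis"
        then have "s \<in> D" using s(1) by (simp add: D_def)
        then have "z \<in> N" unfolding N_def using Z(1) s(2) by blast
        then show False using z(2) by simp
      qed
    qed (use c in auto)
    have "\<sigma> \<in> T" unfolding T_def regular_triangulation_def using \<sigma> gen[OF \<sigma>(1)] by (auto simp: less_le)
    moreover have "(\<Sum>k\<in>\<sigma>. representation \<sigma> (z, a, b) k *\<^sub>R k) = (z, a, b)"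
      using \<sigma> sub z(1) J(1) by (intro representation_expansion) (auto intro: finite_subset)
    then have "z \<in> cone_slice \<sigma> a b"
      using \<sigma>(4) by (auto simp: cone_slice_def intro!: exI[of _ "representation \<sigma> (z, a, b)"] less_imp_le)
    ultimately show ?thesis by blast
  qed
  have "measure (lborel_pow p) (cone_slice J a b) = measure (lborel_pow p) (\<Union>\<sigma>\<in>T. cone_slice \<sigma> a b)"
  proof (rule measure_eq_AE)
    show "AE z in lborel_pow p. z \<in> cone_slice J a b \<longleftrightarrow> z \<in> (\<Union>\<sigma>\<in>T. cone_slice \<sigma> a b)"
      using AE_not_in[OF N] by eventually_elim (use cover cone_slice_mono[OF J(1) fin(2)] in blast)
  qed (use comp slice_meas finT in \<open>auto simp: borel_compact_fun fmeasurable_def\<close>)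
  also have "\<dots> = (\<Sum>\<sigma>\<in>T. measure (lborel_pow p) (cone_slice \<sigma> a b))"
  proof (rule measure_UNION_AE[OF finT slice_meas])
    show "pairwise (\<lambda>\<sigma> \<tau>. AE z in lborel_pow p. z \<notin> cone_slice \<sigma> a b \<or> z \<notin> cone_slice \<tau> a b) T"
    proof (rule pairwiseI)
      fix \<sigma> \<tau> assume st: "\<sigma> \<in> T" "\<tau> \<in> T" "\<sigma> \<noteq> \<tau>"
      show "AE z in lborel_pow p. z \<notin> cone_slice \<sigma> a b \<or> z \<notin> cone_slice \<tau> a b"
        using AE_not_in[OF N]
      proof eventually_elim
        case (elim z)
        show ?case
        proof (rule ccontr)
          assume "\<not> ?thesis"
          then have z: "z \<in> cone_slice \<sigma> a b" "z \<in> cone_slice \<tau> a b" by auto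
          have "(z, a, b) \<in> ?W" using z(1) cone_slice_mono[OF J(1) fin(2)[OF st(1)]] sub by auto
          then have "\<sigma> = \<tau>"
            by (rule regular_triangulation_disjoint[OF J(1) JW st(1,2)[unfolded T_def]])
               (use repr st z elim in blast)+
          then show False using st by simp
        qed
      qed
    qed
  qed
  finally show ?thesis by (simp add: T_def)
qed

text \<open>The Cayley configuration in homogeneous form: the tags are the two unit vectors of the
  plane, so that the cone over the configuration is its plain conic span.\<close>

definition cayley :: "'v set \<Rightarrow> 'v set \<Rightarrow> ('v \<times> real \<times> real) set"
  where "cayley U W = (\<lambda>u. (u, 1, 0)) ` U \<union> (\<lambda>w. (w, 0, 1)) ` W"

lemma cone_slice_cayley:
  fixes U W :: "(nat \<Rightarrow> 'a::euclidean_space) set"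
  assumes fin: "finite U" "finite W" and sub: "U \<subseteq> pow_space p" "W \<subseteq> pow_space p"
    and ab: "0 < a" "0 < b"
  shows "cone_slice (cayley U W) a b = dilate a (convex hull U) + dilate b (convex hull W)"
proof -
  have J: "finite (cayley U W)" "lifted p (cayley U W)"
    using fin sub by (auto simp: cayley_def lifted_def)
  have s0: "{x \<in> cayley U W. snd x = (1, 0)} = (\<lambda>u. (u, 1, 0)) ` U"
    and s1: "{x \<in> cayley U W. snd x = (0, 1)} = (\<lambda>w. (w, 0, 1)) ` W"
    by (auto simp: cayley_def)
  have inj: "inj_on (\<lambda>u. (u, 1::real, 0::real)) U" "inj_on (\<lambda>w. (w, 0::real, 1::real)) W"
    by (auto simp: inj_on_def)
  have eq: "(\<Sum>x\<in>cayley U W. c x *\<^sub>R x) = ((\<Sum>u\<in>U. c (u, 1, 0) *\<^sub>R u) + (\<Sum>w\<in>W. c (w, 0, 1) *\<^sub>R w),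
       (\<Sum>u\<in>U. c (u, 1, 0)), (\<Sum>w\<in>W. c (w, 0, 1)))" for c
  proof -
    have "(\<Sum>x\<in>cayley U W. c x *\<^sub>R fst x) = (\<Sum>x\<in>(\<lambda>u. (u, 1, 0)) ` U. c x *\<^sub>R fst x) + (\<Sum>x\<in>(\<lambda>w. (w, 0, 1)) ` W. c x *\<^sub>R fst x)"
      unfolding cayley_def using fin by (intro sum.union_disjoint) auto
    then show ?thesis unfolding lifted_sum[OF J] s0 s1 using inj by (simp add: sum.reindex)
  qed
  show ?thesis
  proof (intro equalityI subsetI)
    fix z assume "z \<in> cone_slice (cayley U W) a b"
    then obtain c where c: "\<forall>x\<in>cayley U W. 0 \<le> c x" "(\<Sum>x\<in>cayley U W. c x *\<^sub>R x) = (z, a, b)"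
      by (auto simp: cone_slice_def)
    note e = c(2)[unfolded eq prod.inject]
    have "(\<Sum>u\<in>U. (c (u, 1, 0) / a) *\<^sub>R u) \<in> convex hull U"
      unfolding convex_hull_finite[OF fin(1)] using c(1) ab e
      by (intro CollectI exI[of _ "\<lambda>u. c (u, 1, 0) / a"]) (auto simp: cayley_def simp flip: sum_divide_distrib)
    moreover have "(\<Sum>w\<in>W. (c (w, 0, 1) / b) *\<^sub>R w) \<in> convex hull W"
      unfolding convex_hull_finite[OF fin(2)] using c(1) ab e
      by (intro CollectI exI[of _ "\<lambda>u. c (u, 0, 1) / b"]) (auto simp: cayley_def simp flip: sum_divide_distrib)
    moreover have "z = a *\<^sub>R (\<Sum>u\<in>U. (c (u, 1, 0) / a) *\<^sub>R u) + b *\<^sub>R (\<Sum>w\<in>W. (c (w, 0, 1) / b) *\<^sub>R w)"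
      using e ab by (simp add: scaleR_sum_right)
    ultimately show "z \<in> dilate a (convex hull U) + dilate b (convex hull W)"
      unfolding set_plus_def dilate_def by blast
  next
    fix z assume "z \<in> dilate a (convex hull U) + dilate b (convex hull W)"
    then obtain x y where xy: "x \<in> convex hull U" "y \<in> convex hull W" "z = a *\<^sub>R x + b *\<^sub>R y"
      by (auto simp: set_plus_def dilate_def)
    obtain u where u: "\<forall>x\<in>U. 0 \<le> u x" "sum u U = 1" "(\<Sum>x\<in>U. u x *\<^sub>R x) = x"
      using xy(1) unfolding convex_hull_finite[OF fin(1)] by auto
    obtain w where w: "\<forall>x\<in>W. 0 \<le> w x" "sum w W = 1" "(\<Sum>x\<in>W. w x *\<^sub>R x) = y"
      using xy(2) unfolding convex_hull_finite[OF fin(2)] by auto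
    define c where "c x = (if snd x = (1, 0) then a * u (fst x) else b * w (fst x))" for x :: "(nat \<Rightarrow> 'a) \<times> real \<times> real"
    have "(\<Sum>x\<in>cayley U W. c x *\<^sub>R x) = (z, a, b)"
      unfolding eq using u w xy(3) by (auto simp: c_def simp flip: scaleR_scaleR scaleR_sum_right sum_distrib_left)
    moreover have "\<forall>x\<in>cayley U W. 0 \<le> c x" using u w ab by (auto simp: c_def cayley_def)
    ultimately show "z \<in> cone_slice (cayley U W) a b" by (auto simp: cone_slice_def)
  qed
qed

lemma convex_pow_space: "convex (pow_space p :: (nat \<Rightarrow> 'a::real_vector) set)"
  by (intro subspace_imp_convex subspace_pow_space)

lemma dilate_plus_subset_pow_space:
  "A \<subseteq> pow_space p \<Longrightarrow> B \<subseteq> pow_space p \<Longrightarrow> dilate a A + dilate b B \<subseteq> (pow_space p :: (nat \<Rightarrow> 'a::real_vector) set)"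
  by (auto simp: set_plus_def dilate_def intro!: subspace_add subspace_scale subspace_pow_space)

text \<open>Collects the cells by their exponent k. The coefficients are free of a and b because the
  triangulation depends on \<omega> and the vertices alone and each cell enters through its slice at
  (1, 1).\<close>

lemma vol_cayley:
  fixes U W :: "(nat \<Rightarrow> 'a::euclidean_space) set"
  assumes fin: "finite U" "finite W" and sub: "U \<subseteq> pow_space p" "W \<subseteq> pow_space p"
    and ab: "0 < a" "0 < b"
    and gen: "\<And>\<sigma> x. \<sigma> \<subseteq> cayley U W \<Longrightarrow> x \<in> cayley U W - \<sigma> \<Longrightarrow> height \<omega> \<sigma> x \<noteq> \<omega> x"
  shows "vol p (dilate a (convex hull U) + dilate b (convex hull W)) =
    (\<Sum>k\<le>DIM('a) * p. (\<Sum>\<sigma> | \<sigma> \<in> regular_triangulation \<omega> (pow_space p \<times> UNIV) (cayley U W) \<and> card {x\<in>\<sigma>. snd x = (1, 0)} - 1 = k.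
        measure (lborel_pow p) (cone_slice \<sigma> 1 1)) * a ^ k * b ^ (DIM('a) * p - k))"
proof -
  let ?J = "cayley U W" and ?N = "DIM('a) * p"
  let ?T = "regular_triangulation \<omega> (pow_space p \<times> UNIV) ?J"
  let ?k = "\<lambda>\<sigma>. card {x\<in>\<sigma>. snd x = (1, 0)} - 1"
  let ?S = "dilate a (convex hull U) + dilate b (convex hull W)"
  have J: "finite ?J" "lifted p ?J" using fin sub by (auto simp: cayley_def lifted_def)
  have S: "compact ?S" "?S \<subseteq> pow_space p"
    by (intro compact_sum_fun compact_convex_hull_fun fin)
      (intro dilate_plus_subset_pow_space hull_minimal convex_pow_space sub)
  have eq: "cone_slice ?J a b = ?S" by (rule cone_slice_cayley[OF fin sub ab])
  have fin: "finite \<sigma>" "lifted p \<sigma>" "independent \<sigma>" "pow_space p \<times> UNIV \<subseteq> span \<sigma>" if "\<sigma> \<in> ?T" for \<sigma>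
    using that J by (auto simp: regular_triangulation_def lifted_def intro: finite_subset)
  have finT: "finite ?T" using J(1) by (auto simp: regular_triangulation_def intro: finite_subset[of _ "Pow ?J"])
  have kN: "?k \<sigma> \<le> ?N" if "\<sigma> \<in> ?T" for \<sigma>
    using cone_slice_basis(1)[OF fin[OF that]] by simp
  have m: "measure (lborel_pow p) (cone_slice \<sigma> a b) = measure (lborel_pow p) (cone_slice \<sigma> 1 1) * a ^ ?k \<sigma> * b ^ (?N - ?k \<sigma>)"
    if "\<sigma> \<in> ?T" for \<sigma>
  proof -
    have "?N - ?k \<sigma> = card {x\<in>\<sigma>. snd x = (0, 1)} - 1"
      using cone_slice_basis(1)[OF fin[OF that]] by simp
    then show ?thesis
      using cone_slice_basis(3)[OF fin[OF that] ab] ab by (simp add: measure_def enn2real_mult)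
  qed
  have "vol p ?S = measure (lborel_pow p) ?S"
    using S by (intro vol_eq borel_compact_fun)
  also have "\<dots> = (\<Sum>\<sigma>\<in>?T. measure (lborel_pow p) (cone_slice \<sigma> a b))"
    using measure_cone_slice[OF J ab _ _ gen] S unfolding eq by simp
  also have "\<dots> = (\<Sum>\<sigma>\<in>?T. measure (lborel_pow p) (cone_slice \<sigma> 1 1) * a ^ ?k \<sigma> * b ^ (?N - ?k \<sigma>))"
    by (intro sum.cong refl m)
  also have "\<dots> = (\<Sum>k\<le>?N. \<Sum>\<sigma> | \<sigma> \<in> ?T \<and> ?k \<sigma> = k. measure (lborel_pow p) (cone_slice \<sigma> 1 1) * a ^ ?k \<sigma> * b ^ (?N - ?k \<sigma>))"
    using kN by (intro sum.group[symmetric] finT) auto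
  also have "\<dots> = (\<Sum>k\<le>?N. (\<Sum>\<sigma> | \<sigma> \<in> ?T \<and> ?k \<sigma> = k. measure (lborel_pow p) (cone_slice \<sigma> 1 1)) * a ^ k * b ^ (?N - k))"
    by (intro sum.cong refl) (auto simp: sum_distrib_right intro!: sum.cong)
  finally show ?thesis .
qed

lemma coefficients_unique:
  fixes c d :: "nat \<Rightarrow> real"
  assumes "\<And>a. 0 < a \<Longrightarrow> (\<Sum>k\<le>N. c k * a ^ k) = (\<Sum>k\<le>N. d k * a ^ k)" and "k \<le> N"
  shows "c k = d k"
proof (rule ccontr)
  assume "c k \<noteq> d k"
  then have "\<exists>k\<le>N. c k - d k \<noteq> 0" using assms(2) by auto
  then have "finite {z. (\<Sum>k\<le>N. (c k - d k) * z ^ k) = 0}"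
    by (simp only: Transcendental.polyfun_finite_roots)
  moreover have "{0<..} \<subseteq> {z. (\<Sum>k\<le>N. (c k - d k) * z ^ k) = 0}"
    using assms(1) by (auto simp: left_diff_distrib sum_subtractf)
  ultimately have "finite {0::real<..}" by (rule finite_subset[rotated])
  then show False by (simp add: infinite_Ioi)
qed

text \<open>The bound on c k is the monotonicity \<open>V(A[k], B[N - k]) \<le> V(C[N])\<close> with
  C the hull of both polytopes. Together with nonnegativity it confines the coefficients to a
  compact range, which the passage to general bodies uses.\<close>

lemma vol_polytope_expansion:
  fixes U W :: "(nat \<Rightarrow> 'a::euclidean_space) set"
  assumes fin: "finite U" "finite W" and ne: "U \<noteq> {}"
    and sub: "U \<subseteq> pow_space p" "W \<subseteq> pow_space p"
  obtains c where "\<And>k. 0 \<le> c k"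
    "\<And>k. k \<le> DIM('a) * p \<Longrightarrow> c k \<le> real (DIM('a) * p choose k) * vol p (convex hull (U \<union> W))"
    "\<And>a b. 0 < a \<Longrightarrow> 0 < b \<Longrightarrow> vol p (dilate a (convex hull U) + dilate b (convex hull W))
       = (\<Sum>k\<le>DIM('a) * p. c k * a ^ k * b ^ (DIM('a) * p - k))"
proof -
  let ?N = "DIM('a) * p"
  let ?J = "cayley U W" and ?J' = "cayley (U \<union> W) (U \<union> W)"
  let ?C = "convex hull (U \<union> W)"
  have J: "finite ?J'" "?J \<subseteq> ?J'" using fin by (auto simp: cayley_def)
  obtain \<omega> where \<omega>: "\<And>\<sigma> x. \<sigma> \<subseteq> ?J' \<Longrightarrow> x \<in> ?J' - \<sigma> \<Longrightarrow> height \<omega> \<sigma> x \<noteq> \<omega> x"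
    "\<And>\<sigma> x. \<sigma> \<subseteq> ?J \<Longrightarrow> x \<in> ?J' - ?J \<Longrightarrow> height \<omega> \<sigma> x < \<omega> x"
    by (rule exists_generic_heights[OF J], rule that) (assumption | simp only:)+
  define T where "T J = regular_triangulation \<omega> (pow_space p \<times> UNIV) J" for J :: "((nat \<Rightarrow> 'a) \<times> real \<times> real) set"
  \<comment> \<open>The points added to the configuration lie strictly above the functional of every
    subset of \<open>?J\<close>, so they violate none of the inequalities defining its
    cells.\<close>
  have TT: "T ?J \<subseteq> T ?J'"
  proof
    fix \<sigma> assume "\<sigma> \<in> T ?J"
    then have \<sigma>: "\<sigma> \<subseteq> ?J" "independent \<sigma>" "pow_space p \<times> UNIV \<subseteq> span \<sigma>" "\<forall>x\<in>?J - \<sigma>. height \<omega> \<sigma> x < \<omega> x"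
      by (simp_all add: T_def regular_triangulation_def)
    have "height \<omega> \<sigma> x < \<omega> x" if "x \<in> ?J' - \<sigma>" for x
      using \<sigma>(4) \<omega>(2)[OF \<sigma>(1), of x] that by (cases "x \<in> ?J") auto
    then show "\<sigma> \<in> T ?J'" using \<sigma> J(2) by (simp add: T_def regular_triangulation_def)
  qed
  have finT: "finite (T ?J')" using J(1) by (auto simp: T_def regular_triangulation_def intro: finite_subset[of _ "Pow ?J'"])
  define c where "c J k = (\<Sum>\<sigma> | \<sigma> \<in> T J \<and> card {x\<in>\<sigma>. snd x = (1, 0)} - 1 = k. measure (lborel_pow p) (cone_slice \<sigma> 1 1))" for J k
  have C: "compact ?C" "?C \<subseteq> pow_space p"
    by (intro compact_convex_hull_fun finite_UnI fin) (intro hull_minimal convex_pow_space Un_least sub)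
  \<comment> \<open>With the same hull C in both places the sum is \<open>dilate (a + b) C\<close>.
    Comparing powers of a at b = 1 already determines all coefficients.\<close>
  have c': "c ?J' k = real (?N choose k) * vol p ?C" if k: "k \<le> ?N" for k
  proof (rule coefficients_unique[OF _ k])
    fix a :: real assume a: "0 < a"
    have "(\<Sum>k\<le>?N. c ?J' k * a ^ k) = (\<Sum>k\<le>?N. c ?J' k * a ^ k * 1 ^ (?N - k))" by simp
    also have "\<dots> = vol p (dilate a ?C + dilate 1 ?C)"
      unfolding c_def T_def by (rule vol_cayley[symmetric]) (use fin sub a \<omega>(1) in auto)
    also have "dilate a ?C + dilate 1 ?C = dilate (a + 1) ?C"
      using a ne by (intro dilate_plus_same) auto
    also have "vol p \<dots> = (a + 1) ^ ?N * vol p ?C"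
      using a C by (subst vol_dilate) (auto intro: borel_compact_fun)
    also have "(a + 1) ^ ?N = (\<Sum>k\<le>?N. real (?N choose k) * a ^ k)"
      by (simp add: binomial_ring)
    finally show "(\<Sum>k\<le>?N. c ?J' k * a ^ k) = (\<Sum>k\<le>?N. real (?N choose k) * vol p ?C * a ^ k)"
      by (simp only: sum_distrib_right sum_distrib_left mult_ac)
  qed
  show ?thesis
  proof (rule that)
    show "0 \<le> c ?J k" for k unfolding c_def by (intro sum_nonneg) auto
    show "c ?J k \<le> real (?N choose k) * vol p ?C" if "k \<le> ?N" for k
      unfolding c'[OF that, symmetric] unfolding c_def using TT finT
      by (intro sum_mono2) auto
    show "vol p (dilate a (convex hull U) + dilate b (convex hull W)) = (\<Sum>k\<le>?N. c ?J k * a ^ k * b ^ (?N - k))"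
      if "0 < a" "0 < b" for a b
      unfolding c_def T_def using fin sub that
    proof (rule vol_cayley)
      show "height \<omega> \<sigma> x \<noteq> \<omega> x" if "\<sigma> \<subseteq> ?J" "x \<in> ?J - \<sigma>" for \<sigma> x
        using \<omega>(1)[of \<sigma> x] that J(2) by blast
    qed
  qed
qed

section \<open>The volume of a Minkowski sum of two convex bodies\<close>

text \<open>The copy of K shrunk towards z is a compact subset of the interior. Each of its points
  is interior to a small cube inside K; U consists of the corners of finitely many of these cubes
  that cover the copy.\<close>

lemma exists_inner_polytope:
  fixes K :: "'a::euclidean_space set"
  assumes K: "compact K" "convex K" and z: "z \<in> interior K" and e: "0 < e" "e \<le> 1"
  obtains U where "finite U" "U \<noteq> {}" "U \<subseteq> K" "(\<lambda>x. z + (1 - e) *\<^sub>R (x - z)) ` K \<subseteq> convex hull U"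
proof -
  define C where "C = (\<lambda>x. z + (1 - e) *\<^sub>R (x - z)) ` K"
  have C: "compact C"
    unfolding C_def using K by (intro compact_continuous_image continuous_intros)
  have CK: "C \<subseteq> interior K"
  proof
    fix y assume "y \<in> C"
    then obtain x where x: "x \<in> K" "y = x - e *\<^sub>R (x - z)" by (auto simp: C_def algebra_simps)
    show "y \<in> interior K" unfolding x(2) using mem_interior_convex_shrink[OF K(2) z x(1) e] .
  qed
  have "\<exists>V. finite V \<and> V \<subseteq> K \<and> y \<in> interior (convex hull V)" if y: "y \<in> C" for y
  proof -
    from y CK have "y \<in> interior K" by auto
    then obtain r where r: "r > 0" "cball y r \<subseteq> K" by (auto simp: mem_interior_cball)
    \<comment> \<open>Half the side of the cube. The 1-norm of a deviation is at most
      \<open>DIM('a)\<close> times d, that is r / 2, which keeps the cube inside the ball.\<close>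
    define d where "d = r / (2 * real DIM('a))"
    have d: "d > 0" using r by (simp add: d_def)
    obtain V where V: "finite V" "cbox (y - (\<Sum>i\<in>Basis. d *\<^sub>R i)) (y + (\<Sum>i\<in>Basis. d *\<^sub>R i)) = convex hull V"
      by (rule cube_convex_hull[OF d])
    have "cbox (y - (\<Sum>i\<in>Basis. d *\<^sub>R i)) (y + (\<Sum>i\<in>Basis. d *\<^sub>R i)) \<subseteq> cball y r"
    proof
      fix x assume x: "x \<in> cbox (y - (\<Sum>i\<in>Basis. d *\<^sub>R i)) (y + (\<Sum>i\<in>Basis. d *\<^sub>R i))"
      have "norm (y - x) \<le> (\<Sum>i\<in>Basis. \<bar>(y - x) \<bullet> i\<bar>)" by (rule norm_le_l1)
      also have "\<dots> \<le> (\<Sum>i\<in>(Basis::'a set). d)"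
        using x by (intro sum_mono) (auto simp: mem_box inner_diff_left inner_add_left abs_le_iff)
      also have "\<dots> = r / 2" by (simp add: d_def)
      finally show "x \<in> cball y r" using r by (simp add: dist_norm)
    qed
    then have "convex hull V \<subseteq> K" using r V by auto
    then have "V \<subseteq> K" using hull_subset[of V convex] by auto
    moreover have "y \<in> interior (convex hull V)"
      unfolding V(2)[symmetric] using d by (auto simp: interior_cbox mem_box inner_diff_left inner_add_left)
    ultimately show ?thesis using V by blast
  qed
  then obtain V where V: "\<And>y. y \<in> C \<Longrightarrow> finite (V y)" "\<And>y. y \<in> C \<Longrightarrow> V y \<subseteq> K"
    "\<And>y. y \<in> C \<Longrightarrow> y \<in> interior (convex hull (V y))" by metis
  obtain D where D: "D \<subseteq> C" "finite D" "C \<subseteq> (\<Union>y\<in>D. interior (convex hull (V y)))"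
    by (rule compactE_image[OF C, of C "\<lambda>y. interior (convex hull (V y))"]) (use V(3) in blast)+
  define U where "U = (\<Union>y\<in>D. V y)"
  show ?thesis
  proof (rule that)
    show "finite U" using D V(1) by (auto simp: U_def)
    show "U \<subseteq> K" using D V(2) by (auto simp: U_def)
    show sub: "(\<lambda>x. z + (1 - e) *\<^sub>R (x - z)) ` K \<subseteq> convex hull U"
      unfolding C_def[symmetric]
    proof
      fix x assume "x \<in> C"
      then obtain y where y: "y \<in> D" "x \<in> interior (convex hull (V y))" using D by blast
      then have "x \<in> convex hull (V y)" using interior_subset by blast
      also have "\<dots> \<subseteq> convex hull U" using y by (intro hull_mono) (auto simp: U_def)
      finally show "x \<in> convex hull U" .
    qed
    show "U \<noteq> {}"
    proof
      assume "U = {}"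
      then have "K = {}" using sub by simp
      then show False using z by simp
    qed
  qed
qed

section \<open>Cartesian powers, the diagonal and dilates: convex hulls, compactness and inclusion
  in the power space\<close>

lemma finite_cart_power: "finite U \<Longrightarrow> finite (cart_power p U)"
proof -
  assume U: "finite U"
  have "cart_power p U \<subseteq> (\<lambda>x i. if i < p then x i else 0) ` (Pi\<^sub>E {..<p} (\<lambda>_. U))"
  proof
    fix x assume x: "x \<in> cart_power p U"
    then have "x = (\<lambda>i. if i < p then restrict x {..<p} i else 0)" "restrict x {..<p} \<in> Pi\<^sub>E {..<p} (\<lambda>_. U)"
      by (auto simp: cart_power_def fun_eq_iff)
    then show "x \<in> (\<lambda>x i. if i < p then x i else 0) ` (Pi\<^sub>E {..<p} (\<lambda>_. U))" by (rule image_eqI)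
  qed
  then show ?thesis by (rule finite_subset) (intro finite_imageI finite_PiE U finite_lessThan)
qed

lemma convex_cart_power: "convex K \<Longrightarrow> convex (cart_power p K)"
  for K :: "'a::real_vector set"
  by (auto simp: convex_def cart_power_def fun_vector_apply)

lemma cart_power_mono: "A \<subseteq> B \<Longrightarrow> cart_power p A \<subseteq> cart_power p B"
  by (auto simp: cart_power_def)

text \<open>The nontrivial inclusion frees one coordinate at a time: those before q range over the
  hull, the others still over U. The admissible values of coordinate q form a convex set containing
  U, hence containing its hull.\<close>

lemma convex_hull_cart_power:
  fixes U :: "'a::real_vector set"
  shows "convex hull (cart_power p U) = cart_power p (convex hull U)"
proof
  show "convex hull (cart_power p U) \<subseteq> cart_power p (convex hull U)"
    by (intro hull_minimal cart_power_mono hull_subset convex_cart_power convex_convex_hull)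
  have "y \<in> convex hull (cart_power p U)"
    if "q \<le> p" "\<And>i. i < q \<Longrightarrow> y i \<in> convex hull U" "\<And>i. q \<le> i \<Longrightarrow> i < p \<Longrightarrow> y i \<in> U" "\<And>i. p \<le> i \<Longrightarrow> y i = 0" for q y
    using that
  proof (induction q arbitrary: y)
    case 0
    then show ?case by (intro hull_inc) (auto simp: cart_power_def)
  next
    case (Suc q)
    let ?H = "{z. y(q := z) \<in> convex hull (cart_power p U)}"
    have "convex hull U \<subseteq> ?H"
    proof (rule hull_minimal)
      show "U \<subseteq> ?H"
      proof
        fix z assume "z \<in> U"
        then show "z \<in> ?H" using Suc.prems by (intro CollectI Suc.IH) auto
      qed
      show "convex ?H"
      proof (intro convexI CollectI)
        fix x z and u v :: real
        assume *: "x \<in> ?H" "z \<in> ?H" "0 \<le> u" "0 \<le> v" "u + v = 1"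
        have "y(q := u *\<^sub>R x + v *\<^sub>R z) = u *\<^sub>R y(q := x) + v *\<^sub>R y(q := z)"
          using *(5) by (auto simp: fun_eq_iff fun_vector_apply simp flip: scaleR_add_left)
        then show "y(q := u *\<^sub>R x + v *\<^sub>R z) \<in> convex hull (cart_power p U)"
          using * convexD[OF convex_convex_hull] by fastforce
      qed
    qed
    then show ?case using Suc.prems(2)[of q] by force
  qed
  from this[of p] show "cart_power p (convex hull U) \<subseteq> convex hull (cart_power p U)"
    by (auto simp: cart_power_def)
qed

lemma linear_diag: "linear (diag p :: 'a::real_vector \<Rightarrow> nat \<Rightarrow> 'a)"
  by (rule linearI) (auto simp: diag_def fun_eq_iff fun_vector_apply)

lemma convex_hull_dilate: "convex hull (dilate c A) = dilate c (convex hull A)"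
  unfolding dilate_def by (rule convex_hull_linear_image[OF linear_scale_self, symmetric])

lemma convex_hull_diag: "convex hull (diag p ` U) = diag p ` (convex hull U)"
  for U :: "'a::real_vector set"
  by (rule convex_hull_linear_image[OF linear_diag, symmetric])

lemma diag_subset: "diag p ` K \<subseteq> pow_space p"
  by (auto simp: diag_def pow_space_def)

lemma dilate_subset_pow_space: "A \<subseteq> pow_space p \<Longrightarrow> dilate c A \<subseteq> (pow_space p :: (nat \<Rightarrow> 'a::real_vector) set)"
  by (auto simp: dilate_def intro!: subspace_scale subspace_pow_space)

lemma compact_dilate_fun:
  fixes A :: "(nat \<Rightarrow> 'a::euclidean_space) set"
  assumes "compact A"
  shows "compact (dilate c A)"
proof -
  have "continuous_on A (\<lambda>x. c *\<^sub>R x)"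
  proof (rule continuous_on_funI)
    fix i
    have "continuous_on A (\<lambda>x. c *\<^sub>R x i)"
      by (intro continuous_on_scaleR continuous_on_const continuous_on_component)
    then show "continuous_on A (\<lambda>x. (c *\<^sub>R x) i)" by (simp add: fun_vector_apply)
  qed
  then show ?thesis unfolding dilate_def using assms by (rule compact_continuous_image)
qed

lemma compact_diag:
  fixes K :: "'a::euclidean_space set"
  assumes "compact K"
  shows "compact (diag p ` K)"
proof -
  have "continuous_on K (diag p)"
  proof (rule continuous_on_funI)
    show "continuous_on K (\<lambda>x. diag p x i)" for i
      by (cases "i < p") (auto simp: diag_def)
  qed
  then show ?thesis using assms by (rule compact_continuous_image)
qed

lemma convex_dilate: "convex A \<Longrightarrow> convex (dilate c A)"
  unfolding dilate_def by (rule convex_scaling)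

lemma convex_diag: "convex K \<Longrightarrow> convex (diag p ` K)"
  for K :: "'a::real_vector set"
  by (rule convex_linear_image[OF linear_diag])

lemma dilate_mono: "A \<subseteq> B \<Longrightarrow> dilate c A \<subseteq> dilate c B"
  by (auto simp: dilate_def)

lemma join_subset_pow_space:
  "A \<subseteq> pow_space p \<Longrightarrow> B \<subseteq> pow_space p \<Longrightarrow> A \<or>\<^sub>c B \<subseteq> (pow_space p :: (nat \<Rightarrow> 'a::real_vector) set)"
  unfolding join_def by (intro hull_minimal convex_pow_space) auto

lemma tendsto_component:
  fixes f :: "nat \<Rightarrow> nat \<Rightarrow> 'a::euclidean_space"
  assumes "f \<longlonglongrightarrow> l"
  shows "(\<lambda>m. f m i) \<longlonglongrightarrow> l i"
proof -
  have "isCont (\<lambda>x :: nat \<Rightarrow> 'a. x i) l"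
    using continuous_on_component[where 'a = 'a, of UNIV i]
    by (simp add: continuous_on_eq_continuous_at del: continuous_on_product_coordinates)
  then show ?thesis using assms by (rule isCont_tendsto_compose)
qed

lemma compact_translate_fun:
  fixes A :: "(nat \<Rightarrow> 'a::euclidean_space) set"
  assumes "compact A"
  shows "compact ((\<lambda>x. x + v) ` A)"
proof -
  have "(\<lambda>x. x + v) ` A = dilate 1 A + dilate 1 {v}"
    by (auto simp: set_plus_def dilate_def)
  then show ?thesis using compact_sum_fun[OF assms, of "{v}"] by simp
qed

text \<open>One polytope inscribed in K inscribes polytopes in A and in B simultaneously, as both
  are built from K. Their weighted sum contains a homothetic copy of aA + bB with ratio 1 - e, for
  all weights at once. The bound on the coefficients does not depend on e.\<close>

lemma vol_body_expansion_approx: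
  fixes K :: "'a::euclidean_space set" and r s :: real and p :: nat
  assumes K: "compact K" "convex K" and z: "z \<in> interior K" and e: "0 < e" "e < 1"
  defines "A \<equiv> dilate s (diag p ` K)" and "B \<equiv> dilate r (cart_power p K)"
  shows "\<exists>c. (\<forall>k. 0 \<le> c k) \<and> (\<forall>k. c k \<le> real (DIM('a) * p choose k) * vol p (A \<or>\<^sub>c B)) \<and>
    (\<forall>a b. 0 < a \<longrightarrow> 0 < b \<longrightarrow> (1 - e) ^ (DIM('a) * p) * vol p (dilate a A + dilate b B)
       \<le> (\<Sum>k\<le>DIM('a) * p. c k * a ^ k * b ^ (DIM('a) * p - k))
     \<and> (\<Sum>k\<le>DIM('a) * p. c k * a ^ k * b ^ (DIM('a) * p - k)) \<le> vol p (dilate a A + dilate b B))"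
proof -
  let ?N = "DIM('a) * p"
  obtain U where U: "finite U" "U \<noteq> {}" "U \<subseteq> K" "(\<lambda>x. z + (1 - e) *\<^sub>R (x - z)) ` K \<subseteq> convex hull U"
    using exists_inner_polytope[OF K z] e by (metis less_imp_le)
  define A' where "A' = dilate s (diag p ` U)"
  define B' where "B' = dilate r (cart_power p U)"
  have hA: "convex hull A' = dilate s (diag p ` (convex hull U))"
    by (simp add: A'_def convex_hull_dilate convex_hull_diag)
  have hB: "convex hull B' = dilate r (cart_power p (convex hull U))"
    by (simp add: B'_def convex_hull_dilate convex_hull_cart_power)
  have hU: "convex hull U \<subseteq> K" using U K by (intro hull_minimal)
  have subs: "A \<subseteq> pow_space p" "B \<subseteq> pow_space p" "A' \<subseteq> pow_space p" "B' \<subseteq> pow_space p"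
    unfolding A_def B_def A'_def B'_def
    by (intro dilate_subset_pow_space diag_subset cart_power_subset)+
  have comp: "compact A" "compact B" "convex A" "convex B"
    unfolding A_def B_def using K
    by (auto intro!: compact_dilate_fun compact_diag compact_cart_power convex_dilate convex_diag convex_cart_power)
  have AA: "convex hull A' \<subseteq> A" "convex hull B' \<subseteq> B"
    unfolding hA hB unfolding A_def B_def using hU by (intro dilate_mono image_mono cart_power_mono; assumption)+
  have "finite A'" "finite B'" using U by (auto simp: A'_def B'_def dilate_def finite_cart_power)
  moreover have "A' \<noteq> {}" using U by (auto simp: A'_def dilate_def)
  ultimately obtain c where c: "\<And>k. 0 \<le> c k"
    "\<And>k. k \<le> ?N \<Longrightarrow> c k \<le> real (?N choose k) * vol p (convex hull (A' \<union> B'))"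
    "\<And>a b. 0 < a \<Longrightarrow> 0 < b \<Longrightarrow> vol p (dilate a (convex hull A') + dilate b (convex hull B'))
       = (\<Sum>k\<le>?N. c k * a ^ k * b ^ (?N - k))"
    using vol_polytope_expansion[of A' B' p] subs by blast
  \<comment> \<open>Set to 0 beyond the degree, where the binomial coefficient vanishes too, so that
    the bounds hold for every index and whole sequences can be compared later.\<close>
  define c' where "c' k = (if k \<le> ?N then c k else 0)" for k
  have sum': "(\<Sum>k\<le>?N. c' k * a ^ k * b ^ (?N - k)) = (\<Sum>k\<le>?N. c k * a ^ k * b ^ (?N - k))" for a b
    by (intro sum.cong) (auto simp: c'_def)
  have fin: "finite (A' \<union> B')" using \<open>finite A'\<close> \<open>finite B'\<close> by simp
  have volAB: "vol p (convex hull (A' \<union> B')) \<le> vol p (A \<or>\<^sub>c B)"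
  proof (rule vol_mono)
    show "convex hull (A' \<union> B') \<subseteq> A \<or>\<^sub>c B"
      unfolding join_def using AA hull_subset[of A' convex] hull_subset[of B' convex] by (intro hull_mono) blast
  qed (intro compact_convex_hull_fun fin compact_join_fun comp join_subset_pow_space subs)+
  have compS: "compact (dilate a A + dilate b B)" "dilate a A + dilate b B \<subseteq> pow_space p" for a b
    by (intro compact_sum_fun comp) (intro dilate_plus_subset_pow_space subs)
  have comp': "compact (convex hull A')" "compact (convex hull B')" "convex hull A' \<subseteq> pow_space p" "convex hull B' \<subseteq> pow_space p"
    by (intro compact_convex_hull_fun \<open>finite A'\<close> \<open>finite B'\<close>)+ (use AA subs in blast)+
  have compS': "compact (dilate a (convex hull A') + dilate b (convex hull B'))" "dilate a (convex hull A') + dilate b (convex hull B') \<subseteq> pow_space p" for a b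
    by (intro compact_sum_fun comp') (intro dilate_plus_subset_pow_space comp')
  show ?thesis
  proof (intro exI[of _ c'] conjI allI impI)
    show "0 \<le> c' k" for k using c(1) by (simp add: c'_def)
    show "c' k \<le> real (?N choose k) * vol p (A \<or>\<^sub>c B)" for k
    proof (cases "k \<le> ?N")
      case True
      have "c k \<le> real (?N choose k) * vol p (convex hull (A' \<union> B'))" by (rule c(2)[OF True])
      also have "\<dots> \<le> real (?N choose k) * vol p (A \<or>\<^sub>c B)" using volAB by (intro mult_left_mono) auto
      finally show ?thesis using True by (simp add: c'_def)
    qed (auto simp: c'_def vol_def)
    fix a b :: real assume ab: "0 < a" "0 < b"
    show "(\<Sum>k\<le>?N. c' k * a ^ k * b ^ (?N - k)) \<le> vol p (dilate a A + dilate b B)"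
      unfolding sum' c(3)[OF ab, symmetric]
      using compS' compS by (intro vol_mono set_plus_mono2 dilate_mono AA)
    \<comment> \<open>The point of aA + bB obtained by putting z in every place; the shrinking of K
      towards z becomes the homothety with this center.\<close>
    let ?v = "(a * s + b * r) *\<^sub>R diag p z"
    have "(\<lambda>x. x + e *\<^sub>R ?v) ` dilate (1 - e) (dilate a A + dilate b B) \<subseteq> dilate a (convex hull A') + dilate b (convex hull B')"
    proof
      fix w assume "w \<in> (\<lambda>x. x + e *\<^sub>R ?v) ` dilate (1 - e) (dilate a A + dilate b B)"
      then obtain x y where xy: "x \<in> K" "y \<in> cart_power p K"
        "w = (1 - e) *\<^sub>R (a *\<^sub>R s *\<^sub>R diag p x + b *\<^sub>R r *\<^sub>R y) + e *\<^sub>R ?v"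
        by (auto simp: A_def B_def dilate_def set_plus_def)
      define x' where "x' = z + (1 - e) *\<^sub>R (x - z)"
      define y' where "y' i = (if i < p then z + (1 - e) *\<^sub>R (y i - z) else 0)" for i
      have "w = a *\<^sub>R s *\<^sub>R diag p x' + b *\<^sub>R r *\<^sub>R y'"
        unfolding xy(3) using xy(2)
        by (auto simp: fun_eq_iff fun_vector_apply diag_def x'_def y'_def cart_power_def algebra_simps)
      moreover have "x' \<in> convex hull U" using U(4) xy(1) by (auto simp: x'_def)
      moreover have "y' \<in> cart_power p (convex hull U)" using U(4) xy(2) by (auto simp: y'_def cart_power_def)
      ultimately show "w \<in> dilate a (convex hull A') + dilate b (convex hull B')"
        unfolding hA hB by (auto simp: dilate_def set_plus_def)
    qed
    moreover have "vol p ((\<lambda>x. x + e *\<^sub>R ?v) ` dilate (1 - e) (dilate a A + dilate b B)) = (1 - e) ^ ?N * vol p (dilate a A + dilate b B)"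
    proof -
      have "vol p ((\<lambda>x. x + e *\<^sub>R ?v) ` dilate (1 - e) (dilate a A + dilate b B)) = vol p (dilate (1 - e) (dilate a A + dilate b B))"
        using compS e
        by (intro vol_translate borel_compact_fun compact_dilate_fun dilate_subset_pow_space subspace_scale subspace_pow_space)
          (auto simp: diag_def pow_space_def)
      also have "\<dots> = \<bar>1 - e\<bar> ^ ?N * vol p (dilate a A + dilate b B)"
        using compS e by (intro vol_dilate borel_compact_fun) auto
      finally show ?thesis using e by simp
    qed
    moreover have "compact ((\<lambda>x. x + e *\<^sub>R ?v) ` dilate (1 - e) (dilate a A + dilate b B))"
      by (intro compact_translate_fun compact_dilate_fun compS)
    ultimately show "(1 - e) ^ ?N * vol p (dilate a A + dilate b B) \<le> (\<Sum>k\<le>?N. c' k * a ^ k * b ^ (?N - k))"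
      unfolding sum' c(3)[OF ab, symmetric] using vol_mono[OF _ compS'(1) _ compS'(2)] by metis
  qed
qed

text \<open>The coefficient sequences of the approximations lie in a product of compact intervals. A
  subsequence converges in every coordinate, and the sandwich between \<open>(1 - e) ^ N\<close>
  times the volume and the volume passes to the limit for all a and b with the same limit
  coefficients.\<close>

lemma vol_body_expansion_pos:
  fixes K :: "'a::euclidean_space set" and r s :: real and p :: nat
  assumes K: "compact K" "convex K" and z: "z \<in> interior K"
  defines "A \<equiv> dilate s (diag p ` K)" and "B \<equiv> dilate r (cart_power p K)"
  shows "\<exists>c. (\<forall>k. c k \<le> real (DIM('a) * p choose k) * vol p (A \<or>\<^sub>c B)) \<and>
    (\<forall>a b. 0 < a \<longrightarrow> 0 < b \<longrightarrow> vol p (dilate a A + dilate b B)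
       = (\<Sum>k\<le>DIM('a) * p. c k * a ^ k * b ^ (DIM('a) * p - k)))"
proof -
  let ?N = "DIM('a) * p"
  \<comment> \<open>The values 1/2, 1/3, ...: starting at 1/2 keeps the ratio 1 - e
    positive.\<close>
  define e where "e m = inverse (real (Suc (Suc m)))" for m
  have e: "0 < e m" "e m < 1" for m unfolding e_def by (auto intro!: inverse_less_1_iff[THEN iffD2])
  have elim: "e \<longlonglongrightarrow> 0"
    unfolding e_def using LIMSEQ_inverse_real_of_nat by (rule LIMSEQ_Suc)
  let ?M = "\<lambda>k. real (?N choose k) * vol p (A \<or>\<^sub>c B)"
  define P where "P a b = vol p (dilate a A + dilate b B)" for a b
  define Q where "Q m c \<longleftrightarrow> (\<forall>k. 0 \<le> c k) \<and> (\<forall>k. c k \<le> ?M k) \<and> (\<forall>a b. 0 < a \<longrightarrow> 0 < b \<longrightarrow>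
     (1 - e m) ^ ?N * P a b \<le> (\<Sum>k\<le>?N. c k * a ^ k * b ^ (?N - k)) \<and> (\<Sum>k\<le>?N. c k * a ^ k * b ^ (?N - k)) \<le> P a b)" for m c
  have "\<exists>c. Q m c" for m
    unfolding Q_def P_def A_def B_def by (rule vol_body_expansion_approx[OF K z e[of m]])
  then obtain c where "\<And>m. Q m (c m)" by metis
  then have c: "\<And>m k. 0 \<le> c m k \<and> c m k \<le> ?M k"
    "\<And>m a b. 0 < a \<Longrightarrow> 0 < b \<Longrightarrow> (1 - e m) ^ ?N * P a b \<le> (\<Sum>k\<le>?N. c m k * a ^ k * b ^ (?N - k))"
    "\<And>m a b. 0 < a \<Longrightarrow> 0 < b \<Longrightarrow> (\<Sum>k\<le>?N. c m k * a ^ k * b ^ (?N - k)) \<le> P a b"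
    unfolding Q_def by blast+
  have "compactin (product_topology (\<lambda>_::nat. euclidean) UNIV) (Pi\<^sub>E UNIV (\<lambda>k. {0..?M k}))"
    by (auto simp: compactin_PiE)
  then have "compact (Pi\<^sub>E UNIV (\<lambda>k. {0..?M k}))" by (simp add: euclidean_product_topology)
  then have "seq_compact (Pi\<^sub>E UNIV (\<lambda>k. {0..?M k}))" by (rule compact_imp_seq_compact)
  moreover have "\<forall>m. c m \<in> Pi\<^sub>E UNIV (\<lambda>k. {0..?M k})" using c(1) by auto
  ultimately obtain l \<phi> where l: "l \<in> Pi\<^sub>E UNIV (\<lambda>k. {0..?M k})" "strict_mono (\<phi> :: nat \<Rightarrow> nat)" "(c \<circ> \<phi>) \<longlonglongrightarrow> l"
    by (rule seq_compactE)
  have lk: "(\<lambda>m. c (\<phi> m) k) \<longlonglongrightarrow> l k" for k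
    using tendsto_component[OF l(3), of k] by simp
  show ?thesis
  proof (intro exI[of _ l] conjI allI impI)
    show "l k \<le> ?M k" for k using l(1) by (auto simp: PiE_iff)
    fix a b :: real assume ab: "0 < a" "0 < b"
    have "(\<lambda>m. \<Sum>k\<le>?N. c (\<phi> m) k * a ^ k * b ^ (?N - k)) \<longlonglongrightarrow> (\<Sum>k\<le>?N. l k * a ^ k * b ^ (?N - k))"
      by (intro tendsto_sum tendsto_mult lk tendsto_const)
    moreover have "(\<lambda>m. \<Sum>k\<le>?N. c (\<phi> m) k * a ^ k * b ^ (?N - k)) \<longlonglongrightarrow> P a b"
    proof (rule tendsto_sandwich)
      have "(\<lambda>m. e (\<phi> m)) \<longlonglongrightarrow> 0" using LIMSEQ_subseq_LIMSEQ[OF elim l(2)] by (simp add: o_def)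
      then have "(\<lambda>m. (1 - e (\<phi> m)) ^ ?N * P a b) \<longlonglongrightarrow> (1 - 0) ^ ?N * P a b"
        by (intro tendsto_mult tendsto_power tendsto_diff tendsto_const)
      then show "(\<lambda>m. (1 - e (\<phi> m)) ^ ?N * P a b) \<longlonglongrightarrow> P a b" by simp
      show "(\<lambda>m. P a b) \<longlonglongrightarrow> P a b" by (rule tendsto_const)
    qed (use c(2,3)[OF ab] in auto)
    ultimately show "vol p (dilate a A + dilate b B) = (\<Sum>k\<le>?N. l k * a ^ k * b ^ (?N - k))"
      unfolding P_def using LIMSEQ_unique by blast
  qed
qed

text \<open>The expansion extends to the boundary of the orthant by continuity of the measure from above.\<close>

lemma vol_sum_tendsto:
  fixes A B :: "(nat \<Rightarrow> 'a::euclidean_space) set"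
  assumes A: "compact A" "convex A" "0 \<in> A" "A \<subseteq> pow_space p"
    and B: "compact B" "convex B" "0 \<in> B" "B \<subseteq> pow_space p"
    and ab: "0 \<le> a" "0 \<le> b"
  shows "(\<lambda>m. vol p (dilate (a + inverse (real (Suc m))) A + dilate (b + inverse (real (Suc m))) B))
    \<longlonglongrightarrow> vol p (dilate a A + dilate b B)"
proof -
  define e where "e m = inverse (real (Suc m))" for m
  have elim: "e \<longlonglongrightarrow> 0" unfolding e_def by (rule LIMSEQ_inverse_real_of_nat)
  have e: "0 < e m" for m by (simp add: e_def)
  have edec: "e n \<le> e m" if "m \<le> n" for m n using that by (simp add: e_def)
  define S where "S m = dilate (a + e m) A + dilate (b + e m) B" for m
  have comp: "compact (dilate a A + dilate b B)" "dilate a A + dilate b B \<subseteq> pow_space p" for a b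
    by (intro compact_sum_fun A B) (intro dilate_plus_subset_pow_space A B)
  \<comment> \<open>This is where 0 in both bodies matters: their dilates grow with the factor, so
    the sets S m decrease.\<close>
  have mono: "dilate c X \<subseteq> dilate d X" if "0 \<le> c" "c \<le> d" "convex X" "0 \<in> X" for c d and X :: "(nat \<Rightarrow> 'a) set"
  proof
    fix x assume "x \<in> dilate c X"
    then obtain y where y: "y \<in> X" "x = c *\<^sub>R y" by (auto simp: dilate_def)
    show "x \<in> dilate d X"
    proof (cases "d = 0")
      case True
      then show ?thesis using that y by (auto simp: dilate_def)
    next
      case False
      have "(c / d) *\<^sub>R y + (1 - c / d) *\<^sub>R 0 \<in> X"
        using that y False by (intro convexD[OF that(3)]) (auto simp: divide_le_eq_1)
      moreover have "x = d *\<^sub>R ((c / d) *\<^sub>R y + (1 - c / d) *\<^sub>R 0)" using False y by simp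
      ultimately show ?thesis unfolding dilate_def by blast
    qed
  qed
  have dec: "decseq S"
    unfolding S_def decseq_def using ab e edec A B by (intro allI impI set_plus_mono2 mono) (auto intro: add_nonneg_nonneg less_imp_le)
  \<comment> \<open>A point of all S m has representations with varying summands. By compactness of
    A and B these converge along a subsequence, and the limit represents the point with weights
    exactly a and b.\<close>
  have int: "(\<Inter>m. S m) = dilate a A + dilate b B"
  proof
    show "dilate a A + dilate b B \<subseteq> (\<Inter>m. S m)"
      unfolding S_def using ab e A B by (intro INT_greatest set_plus_mono2 mono) (auto intro: less_imp_le)
    show "(\<Inter>m. S m) \<subseteq> dilate a A + dilate b B"
    proof
      fix w assume "w \<in> (\<Inter>m. S m)"
      then have "\<exists>xy\<in>A \<times> B. w = (a + e m) *\<^sub>R fst xy + (b + e m) *\<^sub>R snd xy" for m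
        by (force simp: S_def set_plus_def dilate_def)
      then obtain f where f: "\<And>m. f m \<in> A \<times> B" "\<And>m. w = (a + e m) *\<^sub>R fst (f m) + (b + e m) *\<^sub>R snd (f m)" by metis
      have "seq_compact (A \<times> B)" using A B by (intro compact_imp_seq_compact compact_Times)
      moreover have "\<forall>m. f m \<in> A \<times> B" using f by auto
      ultimately obtain l \<phi> where l: "l \<in> A \<times> B" "strict_mono (\<phi> :: nat \<Rightarrow> nat)" "(f \<circ> \<phi>) \<longlonglongrightarrow> l"
        by (rule seq_compactE)
      have "w i = a *\<^sub>R fst l i + b *\<^sub>R snd l i" for i
      proof -
        have e0: "(\<lambda>m. e (\<phi> m)) \<longlonglongrightarrow> 0" using LIMSEQ_subseq_LIMSEQ[OF elim l(2)] by (simp add: o_def)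
        have "(\<lambda>m. fst (f (\<phi> m)) i) \<longlonglongrightarrow> fst l i" "(\<lambda>m. snd (f (\<phi> m)) i) \<longlonglongrightarrow> snd l i"
          using tendsto_component[OF tendsto_fst[OF l(3)]] tendsto_component[OF tendsto_snd[OF l(3)]] by simp_all
        then have "(\<lambda>m. (a + e (\<phi> m)) *\<^sub>R fst (f (\<phi> m)) i + (b + e (\<phi> m)) *\<^sub>R snd (f (\<phi> m)) i)
          \<longlonglongrightarrow> (a + 0) *\<^sub>R fst l i + (b + 0) *\<^sub>R snd l i"
          by (intro tendsto_add tendsto_scaleR tendsto_const e0)
        moreover have "(a + e (\<phi> m)) *\<^sub>R fst (f (\<phi> m)) i + (b + e (\<phi> m)) *\<^sub>R snd (f (\<phi> m)) i = w i" for m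
          using fun_cong[OF f(2)[of "\<phi> m"], of i] by (simp add: fun_vector_apply)
        ultimately have "(\<lambda>m. w i) \<longlonglongrightarrow> a *\<^sub>R fst l i + b *\<^sub>R snd l i" by simp
        then show ?thesis using LIMSEQ_unique tendsto_const by blast
      qed
      then have "w = a *\<^sub>R fst l + b *\<^sub>R snd l" by (auto simp: fun_eq_iff fun_vector_apply)
      moreover have "fst l \<in> A" "snd l \<in> B" using l(1) by auto
      ultimately show "w \<in> dilate a A + dilate b B"
        unfolding dilate_def set_plus_def by blast
    qed
  qed
  have "(\<lambda>m. measure (lborel_pow p) (S m)) \<longlonglongrightarrow> measure (lborel_pow p) (\<Inter>m. S m)"
  proof (rule Lim_measure_decseq[OF _ dec])
    show "range S \<subseteq> sets (lborel_pow p)" using comp by (auto simp: S_def borel_compact_fun)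
    show "emeasure (lborel_pow p) (S m) \<noteq> \<infinity>" for m
      using emeasure_compact_pow_finite[OF comp, of "a + e m" "b + e m"] by (simp add: S_def less_top)
  qed
  moreover have "vol p (dilate a A + dilate b B) = measure (lborel_pow p) (dilate a A + dilate b B)" for a b
    using comp by (intro vol_eq borel_compact_fun)
  ultimately show ?thesis unfolding int by (simp add: S_def e_def)
qed

text \<open>The mixed volume differentiates at the origin within the closed orthant, so the
  expansion is required for vanishing weights as well. The assumption 0 in K is met by the translate
  of K by one of its points.\<close>

lemma vol_body_expansion:
  fixes K :: "'a::euclidean_space set" and r s :: real and p :: nat
  assumes K: "compact K" "convex K" "interior K \<noteq> {}" "0 \<in> K"
  defines "A \<equiv> dilate s (diag p ` K)" and "B \<equiv> dilate r (cart_power p K)"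
  shows "\<exists>c. (\<forall>k. c k \<le> real (DIM('a) * p choose k) * vol p (A \<or>\<^sub>c B)) \<and>
    (\<forall>a b. 0 \<le> a \<longrightarrow> 0 \<le> b \<longrightarrow> vol p (dilate a A + dilate b B)
       = (\<Sum>k\<le>DIM('a) * p. c k * a ^ k * b ^ (DIM('a) * p - k)))"
proof -
  let ?N = "DIM('a) * p"
  obtain z where z: "z \<in> interior K" using K by auto
  obtain c where c: "\<And>k. c k \<le> real (?N choose k) * vol p (A \<or>\<^sub>c B)"
    "\<And>a b. 0 < a \<Longrightarrow> 0 < b \<Longrightarrow> vol p (dilate a A + dilate b B) = (\<Sum>k\<le>?N. c k * a ^ k * b ^ (?N - k))"
    using vol_body_expansion_pos[OF K(1,2) z, of p s r] unfolding A_def B_def by blast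
  have "diag p (0::'a) = 0" by (auto simp: diag_def fun_eq_iff)
  then have "0 \<in> diag p ` K" using K(4) by (metis imageI)
  then have A0: "0 \<in> A" unfolding A_def dilate_iff by (intro bexI[of _ 0]) auto
  have A: "compact A" "convex A" "A \<subseteq> pow_space p"
    unfolding A_def
    by (intro compact_dilate_fun compact_diag convex_dilate convex_diag dilate_subset_pow_space diag_subset K)+
  have "0 \<in> cart_power p K" using K(4) by (auto simp: cart_power_def)
  then have B0: "0 \<in> B" unfolding B_def dilate_iff by (intro bexI[of _ 0]) auto
  have B: "compact B" "convex B" "B \<subseteq> pow_space p"
    unfolding B_def
    by (intro compact_dilate_fun compact_cart_power convex_dilate convex_cart_power dilate_subset_pow_space cart_power_subset K)+
  show ?thesis
  proof (intro exI[of _ c] conjI allI impI c(1))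
    fix a b :: real assume ab: "0 \<le> a" "0 \<le> b"
    let ?a = "\<lambda>m. a + inverse (real (Suc m))" and ?b = "\<lambda>m. b + inverse (real (Suc m))"
    have "(\<lambda>m. vol p (dilate (?a m) A + dilate (?b m) B)) \<longlonglongrightarrow> vol p (dilate a A + dilate b B)"
      by (rule vol_sum_tendsto[OF A(1,2) A0 A(3) B(1,2) B0 B(3) ab])
    moreover have "vol p (dilate (?a m) A + dilate (?b m) B) = (\<Sum>k\<le>?N. c k * ?a m ^ k * ?b m ^ (?N - k))" for m
      using ab by (intro c(2)) (auto intro: add_nonneg_pos)
    moreover have "(\<lambda>m. \<Sum>k\<le>?N. c k * ?a m ^ k * ?b m ^ (?N - k)) \<longlonglongrightarrow> (\<Sum>k\<le>?N. c k * (a + 0) ^ k * (b + 0) ^ (?N - k))"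
      by (intro tendsto_sum tendsto_mult tendsto_power tendsto_add tendsto_const LIMSEQ_inverse_real_of_nat)
    ultimately show "vol p (dilate a A + dilate b B) = (\<Sum>k\<le>?N. c k * a ^ k * b ^ (?N - k))"
      using LIMSEQ_unique by fastforce
  qed
qed

section \<open>Mixed volumes of two bodies\<close>

text \<open>The falling factorial n (n - 1) ... (n - m + 1), the factor in the m-th derivative of
  the n-th power. As a product of reals it vanishes for m > n, so the derivative formula survives
  the truncated exponent n - m.\<close>

definition falling :: "nat \<Rightarrow> nat \<Rightarrow> real"
  where "falling n m = (\<Prod>i<m. real n - real i)"

lemma falling_eq_0: "n < m \<Longrightarrow> falling n m = 0"
  unfolding falling_def by (rule prod_zero) auto

lemma falling_self: "falling n n = fact n"
proof -
  have "falling n n = (\<Prod>i<n. real (Suc i))"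
    unfolding falling_def by (rule prod.reindex_bij_witness[of _ "\<lambda>i. n - Suc i" "\<lambda>i. n - Suc i"]) auto
  also have "\<dots> = fact n" by (simp only: fact_prod_Suc atLeast0LessThan of_nat_prod)
  finally show ?thesis .
qed

lemma falling_power_derivative:
  "((\<lambda>x. falling n m * x ^ (n - m)) has_real_derivative falling n (Suc m) * x ^ (n - Suc m)) (at x within S)"
proof (cases "m \<le> n")
  case True
  have "((\<lambda>x. falling n m * x ^ (n - m)) has_real_derivative falling n m * (real (n - m) * x ^ (n - m - 1))) (at x within S)"
    by (auto intro!: derivative_eq_intros)
  moreover have "falling n m * (real (n - m) * x ^ (n - m - 1)) = falling n (Suc m) * x ^ (n - Suc m)"
    using True by (simp add: falling_def of_nat_diff)
  ultimately show ?thesis by (simp only:)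
next
  case False
  then show ?thesis by (simp add: falling_eq_0)
qed

text \<open>The derivative within \<open>{0..}\<close> is unique even at \<open>t i = 0\<close>,
  because this filter lies above the nontrivial right-hand filter at \<open>t i\<close>. Only the
  values at nonnegative s have to be known.\<close>

lemma orthant_partial_eq:
  assumes "0 \<le> t i" and "\<And>s. 0 \<le> s \<Longrightarrow> f (t(i := s)) = g s"
    and "(g has_real_derivative D) (at (t i) within {0..})"
  shows "orthant_partial i f t = D"
proof -
  have "at (t i) within {t i<..} \<le> at (t i) within {0..}"
    using assms(1) by (intro at_le) auto
  then have nb: "at (t i) within {0..} \<noteq> bot"
    using trivial_limit_at_right_real[of "t i"] by (auto simp: bot_unique)
  have "((\<lambda>s. f (t(i := s))) has_vector_derivative D) (at (t i) within {0..})"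
    using assms by (intro has_vector_derivative_transform[OF _ _ assms(3)[unfolded has_real_derivative_iff_has_vector_derivative]]) auto
  then show ?thesis
    unfolding orthant_partial_def by (rule vector_derivative_within[OF nb])
qed

text \<open>Backward induction, since \<open>foldr\<close> differentiates in the variables N - 1
  down to m. At that stage \<open>j - m\<close> variables of the first group and
  \<open>N - max j m\<close> of the second have been used, truncated subtraction covering m beyond
  j. Each step acts on the power of one group sum only.\<close>

lemma foldr_orthant_partial:
  fixes f :: "(nat \<Rightarrow> real) \<Rightarrow> real" and j N m :: nat
  defines "a \<equiv> \<lambda>t. \<Sum>i<j. t i" and "b \<equiv> \<lambda>t. \<Sum>i=j..<N. t i"
  assumes f: "\<And>t. (\<And>i. 0 \<le> t i) \<Longrightarrow> f t = (\<Sum>k\<le>N. c k * a t ^ k * b t ^ (N - k))"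
    and j: "j \<le> N" and m: "m \<le> N" and t: "\<And>i. 0 \<le> t i"
  shows "foldr orthant_partial [m..<N] f t =
    (\<Sum>k\<le>N. c k * (falling k (j - m) * a t ^ (k - (j - m)))
       * (falling (N - k) (N - max j m) * b t ^ (N - k - (N - max j m))))"
  using m t
proof (induction m arbitrary: t rule: inc_induct)
  case base
  then show ?case using f[of t] j by (simp add: falling_def max_def)
next
  case (step m)
  have upd: "0 \<le> (t(m := s)) i" if "0 \<le> s" for s i using step.prems that by auto
  let ?F = "foldr orthant_partial [Suc m..<N] f"
  let ?A = "\<lambda>k x. falling k (j - Suc m) * x ^ (k - (j - Suc m))"
  let ?B = "\<lambda>k x. falling (N - k) (N - max j (Suc m)) * x ^ (N - k - (N - max j (Suc m)))"
  have F: "?F (t(m := s)) = (\<Sum>k\<le>N. c k * ?A k (a (t(m := s))) * ?B k (b (t(m := s))))" if "0 \<le> s" for s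
    by (rule step.IH) (use upd that in auto)
  have "foldr orthant_partial [m..<N] f t = orthant_partial m ?F t"
    using step.hyps by (simp add: upt_conv_Cons)
  also have "\<dots> = (\<Sum>k\<le>N. c k * (falling k (j - m) * a t ^ (k - (j - m)))
       * (falling (N - k) (N - max j m) * b t ^ (N - k - (N - max j m))))"
  proof (cases "m < j")
    case True
    have as: "a (t(m := s)) = s + (\<Sum>i\<in>{..<j} - {m}. t i)" for s
    proof -
      have "a (t(m := s)) = s + (\<Sum>i\<in>{..<j} - {m}. (t(m := s)) i)"
        unfolding a_def using True by (subst sum.remove[of _ m]) auto
      also have "(\<Sum>i\<in>{..<j} - {m}. (t(m := s)) i) = (\<Sum>i\<in>{..<j} - {m}. t i)" by (intro sum.cong) auto
      finally show ?thesis .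
    qed
    have bs: "b (t(m := s)) = b t" for s unfolding b_def using True by (intro sum.cong) auto
    have at: "a t = t m + (\<Sum>i\<in>{..<j} - {m}. t i)" using as[of "t m"] by simp
    have eqs: "Suc (j - Suc m) = j - m" "max j (Suc m) = j" "max j m = j" using True by auto
    show ?thesis
    proof (rule orthant_partial_eq)
      show "0 \<le> t m" by (rule step.prems)
      show "?F (t(m := s)) = (\<Sum>k\<le>N. c k * ?A k (s + (\<Sum>i\<in>{..<j} - {m}. t i)) * ?B k (b t))" if "0 \<le> s" for s
        using F[OF that] unfolding as bs .
      have "((\<lambda>s. ?A k (s + (\<Sum>i\<in>{..<j} - {m}. t i))) has_real_derivative falling k (j - m) * a t ^ (k - (j - m))) (at (t m) within {0..})" for k
        using falling_power_derivative[of k "j - Suc m" "a t" UNIV] unfolding eqs at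
        by (intro DERIV_subset[OF DERIV_shift[THEN iffD1]]) auto
      then show "((\<lambda>s. \<Sum>k\<le>N. c k * ?A k (s + (\<Sum>i\<in>{..<j} - {m}. t i)) * ?B k (b t)) has_real_derivative
          (\<Sum>k\<le>N. c k * (falling k (j - m) * a t ^ (k - (j - m))) * (falling (N - k) (N - max j m) * b t ^ (N - k - (N - max j m))))) (at (t m) within {0..})"
        unfolding eqs by (intro DERIV_sum DERIV_cmult_right DERIV_cmult)
    qed
  next
    case False
    have bs: "b (t(m := s)) = s + (\<Sum>i\<in>{j..<N} - {m}. t i)" for s
    proof -
      have "b (t(m := s)) = s + (\<Sum>i\<in>{j..<N} - {m}. (t(m := s)) i)"
        unfolding b_def using False step.hyps by (subst sum.remove[of _ m]) auto
      also have "(\<Sum>i\<in>{j..<N} - {m}. (t(m := s)) i) = (\<Sum>i\<in>{j..<N} - {m}. t i)" by (intro sum.cong) auto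
      finally show ?thesis .
    qed
    have as: "a (t(m := s)) = a t" for s unfolding a_def using False by (intro sum.cong) auto
    have bt: "b t = t m + (\<Sum>i\<in>{j..<N} - {m}. t i)" using bs[of "t m"] by simp
    have eqs: "j - Suc m = 0" "j - m = 0" "N - max j m = Suc (N - max j (Suc m))" using False step.hyps by auto
    show ?thesis
    proof (rule orthant_partial_eq)
      show "0 \<le> t m" by (rule step.prems)
      show "?F (t(m := s)) = (\<Sum>k\<le>N. c k * ?A k (a t) * ?B k (s + (\<Sum>i\<in>{j..<N} - {m}. t i)))" if "0 \<le> s" for s
        using F[OF that] unfolding as bs .
      have "((\<lambda>s. ?B k (s + (\<Sum>i\<in>{j..<N} - {m}. t i))) has_real_derivative falling (N - k) (N - max j m) * b t ^ (N - k - (N - max j m))) (at (t m) within {0..})" for k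
        using falling_power_derivative[of "N - k" "N - max j (Suc m)" "b t" UNIV] unfolding eqs bt
        by (intro DERIV_subset[OF DERIV_shift[THEN iffD1]]) auto
      then show "((\<lambda>s. \<Sum>k\<le>N. c k * ?A k (a t) * ?B k (s + (\<Sum>i\<in>{j..<N} - {m}. t i))) has_real_derivative
          (\<Sum>k\<le>N. c k * (falling k (j - m) * a t ^ (k - (j - m))) * (falling (N - k) (N - max j m) * b t ^ (N - k - (N - max j m))))) (at (t m) within {0..})"
        unfolding eqs(1,2) by (intro DERIV_sum DERIV_cmult)
    qed
  qed
  finally show ?case .
qed

lemma sum_dilate:
  assumes "finite I" "convex A" "A \<noteq> {}" "\<And>i. i \<in> I \<Longrightarrow> 0 \<le> t i"
  shows "(\<Sum>i\<in>I. dilate (t i) A) = dilate (\<Sum>i\<in>I. t i) A"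
  using assms
proof (induction I rule: finite_induct)
  case empty
  then show ?case by (auto simp: dilate_def set_zero)
next
  case (insert i I)
  then show ?case by (simp add: dilate_plus_same sum_nonneg)
qed

text \<open>At the origin only the term k = j survives: one falling factorial kills k < j, the other
  kills k > j. The remaining factor j! (N - j)! over N! is the inverse binomial coefficient.\<close>

lemma mixed_volume_two_bodies:
  fixes A B :: "(nat \<Rightarrow> 'a::euclidean_space) set"
  assumes A: "convex A" "A \<noteq> {}" and B: "convex B" "B \<noteq> {}" and j: "j \<le> N"
    and exp: "\<And>a b. 0 \<le> a \<Longrightarrow> 0 \<le> b \<Longrightarrow> vol p (dilate a A + dilate b B) = (\<Sum>k\<le>N. c k * a ^ k * b ^ (N - k))"
  shows "mixed_volume p (replicate j A @ replicate (N - j) B) = c j / real (N choose j)"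
proof -
  let ?Ks = "replicate j A @ replicate (N - j) B"
  have len: "length ?Ks = N" using j by simp
  let ?f = "\<lambda>t. vol p (\<Sum>i<N. dilate (t i) (?Ks ! i))"
  have f: "?f t = (\<Sum>k\<le>N. c k * (\<Sum>i<j. t i) ^ k * (\<Sum>i=j..<N. t i) ^ (N - k))" if t: "\<And>i. 0 \<le> t i" for t
  proof -
    have "(\<Sum>i<N. dilate (t i) (?Ks ! i)) = (\<Sum>i\<in>{..<j} \<union> {j..<N}. dilate (t i) (?Ks ! i))"
      using j by (intro sum.cong) auto
    also have "\<dots> = (\<Sum>i<j. dilate (t i) (?Ks ! i)) + (\<Sum>i=j..<N. dilate (t i) (?Ks ! i))"
      by (intro sum.union_disjoint) auto
    also have "(\<Sum>i<j. dilate (t i) (?Ks ! i)) = (\<Sum>i<j. dilate (t i) A)"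
      by (intro sum.cong) (auto simp: nth_append)
    also have "(\<Sum>i=j..<N. dilate (t i) (?Ks ! i)) = (\<Sum>i=j..<N. dilate (t i) B)"
      by (intro sum.cong) (auto simp: nth_append)
    finally have "(\<Sum>i<N. dilate (t i) (?Ks ! i)) = dilate (\<Sum>i<j. t i) A + dilate (\<Sum>i=j..<N. t i) B"
      using A B t by (simp add: sum_dilate)
    then show ?thesis using t by (simp add: exp sum_nonneg)
  qed
  have "foldr orthant_partial [0..<N] ?f (\<lambda>_. 0) =
    (\<Sum>k\<le>N. c k * (falling k j * 0 ^ (k - j)) * (falling (N - k) (N - j) * 0 ^ (N - k - (N - j))))"
    using foldr_orthant_partial[OF f j, of 0 "\<lambda>_. 0"] by simp
  also have "\<dots> = (\<Sum>k\<le>N. if k = j then c j * fact j * fact (N - j) else 0)"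
  proof (intro sum.cong refl)
    fix k assume "k \<in> {..N}"
    then show "c k * (falling k j * 0 ^ (k - j)) * (falling (N - k) (N - j) * 0 ^ (N - k - (N - j))) = (if k = j then c j * fact j * fact (N - j) else 0)"
      using j falling_eq_0[of k j] falling_eq_0[of "N - k" "N - j"]
      by (cases k j rule: linorder_cases) (auto simp: falling_self)
  qed
  also have "\<dots> = c j * fact j * fact (N - j)" using j by simp
  finally have "mixed_volume p ?Ks = c j * fact j * fact (N - j) / fact N"
    unfolding mixed_volume_def Let_def len by simp
  also have "\<dots> = c j / real (N choose j)"
    using j by (simp add: binomial_fact field_simps)
  finally show ?thesis .
qed

section \<open>The join of dilates of a simplex\<close>

locale simplex_vertices =
  fixes C :: "'a::euclidean_space set"
  assumes indep: "\<not> affine_dependent C" and card: "card C = DIM('a) + 1" and sum_0: "\<Sum>C = 0"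
begin

lemma finite_vertices: "finite C"
  using card by (metis add_is_0 card.infinite one_neq_zero)

lemma coeff_constant:
  assumes "(\<Sum>v\<in>C. c v *\<^sub>R v) = 0" "(\<Sum>v\<in>C. c v) = 0" "v \<in> C"
  shows "c v = 0"
  using indep assms affine_dependent_explicit_finite[OF finite_vertices] by blast

lemma ex_coord: "\<exists>c. (\<Sum>v\<in>C. c v) = 0 \<and> (\<Sum>v\<in>C. c v *\<^sub>R v) = z"
proof -
  have "z \<in> affine hull C"
    using affine_independent_span_eq[OF indep] card by auto
  then obtain u where u: "(\<Sum>v\<in>C. u v) = 1" "(\<Sum>v\<in>C. u v *\<^sub>R v) = z"
    by (auto simp: affine_hull_finite[OF finite_vertices])
  have "(\<Sum>v\<in>C. u v - 1 / real (DIM('a) + 1)) = 0" using u(1) card by (simp add: sum_subtractf)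
  moreover have "(\<Sum>v\<in>C. (u v - 1 / real (DIM('a) + 1)) *\<^sub>R v) = z"
    using u(2) sum_0 by (simp add: scaleR_diff_left sum_subtractf flip: scaleR_sum_right)
  ultimately show ?thesis by (intro exI[of _ "\<lambda>v. u v - 1 / real (DIM('a) + 1)"]) auto
qed

text \<open>The barycentric coordinates with respect to \<open>C\<close>, shifted so that they sum to \<open>0\<close> and are linear.\<close>

definition coord :: "'a \<Rightarrow> 'a \<Rightarrow> real"
  where "coord z = (SOME c. (\<Sum>v\<in>C. c v) = 0 \<and> (\<Sum>v\<in>C. c v *\<^sub>R v) = z)"

lemma coord: "(\<Sum>v\<in>C. coord z v) = 0" "(\<Sum>v\<in>C. coord z v *\<^sub>R v) = z"
  using someI_ex[OF ex_coord[of z]] by (auto simp: coord_def)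

lemma coord_eqI:
  assumes "(\<Sum>v\<in>C. c v) = 0" "(\<Sum>v\<in>C. c v *\<^sub>R v) = z" "v \<in> C"
  shows "coord z v = c v"
  using coeff_constant[of "\<lambda>v. coord z v - c v" v] coord[of z] assms
  by (simp add: scaleR_diff_left sum_subtractf)

text \<open>Because the vertices sum to 0, a constant may be subtracted from all coefficients;
  subtracting their mean normalizes any representation of z.\<close>

lemma coord_shift:
  assumes "(\<Sum>v\<in>C. c v *\<^sub>R v) = z" "v \<in> C"
  shows "coord z v = c v - (\<Sum>v\<in>C. c v) / real (DIM('a) + 1)"
proof (rule coord_eqI[OF _ _ assms(2)])
  show "(\<Sum>v\<in>C. c v - (\<Sum>v\<in>C. c v) / real (DIM('a) + 1)) = 0" using card by (simp add: sum_subtractf)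
  show "(\<Sum>v\<in>C. (c v - (\<Sum>v\<in>C. c v) / real (DIM('a) + 1)) *\<^sub>R v) = z"
    using assms(1) sum_0 by (simp add: scaleR_diff_left sum_subtractf flip: scaleR_sum_right)
qed

lemma coord_add: "v \<in> C \<Longrightarrow> coord (x + y) v = coord x v + coord y v"
  by (rule coord_eqI) (simp_all add: sum.distrib scaleR_add_left coord)

lemma coord_scale: "v \<in> C \<Longrightarrow> coord (r *\<^sub>R x) v = r * coord x v"
  by (rule coord_eqI) (simp_all add: coord flip: sum_distrib_left scaleR_scaleR scaleR_sum_right)

lemma linear_coord: "v \<in> C \<Longrightarrow> linear (\<lambda>z. coord z v)"
  by (rule linearI) (simp_all add: coord_add coord_scale)

lemma coord_borel: "v \<in> C \<Longrightarrow> (\<lambda>z. coord z v) \<in> borel_measurable borel"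
  by (intro borel_measurable_continuous_onI linear_continuous_on linear_conv_bounded_linear[THEN iffD1] linear_coord)

abbreviation S :: "'a set" where "S \<equiv> convex hull C"

text \<open>For d > 0 the barycentric coordinates of z / d are
  \<open>coord z v / d + 1 / (n + 1)\<close>, and membership means that they are nonnegative. For d
  = 0 the coordinates are nonnegative with sum 0, so z = 0.\<close>

lemma dilate_S_iff:
  assumes "0 \<le> d"
  shows "z \<in> dilate d S \<longleftrightarrow> (\<forall>v\<in>C. - d / real (DIM('a) + 1) \<le> coord z v)"
proof
  assume "z \<in> dilate d S"
  then obtain u where u: "\<forall>v\<in>C. 0 \<le> u v" "(\<Sum>v\<in>C. u v) = 1" "z = d *\<^sub>R (\<Sum>v\<in>C. u v *\<^sub>R v)"
    by (auto simp: dilate_def convex_hull_finite[OF finite_vertices])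
  show "\<forall>v\<in>C. - d / real (DIM('a) + 1) \<le> coord z v"
  proof
    fix v assume v: "v \<in> C"
    have "coord z v = d * u v - (\<Sum>v\<in>C. d * u v) / real (DIM('a) + 1)"
      using v u(3) by (intro coord_shift) (auto simp: scaleR_sum_right)
    then show "- d / real (DIM('a) + 1) \<le> coord z v"
      using u v assms by (simp flip: sum_distrib_left)
  qed
next
  assume *: "\<forall>v\<in>C. - d / real (DIM('a) + 1) \<le> coord z v"
  show "z \<in> dilate d S"
  proof (cases "d = 0")
    case True
    then have "\<forall>v\<in>C. coord z v = 0"
      using * coord(1)[of z] finite_vertices by (subst (asm) sum_nonneg_eq_0_iff) auto
    then have "z = 0" using coord(2)[of z] by (metis (no_types, lifting) scaleR_zero_left sum.neutral)
    moreover obtain x where "x \<in> S" using card by (metis add_is_0 card.empty ex_in_conv convex_hull_eq_empty one_neq_zero)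
    ultimately show ?thesis using True by (auto simp: dilate_def intro: image_eqI[of _ _ x])
  next
    case False
    define u where "u v = coord z v / d + 1 / real (DIM('a) + 1)" for v
    have "\<forall>v\<in>C. 0 \<le> u v"
    proof
      fix v assume "v \<in> C"
      then have "- d / real (DIM('a) + 1) / d \<le> coord z v / d" using * assms by (intro divide_right_mono) auto
      then show "0 \<le> u v" using False by (simp add: u_def)
    qed
    moreover have "(\<Sum>v\<in>C. u v) = 1"
      using card coord(1)[of z] by (simp add: u_def sum.distrib flip: sum_divide_distrib)
    moreover have "z = d *\<^sub>R (\<Sum>v\<in>C. u v *\<^sub>R v)"
    proof -
      have "(\<Sum>v\<in>C. u v *\<^sub>R v) = (\<Sum>v\<in>C. (1 / d) *\<^sub>R (coord z v *\<^sub>R v)) + (\<Sum>v\<in>C. (1 / real (DIM('a) + 1)) *\<^sub>R v)"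
        by (simp add: u_def scaleR_add_left sum.distrib)
      also have "\<dots> = (1 / d) *\<^sub>R z"
        by (simp only: scaleR_sum_right[symmetric] sum_0 coord(2) scaleR_zero_right add_0_right)
      finally show ?thesis using False by simp
    qed
    ultimately show ?thesis by (auto simp: dilate_def convex_hull_finite[OF finite_vertices])
  qed
qed

lemma S_iff: "z \<in> S \<longleftrightarrow> (\<forall>v\<in>C. - 1 / real (DIM('a) + 1) \<le> coord z v)"
  using dilate_S_iff[of 1 z] by (simp add: dilate_def)

lemma compact_S: "compact S"
  by (intro finite_imp_compact_convex_hull finite_vertices)

text \<open>The hull of 0 and the vertices other than v0. These n + 1 simplices subdivide S from its
  centroid.\<close>

definition piece :: "'a \<Rightarrow> 'a set"
  where "piece v0 = {z \<in> S. \<forall>v\<in>C. coord z v0 \<le> coord z v}"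

definition unit_coeffs :: "'a \<Rightarrow> ('a \<Rightarrow> real) set"
  where "unit_coeffs v0 = {y \<in> space (Pi\<^sub>M (C - {v0}) (\<lambda>_. lborel)). (\<forall>v\<in>C - {v0}. 0 \<le> y v) \<and> (\<Sum>v\<in>C - {v0}. y v) \<le> 1}"

text \<open>The image of \<open>piece v0\<close> under the map that is diagonal in the basis
  \<open>C - {v0}\<close>, with factors -t on J and 1 - t elsewhere. The ratio of the volumes can be
  read off directly.\<close>

definition cell :: "real \<Rightarrow> 'a \<Rightarrow> 'a set \<Rightarrow> 'a set"
  where "cell t v0 J = {\<Sum>v\<in>C - {v0}. ((if v \<in> J then - t else 1 - t) * y v) *\<^sub>R v |y.
    (\<forall>v\<in>C - {v0}. 0 \<le> y v) \<and> (\<Sum>v\<in>C - {v0}. y v) \<le> 1}"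

lemma piece_eq: "v0 \<in> C \<Longrightarrow> piece v0 = (\<lambda>y. \<Sum>v\<in>C - {v0}. y v *\<^sub>R v) ` unit_coeffs v0"
proof (intro equalityI subsetI)
  fix z assume v0: "v0 \<in> C" and z: "z \<in> piece v0"
  define y where "y = (\<lambda>v\<in>C - {v0}. coord z v - coord z v0)"
  have "(\<Sum>v\<in>C - {v0}. y v) = (\<Sum>v\<in>C - {v0}. coord z v - coord z v0)"
    by (simp add: y_def)
  also have "\<dots> = (\<Sum>v\<in>C. coord z v - coord z v0)"
    using v0 finite_vertices by (simp add: sum.remove[of C v0])
  also have "\<dots> = - real (DIM('a) + 1) * coord z v0" using coord(1)[of z] card by (simp add: sum_subtractf algebra_simps)
  also have "\<dots> \<le> 1" using z v0 by (auto simp: piece_def S_iff field_simps)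
  finally have "y \<in> unit_coeffs v0" using z by (auto simp: unit_coeffs_def y_def piece_def space_PiM)
  moreover have "z = (\<Sum>v\<in>C - {v0}. y v *\<^sub>R v)"
  proof -
    have "(\<Sum>v\<in>C - {v0}. y v *\<^sub>R v) = (\<Sum>v\<in>C - {v0}. (coord z v - coord z v0) *\<^sub>R v)"
      by (simp add: y_def)
    also have "\<dots> = (\<Sum>v\<in>C. (coord z v - coord z v0) *\<^sub>R v)"
      using v0 finite_vertices by (simp add: sum.remove[of C v0])
    also have "\<dots> = z" using coord(2)[of z] sum_0 by (simp add: scaleR_diff_left sum_subtractf flip: scaleR_sum_right)
    finally show ?thesis by simp
  qed
  ultimately show "z \<in> (\<lambda>y. \<Sum>v\<in>C - {v0}. y v *\<^sub>R v) ` unit_coeffs v0" by blast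
next
  fix z assume v0: "v0 \<in> C" and "z \<in> (\<lambda>y. \<Sum>v\<in>C - {v0}. y v *\<^sub>R v) ` unit_coeffs v0"
  then obtain y where y: "y \<in> unit_coeffs v0" "z = (\<Sum>v\<in>C - {v0}. y v *\<^sub>R v)" by blast
  define c where "c v = (if v = v0 then 0 else y v)" for v
  have sc: "(\<Sum>v\<in>C. c v) = (\<Sum>v\<in>C - {v0}. y v)"
    using v0 finite_vertices by (simp add: sum.remove[of C v0] c_def)
  have "(\<Sum>v\<in>C. c v *\<^sub>R v) = z"
    using v0 finite_vertices y(2) by (simp add: sum.remove[of C v0] c_def)
  note co = coord_shift[OF this, unfolded sc]
  have le: "(\<Sum>v\<in>C - {v0}. y v) / real (DIM('a) + 1) \<le> 1 / real (DIM('a) + 1)" using y(1) by (intro divide_right_mono) (auto simp: unit_coeffs_def)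
  have c0: "0 \<le> c v" if "v \<in> C" for v using that y(1) by (auto simp: c_def unit_coeffs_def)
  have "c v0 = 0" by (simp add: c_def)
  then have "- 1 / real (DIM('a) + 1) \<le> coord z v" "coord z v0 \<le> coord z v" if "v \<in> C" for v
    using co[OF that] co[OF v0] c0[OF that] le by linarith+
  then show "z \<in> piece v0" by (auto simp: piece_def S_iff)
qed

lemma basis_coords:
  assumes v0: "v0 \<in> C"
  shows "\<And>z. \<exists>y. (\<Sum>v\<in>C - {v0}. y v *\<^sub>R v) = z"
    and "\<And>y v. (\<Sum>v\<in>C - {v0}. y v *\<^sub>R v) = 0 \<Longrightarrow> v \<in> C - {v0} \<Longrightarrow> y v = 0"
proof -
  fix z
  have "(\<Sum>v\<in>C - {v0}. (coord z v - coord z v0) *\<^sub>R v) = (\<Sum>v\<in>C. (coord z v - coord z v0) *\<^sub>R v)"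
    using v0 finite_vertices by (simp add: sum.remove[of C v0])
  also have "\<dots> = z" using coord(2)[of z] sum_0 by (simp add: scaleR_diff_left sum_subtractf flip: scaleR_sum_right)
  finally show "\<exists>y. (\<Sum>v\<in>C - {v0}. y v *\<^sub>R v) = z"
    by (rule exI[of _ "\<lambda>v. coord z v - coord z v0"])
next
  fix y v assume y: "(\<Sum>v\<in>C - {v0}. y v *\<^sub>R v) = 0" and v: "v \<in> C - {v0}"
  define c where "c v = (if v = v0 then 0 else y v)" for v
  have c: "(\<Sum>v\<in>C. c v *\<^sub>R v) = 0"
    using v0 finite_vertices y by (simp add: sum.remove[of C v0] c_def)
  have z: "coord 0 w = 0" if "w \<in> C" for w using that by (intro coord_eqI) auto
  have "v \<in> C" using v by simp
  then have "c v0 = c v"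
    using coord_shift[OF c v0] coord_shift[OF c, of v] z[OF v0] z[of v] by linarith
  then show "y v = 0" using v by (simp add: c_def)
qed

lemma unit_coeffs_sets: "unit_coeffs v0 \<in> sets (Pi\<^sub>M (C - {v0}) (\<lambda>_. lborel))"
proof -
  have comp: "(\<lambda>y. y x) \<in> borel_measurable (Pi\<^sub>M (C - {v0}) (\<lambda>_. lborel :: real measure))" if "x \<in> C - {v0}" for x
  proof -
    have "(\<lambda>y. y x) \<in> measurable (Pi\<^sub>M (C - {v0}) (\<lambda>_. lborel :: real measure)) lborel"
      using that by (rule measurable_component_singleton)
    then show ?thesis by simp
  qed
  show ?thesis
    unfolding unit_coeffs_def
    by (intro sets.sets_Collect_conj sets.sets_Collect_finite_All borel_measurable_le borel_measurable_const
          borel_measurable_sum comp finite_Diff finite_vertices)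
qed

lemma cell_measure:
  assumes v0: "v0 \<in> C" and J: "J \<subseteq> C - {v0}" and t: "0 < t" "t < 1"
  shows "cell t v0 J \<in> sets borel" "piece v0 \<in> sets borel"
    and "emeasure lborel (cell t v0 J) = ennreal (t ^ card J * (1 - t) ^ (DIM('a) - card J)) * emeasure lborel (piece v0)"
proof -
  let ?I = "C - {v0}" and ?\<Phi> = "\<lambda>y. \<Sum>v\<in>C - {v0}. y v *\<^sub>R v"
  let ?r = "\<lambda>v. if v \<in> J then - t else 1 - t"
  let ?sc = "\<lambda>y. \<lambda>v\<in>?I. ?r v *\<^sub>R (y v :: real)"
  have fI: "finite ?I" using finite_vertices by simp
  obtain c where c: "\<And>X. X \<in> sets (Pi\<^sub>M ?I (\<lambda>_. lborel)) \<Longrightarrow> ?\<Phi> ` X \<in> sets borel"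
    "\<And>X. X \<in> sets (Pi\<^sub>M ?I (\<lambda>_. lborel)) \<Longrightarrow> emeasure lborel (?\<Phi> ` X) = c * emeasure (Pi\<^sub>M ?I (\<lambda>_. lborel)) X"
  proof (rule lborel_coordinates[of ?I "\<lambda>v. v"])
    show "\<exists>y. ?\<Phi> y = z" for z by (rule basis_coords(1)[OF v0])
    show "y v = 0" if "?\<Phi> y = 0" "v \<in> ?I" for y v using that by (rule basis_coords(2)[OF v0])
  qed (use fI in blast)+
  have r0: "?r v \<noteq> 0" for v using t by auto
  note sc = PiM_lborel_scale[of ?I ?r "unit_coeffs v0", OF fI r0 unit_coeffs_sets]
  have cell: "cell t v0 J = ?\<Phi> ` ?sc ` unit_coeffs v0"
  proof (intro equalityI subsetI)
    fix z assume "z \<in> cell t v0 J"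
    then obtain y where y: "z = (\<Sum>v\<in>?I. (?r v * y v) *\<^sub>R v)" "\<forall>v\<in>?I. 0 \<le> y v" "(\<Sum>v\<in>?I. y v) \<le> 1"
      unfolding cell_def by blast
    have "restrict y ?I \<in> unit_coeffs v0" using y by (auto simp: unit_coeffs_def space_PiM)
    moreover have "z = ?\<Phi> (?sc (restrict y ?I))" unfolding y(1) by (intro sum.cong) auto
    ultimately show "z \<in> ?\<Phi> ` ?sc ` unit_coeffs v0" by blast
  next
    fix z assume "z \<in> ?\<Phi> ` ?sc ` unit_coeffs v0"
    then obtain y where y: "y \<in> unit_coeffs v0" "z = ?\<Phi> (?sc y)" by blast
    have "z = (\<Sum>v\<in>?I. (?r v * y v) *\<^sub>R v)" unfolding y(2) by (intro sum.cong) auto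
    then show "z \<in> cell t v0 J" using y(1) unfolding cell_def unit_coeffs_def by blast
  qed
  show "cell t v0 J \<in> sets borel" unfolding cell by (rule c(1)[OF sc(2)])
  show "piece v0 \<in> sets borel" unfolding piece_eq[OF v0] by (rule c(1)[OF unit_coeffs_sets])
  have "(\<Prod>v\<in>?I. ennreal (\<bar>?r v\<bar> ^ DIM(real))) = ennreal (\<Prod>v\<in>?I. if v \<in> J then t else 1 - t)"
    using t by (subst prod_ennreal[symmetric]) (auto intro!: prod.cong split: if_splits)
  also have "(\<Prod>v\<in>?I. if v \<in> J then t else 1 - t) = t ^ card (?I \<inter> J) * (1 - t) ^ card (?I - J)"
    using fI by (simp add: prod.If_cases Diff_eq)
  also have "?I \<inter> J = J" using J by auto
  also have "card (?I - J) = DIM('a) - card J"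
    using J fI v0 card by (subst card_Diff_subset) (auto intro: finite_subset)
  finally have "(\<Prod>v\<in>?I. ennreal (\<bar>?r v\<bar> ^ DIM(real))) = ennreal (t ^ card J * (1 - t) ^ (DIM('a) - card J))" .
  then show "emeasure lborel (cell t v0 J) = ennreal (t ^ card J * (1 - t) ^ (DIM('a) - card J)) * emeasure lborel (piece v0)"
    unfolding cell piece_eq[OF v0] c(2)[OF sc(2)] c(2)[OF unit_coeffs_sets] sc(1) by (simp only: mult_ac)
qed

text \<open>Two pieces share only points whose coordinates at v and w coincide. These form a proper
  subspace, since the difference of the two coordinates equals 1 at v, and so they are
  negligible.\<close>

lemma sum_piece_le: "(\<Sum>v\<in>C. measure lborel (piece v)) \<le> measure lborel S"
proof -
  have b: "piece v \<in> sets borel" if "v \<in> C" for v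
    using cell_measure(2)[OF that, of "{}" "1/2"] by simp
  have Sf: "S \<in> fmeasurable lborel" using compact_S by (rule fmeasurable_compact)
  have pf: "piece v \<in> fmeasurable lborel" if "v \<in> C" for v
    using b[OF that] by (intro fmeasurableI2[OF Sf]) (auto simp: piece_def)
  have "pairwise (\<lambda>v w. AE z in lborel. z \<notin> piece v \<or> z \<notin> piece w) C"
  proof (rule pairwiseI)
    fix v w assume vw: "v \<in> C" "w \<in> C" "v \<noteq> w"
    define f where "f z = coord z v - coord z w" for z
    have f: "linear f" unfolding f_def using linear_coord vw by (intro linear_compose_sub) auto
    have "coord v v = 1 - 1 / real (DIM('a) + 1)"
      using coord_shift[of "\<lambda>u. if u = v then 1 else 0" v v] vw finite_vertices by (simp add: if_distrib[of "\<lambda>c. c *\<^sub>R _"] cong: if_cong)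
    moreover have "coord v w = 0 - 1 / real (DIM('a) + 1)"
      using coord_shift[of "\<lambda>u. if u = v then 1 else 0" v w] vw finite_vertices by (simp add: if_distrib[of "\<lambda>c. c *\<^sub>R _"] cong: if_cong)
    ultimately have fv: "f v \<noteq> 0" by (simp add: f_def)
    have "subspace {z. f z = 0}" using f by (auto simp: subspace_def linear_0 linear_add linear_scale)
    moreover have "{z. f z = 0} \<noteq> UNIV" using fv by auto
    ultimately have "dim {z. f z = 0} < DIM('a)" by (metis dim_eq_full dim_subset_UNIV le_neq_implies_less span_eq_iff)
    then have "negligible {z. f z = 0}" by (rule negligible_lowdim)
    then have "{z. f z = 0} \<in> null_sets lebesgue" by (simp add: negligible_iff_null_sets)
    moreover have "{z. f z = 0} \<in> sets lborel"
    proof -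
      have "f \<in> borel_measurable borel" unfolding f_def using coord_borel vw by (intro borel_measurable_diff) auto
      then have "f -` {0} \<inter> space borel \<in> sets borel" by (rule measurable_sets) simp
      then show ?thesis by (simp add: vimage_def)
    qed
    ultimately have "{z. f z = 0} \<in> null_sets lborel" by (simp add: null_sets_completion_iff)
    then have "AE z in lborel. z \<notin> {z. f z = 0}" by (rule AE_not_in)
    then show "AE z in lborel. z \<notin> piece v \<or> z \<notin> piece w"
      by eventually_elim (use vw in \<open>force simp: piece_def f_def\<close>)
  qed
  then have "measure lborel (\<Union>v\<in>C. piece v) = (\<Sum>v\<in>C. measure lborel (piece v))"
    using pf by (intro measure_UNION_AE finite_vertices)
  moreover have "measure lborel (\<Union>v\<in>C. piece v) \<le> measure lborel S"
    using b finite_vertices by (intro measure_mono_fmeasurable[OF _ _ Sf]) (auto simp: piece_def)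
  ultimately show ?thesis by simp
qed

text \<open>A point of the join is expressed with coefficients vanishing at \<open>v0\<close>, where \<open>v0\<close> is the coefficient of
  rank \<open>j\<close>: among all translates \<open>c - c v0\<close> it minimizes the cost, the quantile minimizing a pinball loss.\<close>

lemma join_cover:
  assumes t: "0 < t" "t < 1" and j: "real j \<le> real (DIM('a) + 1) * t" "real (DIM('a) + 1) * t \<le> real j + 1" "j \<le> DIM('a)"
    and z: "z \<in> dilate (- t) S \<or>\<^sub>c dilate (1 - t) S"
  shows "\<exists>v0\<in>C. \<exists>J\<subseteq>C - {v0}. card J = j \<and> z \<in> cell t v0 J"
proof -
  have "S \<noteq> {}" using card by (metis add_is_0 card.empty convex_hull_eq_empty one_neq_zero)
  then have "z \<in> (\<lambda>(s, x, y). (1 - s) *\<^sub>R x + s *\<^sub>R y) ` ({0..1} \<times> dilate (- t) S \<times> dilate (1 - t) S)"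
    using z by (subst (asm) join_eq) (simp_all add: convex_dilate, simp_all add: dilate_def)
  then obtain s x y where s: "0 \<le> s" "s \<le> 1" "x \<in> S" "y \<in> S" "z = (1 - s) *\<^sub>R (- t) *\<^sub>R x + s *\<^sub>R (1 - t) *\<^sub>R y"
    by (auto simp: dilate_def)
  from s(3) obtain x' where x': "\<forall>v\<in>C. 0 \<le> x' v" "(\<Sum>v\<in>C. x' v) = 1" "(\<Sum>v\<in>C. x' v *\<^sub>R v) = x"
    by (auto simp: convex_hull_finite[OF finite_vertices])
  from s(4) obtain y' where y': "\<forall>v\<in>C. 0 \<le> y' v" "(\<Sum>v\<in>C. y' v) = 1" "(\<Sum>v\<in>C. y' v *\<^sub>R v) = y"
    by (auto simp: convex_hull_finite[OF finite_vertices])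
  \<comment> \<open>Signed coefficients of z over the vertices, the two convex representations
    weighted by -(1 - s) t and s (1 - t). They may still be shifted by a constant, as the vertices
    sum to 0.\<close>
  define c where "c v = s * (1 - t) * y' v - (1 - s) * t * x' v" for v
  have zc: "z = (\<Sum>v\<in>C. c v *\<^sub>R v)"
  proof -
    have "(\<Sum>v\<in>C. c v *\<^sub>R v) = (s * (1 - t)) *\<^sub>R (\<Sum>v\<in>C. y' v *\<^sub>R v) - ((1 - s) * t) *\<^sub>R (\<Sum>v\<in>C. x' v *\<^sub>R v)"
      by (simp add: c_def scaleR_diff_left sum_subtractf scaleR_sum_right)
    then show ?thesis using x' y' s(5) by simp
  qed
  \<comment> \<open>J takes j smallest coefficients, ties broken arbitrarily; v0 will be a smallest
    among the rest.\<close>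
  have "\<exists>J\<subseteq>C. card J = j \<and> (\<forall>v\<in>J. \<forall>w\<in>C - J. c v \<le> c w)"
    using j(3)
  proof (induction j)
    case 0
    then show ?case by (intro exI[of _ "{}"]) auto
  next
    case (Suc j)
    then obtain J where J: "J \<subseteq> C" "card J = j" "\<forall>v\<in>J. \<forall>w\<in>C - J. c v \<le> c w" by auto
    have "C - J \<noteq> {}"
    proof
      assume "C - J = {}"
      then have "J = C" using J by auto
      then show False using J card Suc.prems by simp
    qed
    then obtain u where u: "u \<in> C - J" "\<And>w. w \<in> C - J \<Longrightarrow> c u \<le> c w"
      using ex_is_arg_min_if_finite[of "C - J" c] finite_vertices by (auto simp: is_arg_min_linorder)
    have "card (insert u J) = Suc j" using u J finite_vertices by (subst card_insert_disjoint) (auto intro: finite_subset)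
    then show ?case using J u by (intro exI[of _ "insert u J"]) auto
  qed
  then obtain J where J: "J \<subseteq> C" "card J = j" "\<And>v w. v \<in> J \<Longrightarrow> w \<in> C - J \<Longrightarrow> c v \<le> c w" by blast
  have fJ: "finite J" using J(1) finite_vertices by (rule finite_subset)
  have "C - J \<noteq> {}"
  proof
    assume "C - J = {}"
    then have "J = C" using J by auto
    then show False using J card j(3) by simp
  qed
  then obtain v0 where v0: "v0 \<in> C - J" "\<And>w. w \<in> C - J \<Longrightarrow> c v0 \<le> c w"
    using ex_is_arg_min_if_finite[of "C - J" c] finite_vertices by (auto simp: is_arg_min_linorder)
  define I where "I = C - J - {v0}"
  have CI: "C = insert v0 (J \<union> I)" "J \<inter> I = {}" "v0 \<notin> J \<union> I" "finite I" "C - {v0} = J \<union> I"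
    using v0 J(1) finite_vertices by (auto simp: I_def)
  have cI: "card I = DIM('a) - j"
  proof -
    have "card C = Suc (card (J \<union> I))"
      unfolding CI(1) using CI(3,4) fJ by (subst card_insert_disjoint) auto
    also have "card (J \<union> I) = card J + card I" using CI fJ by (intro card_Un_disjoint) auto
    finally show ?thesis using card J(2) by simp
  qed
  \<comment> \<open>A subgradient of the pinball loss at the quantile: slope -(1 - t) below, t
    above, and at v0 the value that makes the slopes sum to 0. The two bounds on (n + 1) t say
    exactly that this value lies between -(1 - t) and t.\<close>
  define g where "g v = (if v \<in> J then - (1 - t) else if v \<in> I then t else j - DIM('a) * t)" for v
  have sumC: "(\<Sum>v\<in>C. f v) = f v0 + ((\<Sum>v\<in>J. f v) + (\<Sum>v\<in>I. f v))" for f :: "'a \<Rightarrow> real"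
    unfolding CI(1) using CI(2-4) fJ by (simp add: sum.union_disjoint)
  have gI: "g v = t" if "v \<in> I" for v using that CI(2) by (auto simp: g_def)
  have sg: "(\<Sum>v\<in>C. g v) = 0"
  proof -
    have "(\<Sum>v\<in>J. g v) = (\<Sum>v\<in>J. - (1 - t))" by (intro sum.cong) (auto simp: g_def)
    moreover have "(\<Sum>v\<in>I. g v) = (\<Sum>v\<in>I. t)" by (intro sum.cong) (auto simp: gI)
    moreover have "g v0 = j - DIM('a) * t" using CI(3) by (simp add: g_def)
    ultimately show ?thesis unfolding sumC using j(3) by (simp add: cI J(2) of_nat_diff algebra_simps)
  qed
  have gle: "- (1 - t) \<le> g v" "g v \<le> t" if "v \<in> C" for v
    using t j by (auto simp: g_def algebra_simps)
  define y where "y v = (if v \<in> J then (c v0 - c v) / t else (c v - c v0) / (1 - t))" for v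
  have y0: "0 \<le> y v" if "v \<in> C - {v0}" for v
    using that t v0 J(3)[of v v0] by (auto simp: y_def CI(5) I_def intro!: divide_nonneg_pos)
  \<comment> \<open>Clearing denominators turns both branches of y into
    \<open>g v * (c v - c v0)\<close>; the shift by \<open>c v0\<close> then drops out because g
    sums to 0.\<close>
  have "t * (1 - t) * (\<Sum>v\<in>C - {v0}. y v) = (\<Sum>v\<in>C. g v * (c v - c v0))"
  proof -
    have "t * (1 - t) * (\<Sum>v\<in>C - {v0}. y v) = (\<Sum>v\<in>J. t * (1 - t) * y v) + (\<Sum>v\<in>I. t * (1 - t) * y v)"
      unfolding CI(5) sum_distrib_left using CI fJ by (intro sum.union_disjoint) auto
    also have "(\<Sum>v\<in>J. t * (1 - t) * y v) = (\<Sum>v\<in>J. g v * (c v - c v0))"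
      using t by (intro sum.cong) (auto simp: y_def g_def, simp add: algebra_simps)
    also have "(\<Sum>v\<in>I. t * (1 - t) * y v) = (\<Sum>v\<in>I. g v * (c v - c v0))"
      using t CI(2) by (intro sum.cong) (auto simp: y_def gI)
    finally show ?thesis unfolding sumC by simp
  qed
  also have "\<dots> = (\<Sum>v\<in>C. g v * c v)"
    using sg by (simp add: right_diff_distrib sum_subtractf flip: sum_distrib_right)
  also have "\<dots> = s * (1 - t) * (\<Sum>v\<in>C. g v * y' v) + (1 - s) * t * (\<Sum>v\<in>C. - g v * x' v)"
    by (simp add: c_def sum_distrib_left right_diff_distrib sum_subtractf sum_negf mult_ac)
  \<comment> \<open>Both x' and y' are weights of total mass 1, paired with -g and g, which are at
    most 1 - t and t. The two contributions add up to t (1 - t), whatever s is.\<close>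
  also have "\<dots> \<le> s * (1 - t) * t + (1 - s) * t * (1 - t)"
  proof (intro add_mono mult_left_mono)
    have "(\<Sum>v\<in>C. g v * y' v) \<le> (\<Sum>v\<in>C. t * y' v)"
      using gle y' by (intro sum_mono mult_right_mono) auto
    then show "(\<Sum>v\<in>C. g v * y' v) \<le> t" using y'(2) by (simp flip: sum_distrib_left)
    have "(\<Sum>v\<in>C. - g v * x' v) \<le> (\<Sum>v\<in>C. (1 - t) * x' v)"
    proof (intro sum_mono mult_right_mono)
      show "- g v \<le> 1 - t" if "v \<in> C" for v using gle(1)[OF that] by linarith
    qed (use x' in auto)
    then show "(\<Sum>v\<in>C. - g v * x' v) \<le> 1 - t" using x'(2) by (simp flip: sum_distrib_left)
  qed (use s t in auto)
  also have "\<dots> = t * (1 - t)" by (simp add: algebra_simps)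
  finally have y1: "(\<Sum>v\<in>C - {v0}. y v) \<le> 1"
    using t by (simp add: mult_le_cancel_left2 zero_less_mult_iff mult.assoc)
  have "z = (\<Sum>v\<in>C. (c v - c v0) *\<^sub>R v)"
    unfolding zc using sum_0 by (simp add: scaleR_diff_left sum_subtractf flip: scaleR_sum_right)
  also have "\<dots> = (\<Sum>v\<in>C - {v0}. (c v - c v0) *\<^sub>R v)"
    using v0 finite_vertices by (simp add: sum.remove[of C v0])
  also have "\<dots> = (\<Sum>v\<in>C - {v0}. ((if v \<in> J then - t else 1 - t) * y v) *\<^sub>R v)"
    using t by (intro sum.cong) (auto simp: y_def)
  finally have "z \<in> cell t v0 J" unfolding cell_def using y0 y1 by blast
  moreover have "J \<subseteq> C - {v0}" using J v0 by auto
  ultimately show ?thesis using J(2) v0 by blast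
qed

lemma compact_join: "compact (dilate (- t) S \<or>\<^sub>c dilate (1 - t) S)"
proof -
  have "compact (dilate (- t) S \<union> dilate (1 - t) S)"
    unfolding dilate_def by (intro compact_Un compact_scaling compact_S)
  then show ?thesis unfolding join_def by (rule compact_convex_hull)
qed

text \<open>Each v0 admits \<open>n choose j\<close> sets J, since \<open>C - {v0}\<close> has n
  elements, and their cells all have the same fraction of the volume of \<open>piece v0\<close>.
  Subadditivity over the cover is enough.\<close>

lemma measure_join_le:
  assumes t: "0 < t" "t < 1" and j: "real j \<le> real (DIM('a) + 1) * t" "real (DIM('a) + 1) * t \<le> real j + 1" "j \<le> DIM('a)"
  shows "measure lborel (dilate (- t) S \<or>\<^sub>c dilate (1 - t) S)
    \<le> real (DIM('a) choose j) * t ^ j * (1 - t) ^ (DIM('a) - j) * measure lborel S"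
proof -
  define P where "P v0 = {J. J \<subseteq> C - {v0} \<and> card J = j}" for v0
  define D where "D = (SIGMA v0:C. P v0)"
  have finP: "finite (P v0)" for v0 using finite_vertices by (auto simp: P_def intro: finite_subset[of _ "Pow (C - {v0})"])
  then have finD: "finite D" unfolding D_def using finite_vertices by blast
  have cP: "card (P v0) = (DIM('a) choose j)" if "v0 \<in> C" for v0
    unfolding P_def using n_subsets[of "C - {v0}" j] finite_vertices card that by simp
  have pf: "emeasure lborel (piece v0) < \<infinity>" if "v0 \<in> C" for v0
  proof -
    have "emeasure lborel (piece v0) \<le> emeasure lborel S"
      using compact_S by (intro emeasure_mono) (auto simp: piece_def compact_imp_closed)
    also have "\<dots> < \<infinity>" using compact_S by (intro emeasure_bounded_finite compact_imp_bounded)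
    finally show ?thesis .
  qed
  have m: "measure lborel (cell t v0 J) = t ^ j * (1 - t) ^ (DIM('a) - j) * measure lborel (piece v0)"
    and cf: "cell t v0 J \<in> fmeasurable lborel" if "v0 \<in> C" "J \<in> P v0" for v0 J
  proof -
    have J: "J \<subseteq> C - {v0}" "card J = j" using that by (auto simp: P_def)
    note cm = cell_measure[OF that(1) J(1) t, unfolded J(2)]
    show "measure lborel (cell t v0 J) = t ^ j * (1 - t) ^ (DIM('a) - j) * measure lborel (piece v0)"
      using cm(3) t by (simp add: measure_def enn2real_mult)
    show "cell t v0 J \<in> fmeasurable lborel"
      using cm(1,3) pf[OF that(1)] by (intro fmeasurableI) (auto simp: ennreal_mult_less_top)
  qed
  let ?H = "dilate (- t) S \<or>\<^sub>c dilate (1 - t) S"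
  have "?H \<subseteq> (\<Union>(v0, J)\<in>D. cell t v0 J)"
  proof
    fix z assume "z \<in> ?H"
    from join_cover[OF t j this] obtain v0 J where "v0 \<in> C" "J \<in> P v0" "z \<in> cell t v0 J"
      unfolding P_def by blast
    then show "z \<in> (\<Union>(v0, J)\<in>D. cell t v0 J)"
      unfolding D_def by (intro UN_I[of "(v0, J)"]) simp_all
  qed
  moreover have cD: "(case d of (v0, J) \<Rightarrow> cell t v0 J) \<in> fmeasurable lborel" if "d \<in> D" for d
    using that cf by (auto simp: D_def)
  have "(\<Union>(v0, J)\<in>D. cell t v0 J) \<in> fmeasurable lborel"
    using cD by (rule fmeasurable.finite_UN[OF finD])
  moreover have "?H \<in> sets lborel" using compact_join by (simp add: compact_imp_closed)
  ultimately have "measure lborel ?H \<le> measure lborel (\<Union>(v0, J)\<in>D. cell t v0 J)"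
    by (intro measure_mono_fmeasurable)
  also have "\<dots> \<le> (\<Sum>d\<in>D. measure lborel (case d of (v0, J) \<Rightarrow> cell t v0 J))"
    using cD by (intro measure_UNION_le[OF finD] fmeasurableD)
  also have "\<dots> = (\<Sum>(v0, J)\<in>D. measure lborel (cell t v0 J))"
    by (simp add: case_prod_beta)
  also have "\<dots> = (\<Sum>v0\<in>C. \<Sum>J\<in>P v0. measure lborel (cell t v0 J))"
    unfolding D_def using finite_vertices finP by (subst sum.Sigma) auto
  also have "\<dots> = (\<Sum>v0\<in>C. real (DIM('a) choose j) * t ^ j * (1 - t) ^ (DIM('a) - j) * measure lborel (piece v0))"
    by (intro sum.cong refl) (simp add: m cP mult.assoc)
  also have "\<dots> = real (DIM('a) choose j) * t ^ j * (1 - t) ^ (DIM('a) - j) * (\<Sum>v0\<in>C. measure lborel (piece v0))"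
    by (simp add: sum_distrib_left)
  also have "\<dots> \<le> real (DIM('a) choose j) * t ^ j * (1 - t) ^ (DIM('a) - j) * measure lborel S"
    using t by (intro mult_left_mono sum_piece_le) auto
  finally show ?thesis .
qed

end

section \<open>The join in a power of the space\<close>

lemma emeasure_lborel_dilate:
  fixes A :: "'a::euclidean_space set"
  assumes A: "A \<in> sets borel" and r: "r \<noteq> 0"
  shows "emeasure lborel ((\<lambda>x. c + r *\<^sub>R x) ` A) = ennreal (\<bar>r\<bar> ^ DIM('a)) * emeasure lborel A"
    and "(\<lambda>x. c + r *\<^sub>R x) ` A \<in> sets borel"
proof -
  have "(\<lambda>x. c + r *\<^sub>R x) ` A = (\<lambda>x. inverse r *\<^sub>R (x - c)) -` A \<inter> space borel"
  proof (intro equalityI subsetI)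
    fix x assume "x \<in> (\<lambda>x. inverse r *\<^sub>R (x - c)) -` A \<inter> space borel"
    then show "x \<in> (\<lambda>x. c + r *\<^sub>R x) ` A"
      using r by (intro image_eqI[where x = "inverse r *\<^sub>R (x - c)"]) auto
  qed (use r in auto)
  also have "\<dots> \<in> sets borel"
    by (rule measurable_sets[OF _ A]) simp
  finally show B: "(\<lambda>x. c + r *\<^sub>R x) ` A \<in> sets borel" .
  have "emeasure lborel ((\<lambda>x. c + r *\<^sub>R x) ` A)
      = emeasure (density (distr lborel borel (\<lambda>x. c + r *\<^sub>R x)) (\<lambda>_. \<bar>r\<bar>^DIM('a))) ((\<lambda>x. c + r *\<^sub>R x) ` A)"
    using lborel_affine[OF r, of c] by simp
  also have "\<dots> = ennreal (\<bar>r\<bar> ^ DIM('a)) * emeasure lborel ((\<lambda>x. c + r *\<^sub>R x) -` (\<lambda>x. c + r *\<^sub>R x) ` A)"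
    using B by (subst emeasure_density) (auto simp: nn_integral_cmult_indicator emeasure_distr)
  also have "(\<lambda>x. c + r *\<^sub>R x) -` (\<lambda>x. c + r *\<^sub>R x) ` A = A"
    using r by auto
  finally show "emeasure lborel ((\<lambda>x. c + r *\<^sub>R x) ` A) = ennreal (\<bar>r\<bar> ^ DIM('a)) * emeasure lborel A" .
qed

context simplex_vertices
begin

text \<open>The smallest homothet of \<open>S\<close> containing \<open>y 0, \<dots>, y (p - 1)\<close> is \<open>center p y + defect p y \<cdot> S\<close>.\<close>

definition mcoord :: "nat \<Rightarrow> (nat \<Rightarrow> 'a) \<Rightarrow> 'a \<Rightarrow> real"
  where "mcoord p y v = Min ((\<lambda>k. coord (y k) v) ` {..<p})"

definition defect :: "nat \<Rightarrow> (nat \<Rightarrow> 'a) \<Rightarrow> real"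
  where "defect p y = - (\<Sum>v\<in>C. mcoord p y v)"

definition center :: "nat \<Rightarrow> (nat \<Rightarrow> 'a) \<Rightarrow> 'a"
  where "center p y = (\<Sum>v\<in>C. mcoord p y v *\<^sub>R v)"

lemma mcoord_le: "k < p \<Longrightarrow> mcoord p y v \<le> coord (y k) v"
  unfolding mcoord_def by (intro Min_le) auto

lemma mcoord_attained: "0 < p \<Longrightarrow> \<exists>k<p. mcoord p y v = coord (y k) v"
proof -
  assume "0 < p"
  then have "mcoord p y v \<in> (\<lambda>k. coord (y k) v) ` {..<p}" unfolding mcoord_def by (intro Min_in) auto
  then show ?thesis by auto
qed

text \<open>A minimum commutes with nondecreasing affine maps. The shift s may depend on v, which
  covers both adding a common vector to all components and adding a diagonal part.\<close>

lemma mcoord_affine: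
  assumes p: "0 < p" and r: "0 \<le> r" and eq: "\<And>k. k < p \<Longrightarrow> coord (y' k) v = r * coord (y k) v + s"
  shows "mcoord p y' v = r * mcoord p y v + s"
proof (rule antisym)
  obtain k where k: "k < p" "mcoord p y v = coord (y k) v" using mcoord_attained[OF p] by blast
  show "mcoord p y' v \<le> r * mcoord p y v + s" using mcoord_le[OF k(1), of y' v] eq[OF k(1)] k(2) by simp
  obtain k where k: "k < p" "mcoord p y' v = coord (y' k) v" using mcoord_attained[OF p] by blast
  show "r * mcoord p y v + s \<le> mcoord p y' v"
    unfolding k(2) eq[OF k(1)] using mcoord_le[OF k(1), of y v] r by (simp add: mult_left_mono)
qed

lemma defect_nonneg:
  assumes p: "0 < p"
  shows "0 \<le> defect p y"
proof -
  have "(\<Sum>v\<in>C. mcoord p y v) \<le> (\<Sum>v\<in>C. coord (y 0) v)" using p by (intro sum_mono mcoord_le)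
  then show ?thesis by (simp add: defect_def coord)
qed

lemma coord_center: "v \<in> C \<Longrightarrow> coord (center p y) v = mcoord p y v + defect p y / real (DIM('a) + 1)"
  by (subst coord_shift[of "mcoord p y"]) (simp_all add: center_def defect_def)

lemma mcoord_borel [measurable]: "v \<in> C \<Longrightarrow> (\<lambda>y. mcoord p y v) \<in> borel_measurable borel"
  unfolding mcoord_def by (intro borel_measurable_Min measurable_compose[OF measurable_component coord_borel]) auto

lemma defect_borel [measurable]: "defect p \<in> borel_measurable borel"
  unfolding defect_def[abs_def] by (intro borel_measurable_uminus borel_measurable_sum mcoord_borel)

lemma center_borel [measurable]: "center p \<in> borel_measurable borel"
  unfolding center_def[abs_def] by (intro borel_measurable_sum borel_measurable_scaleR mcoord_borel borel_measurable_const)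

text \<open>Tuples whose smallest homothet has size at most d and center in
  \<open>dilate (d - defect p y) X\<close>. Writing this with \<open>inverse\<close> makes
  measurability evident; at size d the dilate degenerates to the origin, which needs the separate
  disjunct because \<open>inverse 0 = 0\<close> would test the wrong condition.\<close>

definition region :: "nat \<Rightarrow> real \<Rightarrow> 'a set \<Rightarrow> (nat \<Rightarrow> 'a) set"
  where "region p d X = {y \<in> pow_space p. defect p y < d \<and> inverse (d - defect p y) *\<^sub>R center p y \<in> X
    \<or> defect p y = d \<and> center p y = 0}"

lemma region_borel:
  assumes X: "X \<in> sets borel"
  shows "region p d X \<in> sets borel"
proof -
  have "(\<lambda>y. inverse (d - defect p y) *\<^sub>R center p y) \<in> borel_measurable borel" by measurable
  then have "(\<lambda>y. inverse (d - defect p y) *\<^sub>R center p y) -` X \<inter> space borel \<in> sets borel"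
    using X by (rule measurable_sets)
  moreover have "region p d X = pow_space p \<inter> ({y. defect p y < d} \<inter> ((\<lambda>y. inverse (d - defect p y) *\<^sub>R center p y) -` X \<inter> space borel)
     \<union> {y. defect p y = d} \<inter> {y. center p y = 0})"
    by (auto simp: region_def)
  moreover have "{y. defect p y < d} \<in> sets borel" "{y. defect p y = d} \<in> sets borel" "{y. center p y = 0} \<in> sets borel"
    by measurable
  ultimately show ?thesis by auto
qed

text \<open>For X = S the center lies in \<open>dilate (d - defect p y) S\<close>, and adding the
  homothet of size \<open>defect p y\<close> keeps all components in \<open>dilate d S\<close>. This
  inclusion will bound the Fubini constant.\<close>

lemma region_S_subset:
  assumes p: "0 < p" and d: "0 \<le> d"
  shows "region p d S \<subseteq> cart_power p (dilate d S)"
proof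
  fix y assume y: "y \<in> region p d S"
  have "center p y \<in> dilate (d - defect p y) S \<and> defect p y \<le> d"
  proof (cases "defect p y < d")
    case True
    then have "inverse (d - defect p y) *\<^sub>R center p y \<in> S" using y by (auto simp: region_def)
    moreover have "center p y = (d - defect p y) *\<^sub>R (inverse (d - defect p y) *\<^sub>R center p y)"
      using True by simp
    ultimately show ?thesis using True unfolding dilate_def by (metis imageI less_imp_le)
  next
    case False
    then have "defect p y = d" "center p y = 0" using y by (auto simp: region_def)
    moreover obtain x0 where "x0 \<in> S" using card by (metis add_is_0 card.empty ex_in_conv convex_hull_eq_empty one_neq_zero)
    ultimately show ?thesis by (auto simp: dilate_def intro: image_eqI[of _ _ x0])
  qed
  then have c: "- (d - defect p y) / real (DIM('a) + 1) \<le> coord (center p y) v" if "v \<in> C" for v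
    using dilate_S_iff[of "d - defect p y" "center p y"] that by auto
  have "y k \<in> dilate d S" if "k < p" for k
    unfolding dilate_S_iff[OF d]
  proof
    fix v assume v: "v \<in> C"
    have "- d / real (DIM('a) + 1) = - (d - defect p y) / real (DIM('a) + 1) - defect p y / real (DIM('a) + 1)"
      unfolding diff_divide_distrib[symmetric] by simp
    also have "\<dots> \<le> mcoord p y v" using c[OF v] coord_center[OF v, of p y] by linarith
    also have "\<dots> \<le> coord (y k) v" by (rule mcoord_le[OF that])
    finally show "- d / real (DIM('a) + 1) \<le> coord (y k) v" .
  qed
  then show "y \<in> cart_power p (dilate d S)" using y by (auto simp: cart_power_def region_def pow_space_def)
qed

text \<open>A point of the join is a diagonal part from x plus s (1 - t) w with w in the power of S.
  Its defect is s (1 - t) D, with D the defect of w, and its center combines x with the center of w,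
  which lies in (1 - D) S. After reweighting, the center is a point of the join for p = 1, scaled by
  the room 1 - s D that the defect leaves.\<close>

lemma join_power_subset:
  assumes p: "0 < p" and t: "0 < t" "t < 1"
  shows "dilate (- t) (diag p ` S) \<or>\<^sub>c dilate (1 - t) (cart_power p S)
    \<subseteq> region p (1 - t) ((\<lambda>x. 0 + inverse (1 - t) *\<^sub>R x) ` (dilate (- t) S \<or>\<^sub>c dilate (1 - t) S))"
proof
  let ?H = "dilate (- t) S \<or>\<^sub>c dilate (1 - t) S"
  fix y assume "y \<in> dilate (- t) (diag p ` S) \<or>\<^sub>c dilate (1 - t) (cart_power p S)"
  moreover obtain x0 where "x0 \<in> S" using card by (metis add_is_0 card.empty ex_in_conv convex_hull_eq_empty one_neq_zero)
  then have "(\<lambda>i. if i < p then x0 else 0) \<in> cart_power p S" by (auto simp: cart_power_def)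
  ultimately have "y \<in> (\<lambda>(s, x, y). (1 - s) *\<^sub>R x + s *\<^sub>R y) ` ({0..1} \<times> dilate (- t) (diag p ` S) \<times> dilate (1 - t) (cart_power p S))"
  proof (subst (asm) join_eq)
    show "convex (dilate (- t) (diag p ` S))" "convex (dilate (1 - t) (cart_power p S))"
      by (intro convex_dilate convex_diag convex_cart_power convex_convex_hull)+
  qed (use \<open>x0 \<in> S\<close> in \<open>auto simp: dilate_def\<close>)
  then obtain s x w where s: "0 \<le> s" "s \<le> 1" "x \<in> S" "w \<in> cart_power p S"
    "y = (1 - s) *\<^sub>R (- t) *\<^sub>R diag p x + s *\<^sub>R (1 - t) *\<^sub>R w"
    by (auto simp: dilate_def)
  have wS: "w k \<in> S" if "k < p" for k using s(4) that by (auto simp: cart_power_def)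
  have yV: "y \<in> pow_space p"
    using s(4,5) by (auto simp: pow_space_def cart_power_def diag_def fun_vector_apply)
  have m: "mcoord p y v = (s * (1 - t)) * mcoord p w v + - ((1 - s) * t * coord x v)" if v: "v \<in> C" for v
  proof (rule mcoord_affine[OF p])
    show "0 \<le> s * (1 - t)" using s t by auto
    fix k assume "k < p"
    then have "y k = ((1 - s) * (- t)) *\<^sub>R x + (s * (1 - t)) *\<^sub>R w k"
      unfolding s(5) by (simp add: fun_vector_apply diag_def)
    then show "coord (y k) v = s * (1 - t) * coord (w k) v + - ((1 - s) * t * coord x v)"
      using v by (simp add: coord_add coord_scale del: scaleR_minus_left)
  qed
  define D where "D = defect p w"
  have dy: "defect p y = s * (1 - t) * D"
    using coord(1)[of x] by (simp add: defect_def D_def m sum.distrib sum_negf sum_subtractf sum_distrib_left[symmetric] mult.assoc)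
  have cy: "center p y = (s * (1 - t)) *\<^sub>R center p w - ((1 - s) * t) *\<^sub>R x"
  proof -
    have "center p y = (s * (1 - t)) *\<^sub>R (\<Sum>v\<in>C. mcoord p w v *\<^sub>R v) - ((1 - s) * t) *\<^sub>R (\<Sum>v\<in>C. coord x v *\<^sub>R v)"
      by (simp add: center_def m scaleR_diff_left sum_subtractf scaleR_sum_right)
    then show ?thesis by (simp only: coord(2) center_def)
  qed
  have mw: "- 1 / real (DIM('a) + 1) \<le> mcoord p w v" if "v \<in> C" for v
    using mcoord_attained[OF p, of w v] wS that by (auto simp: S_iff)
  have D0: "0 \<le> D" unfolding D_def by (rule defect_nonneg[OF p])
  have D1: "D \<le> 1"
  proof -
    have "(\<Sum>v\<in>C. - 1 / real (DIM('a) + 1)) \<le> (\<Sum>v\<in>C. mcoord p w v)" using mw by (intro sum_mono)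
    then show ?thesis using card by (simp add: D_def defect_def)
  qed
  have "center p w \<in> dilate (1 - D) S"
  proof (subst dilate_S_iff)
    have e: "- (1 - D) / real (DIM('a) + 1) = - 1 / real (DIM('a) + 1) + D / real (DIM('a) + 1)"
      unfolding add_divide_distrib[symmetric] by simp
    show "\<forall>v\<in>C. - (1 - D) / real (DIM('a) + 1) \<le> coord (center p w) v"
      unfolding e using mw by (auto simp: coord_center D_def)
  qed (use D1 in simp)
  then obtain q where q: "q \<in> S" "center p w = (1 - D) *\<^sub>R q" by (auto simp: dilate_def)
  have sD: "s * D \<le> 1" using mult_mono[of s 1 D 1] s D0 D1 by simp
  show "y \<in> region p (1 - t) ((\<lambda>x. 0 + inverse (1 - t) *\<^sub>R x) ` ?H)"
  \<comment> \<open>No room is left: s = D = 1, so the size is 1 - t and the center is 0, the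
    degenerate disjunct of \<open>region\<close>.\<close>
  proof (cases "s * D = 1")
    case True
    have "s * D \<le> s" "s * D \<le> D" using s D0 D1 by (auto simp: mult_left_le mult_left_le_one_le)
    then have "s = 1" "D = 1" using True s D1 by auto
    then show ?thesis using yV by (simp add: region_def dy cy q)
  next
    case False
    define l where "l = 1 - s * D"
    have l: "0 < l" using sD False by (simp add: l_def)
    \<comment> \<open>Chosen so that \<open>l * s' = s * (1 - D)\<close> and
      \<open>l * (1 - s') = 1 - s\<close>; dividing the center by l then yields a convex
      combination.\<close>
    define s' where "s' = s * (1 - D) / l"
    have s1: "1 - s' = (1 - s) / l" using l by (simp add: s'_def field_simps) (simp add: l_def algebra_simps)
    have s'0: "0 \<le> s'" using s D1 l by (simp add: s'_def)
    have s'1: "0 \<le> 1 - s'" unfolding s1 using s l by simp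
    define h where "h = (1 - s') *\<^sub>R ((- t) *\<^sub>R x) + s' *\<^sub>R ((1 - t) *\<^sub>R q)"
    have "(- t) *\<^sub>R x \<in> convex hull (dilate (- t) S \<union> dilate (1 - t) S)" "(1 - t) *\<^sub>R q \<in> convex hull (dilate (- t) S \<union> dilate (1 - t) S)"
      using s(3) q(1) by (auto intro!: hull_inc simp: dilate_def)
    then have h: "h \<in> ?H"
      unfolding h_def join_def using s'0 s'1 by (intro convexD[OF convex_convex_hull]) auto
    have "l *\<^sub>R h = (l * (1 - s')) *\<^sub>R ((- t) *\<^sub>R x) + (l * s') *\<^sub>R ((1 - t) *\<^sub>R q)"
      by (simp only: h_def scaleR_add_right scaleR_scaleR mult.assoc)
    also have "l * (1 - s') = 1 - s" unfolding s1 using l by simp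
    also have "l * s' = s * (1 - D)" using l by (simp add: s'_def)
    finally have "center p y = l *\<^sub>R h" unfolding cy q(2) by (simp add: mult_ac)
    moreover have d: "(1 - t) - defect p y = (1 - t) * l" by (simp add: dy l_def algebra_simps)
    ultimately have "inverse ((1 - t) - defect p y) *\<^sub>R center p y = 0 + inverse (1 - t) *\<^sub>R h"
      using l t by simp
    moreover have "defect p y < 1 - t" using d l t by (metis diff_gt_0_iff_gt mult_pos_pos)
    ultimately show ?thesis using h yV by (auto simp: region_def)
  qed
qed

end

context simplex_vertices
begin

text \<open>Adding the last component u to the others separates a tuple into its shape (w, 0) and
  its position u. The defect depends on the shape alone and the center moves with u. For a given
  shape of defect below d the positions thus fill a translate of (d - defect) X. Integrating over
  shapes leaves a factor independent of X.\<close>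

lemma emeasure_region:
  assumes X: "X \<in> sets borel"
  shows "emeasure (lborel_pow (Suc q)) (region (Suc q) d X) =
    (\<integral>\<^sup>+w. (if defect (Suc q) (\<lambda>i. if i < q then w i else 0) < d
        then ennreal ((d - defect (Suc q) (\<lambda>i. if i < q then w i else 0)) ^ DIM('a)) else 0)
      \<partial>(Pi\<^sub>M {..<q} (\<lambda>_. lborel))) * emeasure lborel X"
proof -
  let ?p = "Suc q" and ?M = "Pi\<^sub>M {..<q} (\<lambda>_. lborel :: 'a measure)"
  define R where "R = region ?p d X"
  have R: "R \<in> sets borel" unfolding R_def by (rule region_borel[OF X])
  interpret product_sigma_finite "\<lambda>_::nat. lborel :: 'a measure" by standard
  interpret fp: finite_product_sigma_finite "\<lambda>_::nat. lborel :: 'a measure" "{..<q}" by standard auto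
  interpret pair: pair_sigma_finite "lborel :: 'a measure" ?M by unfold_locales
  let ?e = "\<lambda>w i. if i < q then w i else 0 :: 'a"
  let ?\<Psi> = "\<lambda>u w i. if i < q then w i + u else if i = q then u else 0 :: 'a"
  have comp: "(\<lambda>w. w i) \<in> borel_measurable ?M" if "i < q" for i
  proof -
    have "(\<lambda>w. w i) \<in> measurable ?M lborel" using that by (intro measurable_component_singleton) simp
    then show ?thesis by simp
  qed
  have \<Psi>m: "(\<lambda>(u, w). ?\<Psi> u w) \<in> borel_measurable (lborel \<Otimes>\<^sub>M ?M)"
  proof (rule measurable_coordinatewise_then_product)
    fix i
    show "(\<lambda>z. (case z of (u, w) \<Rightarrow> ?\<Psi> u w) i) \<in> borel_measurable (lborel \<Otimes>\<^sub>M ?M)"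
    proof (cases "i < q")
      case True
      have "(\<lambda>z. snd z i + fst z) \<in> borel_measurable (lborel \<Otimes>\<^sub>M ?M)"
        by (intro borel_measurable_add measurable_compose[OF measurable_snd comp[OF True]]) simp
      then show ?thesis using True by (simp add: case_prod_beta)
    next
      case False
      then show ?thesis by (cases "i = q") (simp_all add: case_prod_beta)
    qed
  qed
  have "emeasure (lborel_pow ?p) R = (\<integral>\<^sup>+y. indicator R y \<partial>lborel_pow ?p)"
    using R by simp
  also have "\<dots> = (\<integral>\<^sup>+y. indicator R (\<lambda>i. if i < ?p then y i else 0) \<partial>Pi\<^sub>M (insert q {..<q}) (\<lambda>_. lborel))"
    using R by (subst nn_integral_lborel_pow) (auto simp: lessThan_Suc)
  also have "\<dots> = (\<integral>\<^sup>+u. (\<integral>\<^sup>+w. indicator R (\<lambda>i. if i < ?p then (w(q := u)) i else 0) \<partial>?M) \<partial>lborel)"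
  proof (rule product_nn_integral_insert_rev)
    have "(\<lambda>y. indicator R y :: ennreal) \<in> borel_measurable borel" using R by simp
    from measurable_compose[OF measurable_embed this, of ?p]
    show "(\<lambda>y. indicator R (\<lambda>i. if i < ?p then y i else 0) :: ennreal) \<in> borel_measurable (Pi\<^sub>M (insert q {..<q}) (\<lambda>_. lborel))"
      by (simp add: lessThan_Suc)
  qed auto
  also have "\<dots> = (\<integral>\<^sup>+u. (\<integral>\<^sup>+w. indicator R (?\<Psi> u w) \<partial>?M) \<partial>lborel)"
  proof (rule nn_integral_cong)
    fix u :: 'a
    let ?g = "\<lambda>w. indicator R (\<lambda>i. if i < ?p then (w(q := u)) i else 0) :: ennreal"
    have "(\<lambda>w i. if i < ?p then (w(q := u)) i else 0) \<in> borel_measurable ?M"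
    proof (rule measurable_coordinatewise_then_product)
      show "(\<lambda>w. if i < ?p then (w(q := u)) i else 0) \<in> borel_measurable ?M" for i
        using comp[of i] by (cases "i < q"; cases "i = q") auto
    qed
    then have g: "?g \<in> borel_measurable ?M"
      by (rule measurable_compose) (use R in simp)
    have tr: "(\<lambda>w. \<lambda>i\<in>{..<q}. w i + u) \<in> measurable ?M ?M" by measurable
    have "(\<integral>\<^sup>+w. ?g w \<partial>?M) = (\<integral>\<^sup>+w. ?g w \<partial>distr ?M ?M (\<lambda>w. \<lambda>i\<in>{..<q}. w i + u))"
      by (simp add: PiM_lborel_translate)
    also have "\<dots> = (\<integral>\<^sup>+w. ?g (\<lambda>i\<in>{..<q}. w i + u) \<partial>?M)"
      using g by (intro nn_integral_distr[OF tr]) (simp add: PiM_lborel_translate)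
    also have "\<dots> = (\<integral>\<^sup>+w. indicator R (?\<Psi> u w) \<partial>?M)"
      by (intro nn_integral_cong arg_cong[where f = "indicator R"]) (auto simp: fun_eq_iff)
    finally show "(\<integral>\<^sup>+w. ?g w \<partial>?M) = (\<integral>\<^sup>+w. indicator R (?\<Psi> u w) \<partial>?M)" .
  qed
  also have "\<dots> = (\<integral>\<^sup>+w. (\<integral>\<^sup>+u. indicator R (?\<Psi> u w) \<partial>lborel) \<partial>?M)"
  proof (rule pair.Fubini'[symmetric])
    have "(\<lambda>z. indicator R (case z of (u, w) \<Rightarrow> ?\<Psi> u w) :: ennreal) \<in> borel_measurable (lborel \<Otimes>\<^sub>M ?M)"
      using R by (intro measurable_compose[OF \<Psi>m]) simp
    then show "(\<lambda>(u, w). indicator R (?\<Psi> u w) :: ennreal) \<in> borel_measurable (lborel \<Otimes>\<^sub>M ?M)"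
      by (simp add: case_prod_beta)
  qed
  also have "\<dots> = (\<integral>\<^sup>+w. (if defect ?p (?e w) < d then ennreal ((d - defect ?p (?e w)) ^ DIM('a)) else 0) * emeasure lborel X \<partial>?M)"
  proof (rule nn_integral_cong)
    fix w :: "nat \<Rightarrow> 'a"
    define D where "D = defect ?p (?e w)"
    define c where "c = center ?p (?e w)"
    have mc: "mcoord ?p (?\<Psi> u w) v = 1 * mcoord ?p (?e w) v + coord u v" if "v \<in> C" for u v
      by (rule mcoord_affine) (use that coord_scale[OF that, of 0 0] in \<open>auto simp: coord_add less_Suc_eq\<close>)
    have sumc: "(\<Sum>v\<in>C. coord u v) = 0" for u by (rule coord)
    have D: "defect ?p (?\<Psi> u w) = D" for u
      by (simp add: defect_def D_def mc sum.distrib sumc)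
    have c: "center ?p (?\<Psi> u w) = c + u" for u
      by (simp add: center_def c_def mc sum.distrib scaleR_add_left coord)
    have \<Psi>V: "?\<Psi> u w \<in> pow_space ?p" for u by (auto simp: pow_space_def)
    have iff: "?\<Psi> u w \<in> R \<longleftrightarrow> D < d \<and> inverse (d - D) *\<^sub>R (c + u) \<in> X \<or> D = d \<and> c + u = 0" for u
      unfolding R_def region_def using \<Psi>V[of u] by (simp add: D c)
    consider "D < d" | "D = d" | "d < D" by linarith
    then have "(\<integral>\<^sup>+u. indicator R (?\<Psi> u w) \<partial>lborel) = (if D < d then ennreal ((d - D) ^ DIM('a)) else 0) * emeasure lborel X"
    proof cases
      case 1
      have "indicator R (?\<Psi> u w) = (indicator ((\<lambda>x. - c + (d - D) *\<^sub>R x) ` X) u :: ennreal)" for u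
      proof -
        have "?\<Psi> u w \<in> R \<longleftrightarrow> u \<in> (\<lambda>x. - c + (d - D) *\<^sub>R x) ` X"
        proof
          assume "?\<Psi> u w \<in> R"
          then have "inverse (d - D) *\<^sub>R (c + u) \<in> X" using iff 1 by auto
          moreover have "u = - c + (d - D) *\<^sub>R (inverse (d - D) *\<^sub>R (c + u))" using 1 by simp
          ultimately show "u \<in> (\<lambda>x. - c + (d - D) *\<^sub>R x) ` X" by (rule image_eqI[rotated])
        next
          assume "u \<in> (\<lambda>x. - c + (d - D) *\<^sub>R x) ` X"
          then show "?\<Psi> u w \<in> R" unfolding iff using 1 by auto
        qed
        then show ?thesis by (simp add: indicator_def)
      qed
      then have "(\<integral>\<^sup>+u. indicator R (?\<Psi> u w) \<partial>lborel) = emeasure lborel ((\<lambda>x. - c + (d - D) *\<^sub>R x) ` X)"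
        using emeasure_lborel_dilate(2)[OF X, of "d - D" "- c"] 1 by simp
      also have "\<dots> = ennreal (\<bar>d - D\<bar> ^ DIM('a)) * emeasure lborel X"
        using 1 by (intro emeasure_lborel_dilate X) auto
      finally show ?thesis using 1 by simp
    next
      \<comment> \<open>Only the position u = -c remains, a null set.\<close>
      case 2
      have "indicator R (?\<Psi> u w) = (indicator {- c} u :: ennreal)" for u
      proof -
        have "?\<Psi> u w \<in> R \<longleftrightarrow> u = - c" unfolding iff using 2 by (auto simp: eq_neg_iff_add_eq_0 add.commute)
        then show ?thesis by (simp add: indicator_def)
      qed
      then have "(\<integral>\<^sup>+u. indicator R (?\<Psi> u w) \<partial>lborel) = 0" by simp
      then show ?thesis using 2 by simp
    next
      case 3
      then have "indicator R (?\<Psi> u w) = (0 :: ennreal)" for u using iff[of u] by (simp add: indicator_def)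
      then show ?thesis using 3 by simp
    qed
    then show "(\<integral>\<^sup>+u. indicator R (?\<Psi> u w) \<partial>lborel) = (if defect ?p (?e w) < d then ennreal ((d - defect ?p (?e w)) ^ DIM('a)) else 0) * emeasure lborel X"
      unfolding D_def .
  qed
  also have "\<dots> = (\<integral>\<^sup>+w. (if defect ?p (?e w) < d then ennreal ((d - defect ?p (?e w)) ^ DIM('a)) else 0) \<partial>?M) * emeasure lborel X"
  proof (rule nn_integral_multc)
    have "(\<lambda>y. if defect ?p y < d then ennreal ((d - defect ?p y) ^ DIM('a)) else 0) \<in> borel_measurable borel"
      by measurable
    from measurable_compose[OF measurable_embed this]
    show "(\<lambda>w. if defect ?p (?e w) < d then ennreal ((d - defect ?p (?e w)) ^ DIM('a)) else 0) \<in> borel_measurable ?M" .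
  qed
  finally show ?thesis unfolding R_def .
qed

text \<open>The constant \<kappa> is not computed. Taking X = S bounds \<kappa> |S| by the volume of
  the power of (1 - t) S; taking X to be the rescaled join for p = 1 bounds the volume in question
  by \<kappa> |X|. The bound of |X| by a multiple of |S| connects the two without a division by
  |S|.\<close>

lemma vol_join_power_le:
  assumes p: "1 \<le> p" and t: "0 < t" "t < 1"
    and j: "real j \<le> real (DIM('a) + 1) * t" "real (DIM('a) + 1) * t \<le> real j + 1" "j \<le> DIM('a)"
  shows "vol p (dilate (- t) (diag p ` S) \<or>\<^sub>c dilate (1 - t) (cart_power p S))
    \<le> real (DIM('a) choose j) * t ^ j * (1 - t) ^ (DIM('a) * p - j) * measure lborel S ^ p"
proof -
  obtain q where q: "p = Suc q" using p by (cases p) auto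
  let ?d = "1 - t" and ?n = "DIM('a)"
  let ?H = "dilate (- t) (diag p ` S) \<or>\<^sub>c dilate ?d (cart_power p S)"
  let ?H1 = "dilate (- t) S \<or>\<^sub>c dilate ?d S"
  let ?X = "(\<lambda>x. 0 + inverse ?d *\<^sub>R x) ` ?H1"
  define \<kappa> where "\<kappa> = (\<integral>\<^sup>+w. (if defect (Suc q) (\<lambda>i. if i < q then w i else 0) < ?d
        then ennreal ((?d - defect (Suc q) (\<lambda>i. if i < q then w i else 0)) ^ ?n) else 0) \<partial>(Pi\<^sub>M {..<q} (\<lambda>_. lborel)))"
  have reg: "emeasure (lborel_pow p) (region p ?d X) = \<kappa> * emeasure lborel X" if "X \<in> sets borel" for X
    unfolding \<kappa>_def q by (rule emeasure_region[OF that])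
  have H1: "compact ?H1" by (rule compact_join)
  have Xb: "?X \<in> sets borel"
    using H1 t by (intro emeasure_lborel_dilate(2)) (auto simp: compact_imp_closed)
  have H: "compact ?H" "?H \<subseteq> pow_space p"
    by (intro compact_join_fun convex_dilate convex_diag convex_cart_power convex_convex_hull
        compact_dilate_fun compact_diag compact_cart_power compact_S)
      (intro join_subset_pow_space dilate_subset_pow_space diag_subset cart_power_subset)
  have fin: "emeasure lborel A = ennreal (measure lborel A)" if "compact A" for A :: "'a set"
    using that by (intro emeasure_eq_ennreal_measure) (metis emeasure_compact_finite infinity_ennreal_def less_irrefl)
  define c where "c = real (?n choose j) * t ^ j"
  have c0: "0 \<le> c" using t by (simp add: c_def)
  have "emeasure lborel ?X = ennreal (inverse ?d ^ ?n * measure lborel ?H1)"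
  proof -
    have "emeasure lborel ?X = ennreal (\<bar>inverse ?d\<bar> ^ ?n) * emeasure lborel ?H1"
      using t H1 by (intro emeasure_lborel_dilate(1)) (auto simp: compact_imp_closed)
    then show ?thesis using t by (simp add: fin[OF H1] ennreal_mult)
  qed
  also have "\<dots> \<le> ennreal (inverse ?d ^ ?n * (c * ?d ^ (?n - j) * measure lborel S))"
    using measure_join_le[OF t j] t by (intro ennreal_leI mult_left_mono) (auto simp: c_def)
  also have "inverse ?d ^ ?n * (c * ?d ^ (?n - j) * measure lborel S) = c * inverse ?d ^ j * measure lborel S"
  proof -
    have "inverse ?d ^ ?n * ?d ^ (?n - j) = inverse ?d ^ j * (inverse ?d ^ (?n - j) * ?d ^ (?n - j))"
      using j(3) by (simp flip: power_add mult.assoc)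
    also have "\<dots> = inverse ?d ^ j" using t by (simp flip: power_mult_distrib)
    finally show ?thesis by (simp add: mult_ac)
  qed
  finally have eX: "emeasure lborel ?X \<le> ennreal (c * inverse ?d ^ j) * emeasure lborel S"
    using t c0 by (simp add: fin[OF compact_S] ennreal_mult)
  have "\<kappa> * emeasure lborel S = emeasure (lborel_pow p) (region p ?d S)"
    using compact_S by (simp add: reg compact_imp_closed)
  also have "\<dots> \<le> emeasure (lborel_pow p) (cart_power p (dilate ?d S))"
  proof (rule emeasure_mono)
    show "region p ?d S \<subseteq> cart_power p (dilate ?d S)" using p t by (intro region_S_subset) auto
    have "compact (dilate ?d S)" unfolding dilate_def by (rule compact_scaling[OF compact_S])
    then show "cart_power p (dilate ?d S) \<in> sets (lborel_pow p)"
      using borel_compact_fun[OF compact_cart_power] by simp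
  qed
  also have "\<dots> = ennreal ((?d ^ ?n * measure lborel S) ^ p)"
  proof -
    have cS: "compact (dilate ?d S)" unfolding dilate_def by (rule compact_scaling[OF compact_S])
    have "emeasure lborel (dilate ?d S) = ennreal (?d ^ ?n) * emeasure lborel S"
      using emeasure_lborel_dilate(1)[of S ?d 0] compact_S t by (simp add: dilate_def compact_imp_closed)
    then have "measure lborel (dilate ?d S) = ?d ^ ?n * measure lborel S"
      using t by (simp add: measure_def enn2real_mult)
    moreover have "vol p (cart_power p (dilate ?d S)) = measure lborel (dilate ?d S) ^ p"
      using cS by (intro vol_cart_power) (simp add: compact_imp_closed)
    moreover have "vol p (cart_power p (dilate ?d S)) = measure (lborel_pow p) (cart_power p (dilate ?d S))"
      using compact_cart_power[OF cS] by (intro vol_eq borel_compact_fun cart_power_subset)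
    moreover have "emeasure (lborel_pow p) (cart_power p (dilate ?d S)) < \<infinity>"
      by (rule emeasure_compact_pow_finite[OF compact_cart_power[OF cS] cart_power_subset])
    ultimately show ?thesis by (simp add: emeasure_eq_ennreal_measure)
  qed
  finally have \<kappa>S: "\<kappa> * emeasure lborel S \<le> ennreal ((?d ^ ?n * measure lborel S) ^ p)" .
  have "emeasure (lborel_pow p) ?H \<le> emeasure (lborel_pow p) (region p ?d ?X)"
    using join_power_subset[of p t] p t region_borel[OF Xb] by (intro emeasure_mono) auto
  also have "\<dots> = \<kappa> * emeasure lborel ?X" by (rule reg[OF Xb])
  also have "\<dots> \<le> \<kappa> * (ennreal (c * inverse ?d ^ j) * emeasure lborel S)"
    using eX by (rule mult_left_mono) simp
  also have "\<dots> = ennreal (c * inverse ?d ^ j) * (\<kappa> * emeasure lborel S)" by (simp add: mult_ac)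
  also have "\<dots> \<le> ennreal (c * inverse ?d ^ j) * ennreal ((?d ^ ?n * measure lborel S) ^ p)"
    using \<kappa>S by (rule mult_left_mono) simp
  also have "\<dots> = ennreal (c * inverse ?d ^ j * (?d ^ ?n * measure lborel S) ^ p)"
    using c0 t by (simp add: ennreal_mult)
  also have "c * inverse ?d ^ j * (?d ^ ?n * measure lborel S) ^ p = c * ?d ^ (?n * p - j) * measure lborel S ^ p"
  proof -
    have "j \<le> ?n * p" using j(3) p by (metis le_trans mult_le_mono2 nat_mult_1_right)
    then have "inverse ?d ^ j * ?d ^ (?n * p) = (inverse ?d ^ j * ?d ^ j) * ?d ^ (?n * p - j)"
      by (simp add: mult.assoc flip: power_add)
    also have "\<dots> = ?d ^ (?n * p - j)" using t by (simp flip: power_mult_distrib)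
    finally show ?thesis by (simp add: power_mult_distrib mult_ac flip: power_mult)
  qed
  finally have "measure (lborel_pow p) ?H \<le> c * ?d ^ (?n * p - j) * measure lborel S ^ p"
    using c0 t by (simp add: measure_def enn2real_leI)
  moreover have "vol p ?H = measure (lborel_pow p) ?H"
    using H by (intro vol_eq borel_compact_fun)
  ultimately show ?thesis by (simp add: c_def)
qed

end

section \<open>The mixed volume inequality\<close>

text \<open>A flat K lies in a hyperplane \<open>u \<bullet> x = r\<close>, so every component of a
  point of aA + bB lies in \<open>u \<bullet> x = (b - a) * r\<close>. The sum is contained in a
  power of a null set, and \<open>p \<ge> 1\<close> makes that power null.\<close>

lemma mixed_volume_degenerate:
  fixes K :: "'a::euclidean_space set"
  assumes K: "convex_body K" "interior K = {}" and p: "1 \<le> p" and j: "j \<le> DIM('a) * p"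
  shows "mixed_volume p (replicate j (dilate (- 1) (diag p ` K)) @ replicate (DIM('a) * p - j) (cart_power p K)) = 0"
proof -
  let ?A = "dilate (- 1) (diag p ` K)" and ?B = "cart_power p K"
  have K': "K \<noteq> {}" "compact K" "convex K" using K by (auto simp: convex_body_def)
  obtain u r where u: "u \<noteq> 0" "K \<subseteq> {x. u \<bullet> x = r}"
    using empty_interior_subset_hyperplane[OF K'(3) K(2)] by metis
  have "vol p (dilate a ?A + dilate b ?B) = 0" for a b
  proof -
    let ?T = "dilate a ?A + dilate b ?B"
    have T: "compact ?T" "?T \<subseteq> pow_space p"
      by (intro compact_sum_fun compact_dilate_fun compact_diag compact_cart_power K')
        (intro dilate_plus_subset_pow_space dilate_subset_pow_space diag_subset cart_power_subset)
    obtain R where R: "?T \<subseteq> cart_power p (cball 0 R)" using bounded_coordinates_compact[OF T] .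
    define H where "H = {x. u \<bullet> x = (b - a) * r} \<inter> cball 0 R"
    have H: "compact H" unfolding H_def by (intro closed_Int_compact closed_hyperplane compact_cball)
    have "?T \<subseteq> cart_power p H"
    proof
      fix y assume y: "y \<in> ?T"
      then obtain x w where xw: "x \<in> K" "w \<in> cart_power p K" "y = a *\<^sub>R (- 1) *\<^sub>R diag p x + b *\<^sub>R w"
        by (auto simp: dilate_def set_plus_def)
      have "u \<bullet> y i = (b - a) * r" if "i < p" for i
      proof -
        have "y i = b *\<^sub>R w i - a *\<^sub>R x" using that by (simp add: xw(3) fun_vector_apply diag_def)
        moreover have "u \<bullet> w i = r" "u \<bullet> x = r" using u(2) xw that by (auto simp: cart_power_def)
        ultimately show ?thesis by (simp add: inner_diff_right left_diff_distrib)
      qed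
      then show "y \<in> cart_power p H" using y R by (auto simp: H_def cart_power_def)
    qed
    then have "vol p ?T \<le> vol p (cart_power p H)"
      by (intro vol_mono T compact_cart_power H cart_power_subset)
    also have "\<dots> = measure lborel H ^ p"
      using H by (intro vol_cart_power) (simp add: compact_imp_closed)
    also have "measure lborel H = 0"
    proof -
      have "negligible H"
        using negligible_hyperplane[of u "(b - a) * r"] u(1) unfolding H_def by (intro negligible_Int) auto
      then have "measure lebesgue H = 0" by (simp add: negligible_iff_measure)
      then show ?thesis using H by (simp add: measure_completion compact_imp_closed)
    qed
    also have "(0::real) ^ p = 0" using p by simp
    finally have "vol p ?T \<le> 0" .
    moreover have "0 \<le> vol p ?T" by (simp add: vol_def)
    ultimately show ?thesis by simp
  qed
  then have "mixed_volume p (replicate j ?A @ replicate (DIM('a) * p - j) ?B) = (\<lambda>_. 0) j / real (DIM('a) * p choose j)"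
    using K' j
    by (intro mixed_volume_two_bodies convex_dilate convex_diag convex_cart_power)
      (auto simp: dilate_def cart_power_def intro!: exI[of _ "\<lambda>i. if i < p then SOME x. x \<in> K else 0"] some_in_eq[THEN iffD2])
  then show ?thesis by simp
qed

text \<open>Translation invariance and homogeneity are read off the polynomial: with weights a / t
  and b / (1 - t) the dilations cancel, and replacing K by K - x shifts the sum by (a - b) times the
  diagonal point of x. Hence the coefficients for K arise from the bounded ones by dividing by
  \<open>t ^ k * (1 - t) ^ (N - k)\<close>.\<close>

lemma mixed_volume_le_vol_join:
  fixes K :: "'a::euclidean_space set"
  assumes K: "convex_body K" "interior K \<noteq> {}" and x: "x \<in> K" and t: "0 < t" "t < 1" and j: "j \<le> DIM('a) * p"
  shows "t ^ j * (1 - t) ^ (DIM('a) * p - j) *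
      mixed_volume p (replicate j (dilate (- 1) (diag p ` K)) @ replicate (DIM('a) * p - j) (cart_power p K))
    \<le> vol p (dilate (- t) (diag p ` translate_by K x) \<or>\<^sub>c dilate (1 - t) (cart_power p (translate_by K x)))"
proof -
  let ?N = "DIM('a) * p" and ?K = "translate_by K x"
  let ?A = "dilate (- 1) (diag p ` K)" and ?B = "cart_power p K"
  let ?A' = "dilate (- t) (diag p ` ?K)" and ?B' = "dilate (1 - t) (cart_power p ?K)"
  have K': "K \<noteq> {}" "compact K" "convex K" using K by (auto simp: convex_body_def)
  have tr: "?K = (\<lambda>y. - x + y) ` K" by (auto simp: translate_by_def)
  have "compact ?K" unfolding tr by (rule compact_translation[OF K'(2)])
  moreover have "convex ?K" unfolding tr by (rule convex_translation[OF K'(3)])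
  moreover have "interior ?K \<noteq> {}" unfolding tr interior_translation using K(2) by blast
  moreover have "0 \<in> ?K" unfolding translate_by_def using x by (intro image_eqI[of _ _ x]) auto
  ultimately obtain c where c: "\<And>k. c k \<le> real (?N choose k) * vol p (?A' \<or>\<^sub>c ?B')"
    "\<And>a b. 0 \<le> a \<Longrightarrow> 0 \<le> b \<Longrightarrow> vol p (dilate a ?A' + dilate b ?B') = (\<Sum>k\<le>?N. c k * a ^ k * b ^ (?N - k))"
    using vol_body_expansion[of ?K p "- t" "1 - t"] by blast
  have "vol p (dilate a ?A + dilate b ?B) = (\<Sum>k\<le>?N. c k / (t ^ k * (1 - t) ^ (?N - k)) * a ^ k * b ^ (?N - k))"
    if ab: "0 \<le> a" "0 \<le> b" for a b
  proof -
    let ?v = "(a - b) *\<^sub>R diag p x"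
    have "dilate (a / t) ?A' + dilate (b / (1 - t)) ?B' = (\<lambda>y. y + ?v) ` (dilate a ?A + dilate b ?B)"
    proof (intro equalityI subsetI)
      have scale: "(a / t) *\<^sub>R (- t) *\<^sub>R u + (b / (1 - t)) *\<^sub>R (1 - t) *\<^sub>R w = (- a) *\<^sub>R u + b *\<^sub>R w" for u w :: "nat \<Rightarrow> 'a"
        using t by simp
      fix y assume "y \<in> dilate (a / t) ?A' + dilate (b / (1 - t)) ?B'"
      then obtain z w where zw: "z \<in> K" "w \<in> cart_power p ?K" "y = (a / t) *\<^sub>R (- t) *\<^sub>R diag p (z - x) + (b / (1 - t)) *\<^sub>R (1 - t) *\<^sub>R w"
        by (auto simp: dilate_def set_plus_def translate_by_def)
      define w' where "w' = w + diag p x"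
      have "w' \<in> cart_power p K"
        using zw(2) by (auto simp: w'_def cart_power_def translate_by_def fun_vector_apply diag_def) 
      moreover have "y = (a *\<^sub>R (- 1) *\<^sub>R diag p z + b *\<^sub>R w') + ?v"
        unfolding zw(3) scale by (auto simp: fun_eq_iff fun_vector_apply w'_def diag_def algebra_simps)
      ultimately show "y \<in> (\<lambda>y. y + ?v) ` (dilate a ?A + dilate b ?B)"
        using zw(1) by (auto simp: dilate_def set_plus_def)
    next
      have scale: "(a / t) *\<^sub>R (- t) *\<^sub>R u + (b / (1 - t)) *\<^sub>R (1 - t) *\<^sub>R w = (- a) *\<^sub>R u + b *\<^sub>R w" for u w :: "nat \<Rightarrow> 'a"
        using t by simp
      fix y assume "y \<in> (\<lambda>y. y + ?v) ` (dilate a ?A + dilate b ?B)"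
      then obtain z w where zw: "z \<in> K" "w \<in> cart_power p K" "y = (a *\<^sub>R (- 1) *\<^sub>R diag p z + b *\<^sub>R w) + ?v"
        by (auto simp: dilate_def set_plus_def)
      define w' where "w' = w - diag p x"
      have "w' \<in> cart_power p ?K"
        using zw(2) by (auto simp: w'_def cart_power_def translate_by_def fun_vector_apply diag_def)
      moreover have "y = (a / t) *\<^sub>R (- t) *\<^sub>R diag p (z - x) + (b / (1 - t)) *\<^sub>R (1 - t) *\<^sub>R w'"
        unfolding zw(3) scale by (auto simp: fun_eq_iff fun_vector_apply w'_def diag_def algebra_simps)
      moreover have "z - x \<in> ?K" using zw(1) by (auto simp: translate_by_def)
      ultimately show "y \<in> dilate (a / t) ?A' + dilate (b / (1 - t)) ?B'"
        unfolding dilate_def set_plus_def by blast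
    qed
    moreover have "vol p ((\<lambda>y. y + ?v) ` (dilate a ?A + dilate b ?B)) = vol p (dilate a ?A + dilate b ?B)"
    proof (rule vol_translate)
      show "?v \<in> pow_space p" by (auto simp: pow_space_def diag_def fun_vector_apply)
      show "dilate a ?A + dilate b ?B \<in> sets borel"
        by (intro borel_compact_fun compact_sum_fun compact_dilate_fun compact_diag compact_cart_power K')
      show "dilate a ?A + dilate b ?B \<subseteq> pow_space p"
        by (intro dilate_plus_subset_pow_space dilate_subset_pow_space diag_subset cart_power_subset)
    qed
    moreover have "vol p (dilate (a / t) ?A' + dilate (b / (1 - t)) ?B') = (\<Sum>k\<le>?N. c k * (a / t) ^ k * (b / (1 - t)) ^ (?N - k))"
      using ab t by (intro c(2)) auto
    ultimately show ?thesis by (simp add: power_divide)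
  qed
  then have "mixed_volume p (replicate j ?A @ replicate (?N - j) ?B) = c j / (t ^ j * (1 - t) ^ (?N - j)) / real (?N choose j)"
    using K' j
    by (intro mixed_volume_two_bodies convex_dilate convex_diag convex_cart_power)
      (auto simp: dilate_def cart_power_def intro!: exI[of _ "\<lambda>i. if i < p then SOME x. x \<in> K else 0"] some_in_eq[THEN iffD2])
  then have "t ^ j * (1 - t) ^ (?N - j) * mixed_volume p (replicate j ?A @ replicate (?N - j) ?B) = c j / real (?N choose j)"
    using t by simp
  also have "\<dots> \<le> vol p (?A' \<or>\<^sub>c ?B')"
    using c(1)[of j] j by (simp add: pos_divide_le_eq mult.commute)
  finally show ?thesis .
qed

theorem proposition8p3:
  fixes S :: "(real ^ 'n) set"
  assumes n_ge_2: "CARD('n) \<ge> 2"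
    and S: "centered_simplex S"
    and hyp: "\<forall>p\<ge>1. \<forall>K :: (real ^ 'n) set. \<forall>t\<in>{0..1}.
      convex_body K \<and> aff_dim K = int CARD('n) \<longrightarrow>
      (\<exists>x\<in>K.
        vol p (dilate (- t) (diag p ` translate_by K x)
               \<or>\<^sub>c dilate (1 - t) (cart_power p (translate_by K x))) / measure lborel K ^ p
        \<le> vol p (dilate (- t) (diag p ` S)
               \<or>\<^sub>c dilate (1 - t) (cart_power p S)) / measure lborel S ^ p)"
  shows "\<forall>p\<ge>1. \<forall>j\<le>CARD('n). \<forall>K :: (real ^ 'n) set. convex_body K \<longrightarrow>
    mixed_volume p (replicate j (dilate (- 1) (diag p ` K))
                    @ replicate (CARD('n) * p - j) (cart_power p K))
    \<le> real (CARD('n) choose j) * measure lborel K ^ p"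
proof (intro allI impI)
  fix p j :: nat and K :: "(real ^ 'n) set"
  assume p: "1 \<le> p" and j: "j \<le> CARD('n)" and K: "convex_body K"
  obtain C where C: "\<not> affine_dependent C" "card C = DIM(real ^ 'n) + 1" "\<Sum>C = 0" "S = convex hull C"
    using S by (auto simp: centered_simplex_def)
  interpret simplex_vertices C by standard fact+
  let ?n = "CARD('n)"
  have dim: "DIM(real ^ 'n) = ?n" by simp
  have jN: "j \<le> ?n * p" using j p by (metis le_trans mult_le_mono2 nat_mult_1_right)
  let ?V = "mixed_volume p (replicate j (dilate (- 1) (diag p ` K)) @ replicate (?n * p - j) (cart_power p K))"
  show "?V \<le> real (?n choose j) * measure lborel K ^ p"
  proof (cases "interior K = {}")
    case True
    then show ?thesis using mixed_volume_degenerate[OF K True p] jN by simp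
  next
    case False
    \<comment> \<open>This value lies between j / (n + 1) and (j + 1) / (n + 1), as the covering of
      the simplex join demands, and strictly between 0 and 1 even for j = 0 and j = n, so that the
      powers of t and 1 - t can be cancelled.\<close>
    define t where "t = real (j + 1) / real (?n + 2)"
    have t: "0 < t" "t < 1" using j by (auto simp: t_def)
    have tj: "real j \<le> real (?n + 1) * t" "real (?n + 1) * t \<le> real j + 1"
    proof -
      have "j * (?n + 2) \<le> (?n + 1) * (j + 1)" "(?n + 1) * (j + 1) \<le> (j + 1) * (?n + 2)"
        using j by (auto simp: algebra_simps)
      then have "real (j * (?n + 2)) \<le> real ((?n + 1) * (j + 1))" "real ((?n + 1) * (j + 1)) \<le> real ((j + 1) * (?n + 2))"
        by (simp_all only: of_nat_le_iff)
      then show "real j \<le> real (?n + 1) * t" "real (?n + 1) * t \<le> real j + 1"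
        by (simp_all add: t_def pos_le_divide_eq pos_divide_le_eq algebra_simps)
    qed
    have Kc: "compact K" using K by (simp add: convex_body_def)
    have "aff_dim K = int ?n" using aff_dim_nonempty_interior[OF False] by simp
    then obtain x where x: "x \<in> K"
      "vol p (dilate (- t) (diag p ` translate_by K x) \<or>\<^sub>c dilate (1 - t) (cart_power p (translate_by K x))) / measure lborel K ^ p
        \<le> vol p (dilate (- t) (diag p ` S) \<or>\<^sub>c dilate (1 - t) (cart_power p S)) / measure lborel S ^ p"
      using hyp p K t by (metis atLeastAtMost_iff less_imp_le)
    let ?J = "vol p (dilate (- t) (diag p ` translate_by K x) \<or>\<^sub>c dilate (1 - t) (cart_power p (translate_by K x)))"
    let ?c = "real (?n choose j) * t ^ j * (1 - t) ^ (?n * p - j)"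
    have "?J / measure lborel K ^ p \<le> ?c"
    \<comment> \<open>If this power were 0, the right-hand side of the hypothesis would be 0 by the
      convention for division by 0, and the bound would follow from \<open>0 \<le> ?c\<close>.
      Positivity of the volume of S is thereby left open.\<close>
    proof (cases "measure lborel S ^ p = 0")
      case True
      have "?J / measure lborel K ^ p \<le> 0" using x(2) unfolding True by (simp only: div_by_0)
      also have "0 \<le> ?c" using t by simp
      finally show ?thesis .
    next
      case False
      then have "0 < measure lborel S ^ p" by (simp only: less_le) simp
      then have "vol p (dilate (- t) (diag p ` S) \<or>\<^sub>c dilate (1 - t) (cart_power p S)) / measure lborel S ^ p \<le> ?c"
        using vol_join_power_le[OF p t, of j] tj j unfolding C(4) dim by (simp add: pos_divide_le_eq)
      then show ?thesis using x(2) by linarith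
    qed
    moreover have "0 < measure lborel K"
    proof -
      obtain z r where "0 < r" "ball z r \<subseteq> K" using False by (auto simp: mem_interior)
      then have "measure lborel (ball z r) \<le> measure lborel K"
        using Kc by (intro measure_mono_fmeasurable fmeasurable_compact) auto
      then show ?thesis using content_ball_pos[OF \<open>0 < r\<close>, of z] by linarith
    qed
    ultimately have "?J \<le> ?c * measure lborel K ^ p" by (simp add: pos_divide_le_eq)
    then have "t ^ j * (1 - t) ^ (?n * p - j) * ?V \<le> ?c * measure lborel K ^ p"
      using mixed_volume_le_vol_join[OF K False x(1) t, of j p] jN by simp
    then have "(t ^ j * (1 - t) ^ (?n * p - j)) * ?V \<le> (t ^ j * (1 - t) ^ (?n * p - j)) * (real (?n choose j) * measure lborel K ^ p)"
      by (simp only: mult_ac)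
    then show ?thesis using t by (subst (asm) mult_le_cancel_left_pos) auto
  qed
qed

end
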